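(* Let $\tau:E\to\mathbb{R}$ be a bundle with $\dim E=n+1$, and let $R$ be a type $(1,1)$ tensor on $E$ with $R(dt)=0$, vanishing Nijenhuis torsion, and algebraically diagonalizable with distinct eigenvalues. Let $\widetilde{R}$ be its complete lift to $J^1\tau^*$ and let $\omega_R=dR^h$, where $R^h$ is the horizontal lift of $R$ to $J^1\tau^*$. Let $h$ be a section of $\rho:T^*E\to J^1\tau^*$ with Hamiltonian vector field $X_h$ on $J^1\tau^*$, and assume that $X_h,\widetilde{R}(X_h),\ldots,\widetilde{R}^n(X_h)$ are linearly independent. Then the distribution $\mathcal{D}_h=\mathrm{sp}\{X_h,\widetilde{R}(X_h),\ldots,\widetilde{R}^n(X_h)\}$ on $J^1\tau^*$ is integrable if and only if $$(\mathcal{L}_{X_h}\omega_R)\big|_{\mathcal{D}_h}=0,$$ i.e. $(\mathcal{L}_{X_h}\omega_R)(X,Y)=0$ for all $X,Y\in\mathcal{D}_h$.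
   Context: All objects are smooth. $E$ has bundle coordinates $(t,q^i)$, $i=1,\ldots,n$, where $t$ is the (pulled-back) coordinate of $\mathbb{R}$. $T^*E$ has natural coordinates $(t,q^i,p_0,p_i)$, canonical 1-form $\theta_E=p_0dt+p_idq^i$ and symplectic form $\omega_E=d\theta_E$. $J^1\tau^*:=T^*E/\langle dt\rangle$, with coordinates $(t,q^i,p_i)$; $\rho:T^*E\to J^1\tau^*$ and $\pi:J^1\tau^*\to E$ are the natural projections. A section $h$ of $\rho$ is locally $h:(t,q,p)\mapsto(t,q,p_0=-H(t,q,p),p)$. $X_h$ on $J^1\tau^*$ is defined by $i_{X_h}h^*\omega_E=0$, $\langle X_h,dt\rangle=1$; locally $X_h=\frac{\partial}{\partial t}+\frac{\partial H}{\partial p_i}\frac{\partial}{\partial q^i}-\frac{\partial H}{\partial q^i}\frac{\partial}{\partial p_i}$. A $(1,1)$ tensor acts on vector fields and on 1-forms, with $\langle X,R(\alpha)\rangle=\langle R(X),\alpha\rangle$. If $R(dt)=0$, then $R=R^i_j(t,q)\frac{\partial}{\partial q^i}\otimes dq^j+R^i_0(t,q)\frac{\partial}{\partial q^i}\otimes dt$. "Algebraically diagonalizable with distinct eigenvalues" means that at each $e\in E$ the endomorphism $R_e$ of $T_eE$ is diagonalizable with $n+1$ distinct eigenvalues (one of which is $0$). $N_R(X,Y)=[RX,RY]+R^2[X,Y]-R[RX,Y]-R[X,RY]$ is the Nijenhuis torsion. $\tau_R:T^*E\to T^*E$ is $(t,q^i,p_0,p_i)\mapsto(t,q^i,R^i_0p_i,R^i_jp_i)$.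 The complete lift $\widetilde{R}_{T^*}$ to $T^*E$ is defined by $i_{\widetilde{R}_{T^*}(Z)}d\theta_E=i_Z(\tau_R^*d\theta_E)$ for all vector fields $Z$ on $T^*E$. The complete lift $\widetilde{R}$ to $J^1\tau^*$ is the $(1,1)$ tensor that is $\rho$-related to $\widetilde{R}_{T^*}$ (if $Y$ on $T^*E$ is $\rho$-related to $X$ on $J^1\tau^*$, then $\widetilde{R}_{T^*}(Y)$ is $\rho$-related to $\widetilde{R}(X)$); in coordinates $$\widetilde{R}=R^i_j\Big(\tfrac{\partial}{\partial q^i}\otimes dq^j+\tfrac{\partial}{\partial p_j}\otimes dp_i\Big)+R^i_0\tfrac{\partial}{\partial q^i}\otimes dt+p_i\Big(\tfrac{\partial R^i_j}{\partial q^k}-\tfrac{\partial R^i_k}{\partial q^j}\Big)\tfrac{\partial}{\partial p_j}\otimes dq^k+p_i\Big(\tfrac{\partial R^i_k}{\partial t}-\tfrac{\partial R^i_0}{\partial q^k}\Big)\tfrac{\partial}{\partial p_k}\otimes dt.$$ $R^h$ is the 1-form on $J^1\tau^*$ given by $\langle X_m,R^h_m\rangle=\langle T\pi(X_m),R_{\pi(m)}(m)\rangle$, $m\in J^1\tau^*$ (well defined since $R(dt)=0$); in coordinates $R^h=p_iR^i_jdq^j+p_iR^i_0dt$. *)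

theory Defs
  imports "HOL-Analysis.Analysis"
begin

section \<open>Calculus on open subsets of Euclidean spaces\<close>

abbreviation tangent_map ::
    "('a::euclidean_space \<Rightarrow> 'b::euclidean_space) \<Rightarrow> 'a \<Rightarrow> 'a \<Rightarrow> 'b" where
  "tangent_map f x \<equiv> frechet_derivative f (at x)"

text \<open>Only meant for open sets: \<open>k\<close> times continuously differentiable.\<close>

fun Ck_on :: "nat \<Rightarrow> ('a::euclidean_space \<Rightarrow> 'b::euclidean_space) \<Rightarrow> 'a set \<Rightarrow> bool" where
  "Ck_on 0 f S \<longleftrightarrow> continuous_on S f"
| "Ck_on (Suc k) f S \<longleftrightarrow>
     (\<forall>x\<in>S. f differentiable (at x)) \<and> (\<forall>v. Ck_on k (\<lambda>x. tangent_map f x v) S)"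

definition smooth_on :: "('a::euclidean_space \<Rightarrow> 'b::euclidean_space) \<Rightarrow> 'a set \<Rightarrow> bool" where
  "smooth_on f S \<longleftrightarrow> (\<forall>k. Ck_on k f S)"

text \<open>
  Vector fields are maps \<open>'a \<Rightarrow> 'a\<close>, (1,1) tensor fields are maps \<open>'a \<Rightarrow> 'a \<Rightarrow> 'a\<close>, and
  1-forms and 2-forms take a point and one or two tangent vectors.
\<close>

definition lie_bracket ::
    "('a::euclidean_space \<Rightarrow> 'a) \<Rightarrow> ('a \<Rightarrow> 'a) \<Rightarrow> 'a \<Rightarrow> 'a" where
  "lie_bracket X Y x = tangent_map Y x (X x) - tangent_map X x (Y x)"

definition nijenhuis_torsion ::
    "('a::euclidean_space \<Rightarrow> 'a \<Rightarrow> 'a) \<Rightarrow> ('a \<Rightarrow> 'a) \<Rightarrow> ('a \<Rightarrow> 'a) \<Rightarrow> 'a \<Rightarrow> 'a" where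
  "nijenhuis_torsion L X Y x =
     lie_bracket (\<lambda>y. L y (X y)) (\<lambda>y. L y (Y y)) x + L x (L x (lie_bracket X Y x))
     - L x (lie_bracket (\<lambda>y. L y (X y)) Y x) - L x (lie_bracket X (\<lambda>y. L y (Y y)) x)"

text \<open>\<open>d\<alpha>(U,V) = U(\<alpha>(V)) - V(\<alpha>(U)) - \<alpha>([U,V])\<close>, evaluated on constant \<open>U\<close> and \<open>V\<close>.\<close>

definition ext_deriv ::
    "('a::euclidean_space \<Rightarrow> 'a \<Rightarrow> real) \<Rightarrow> 'a \<Rightarrow> 'a \<Rightarrow> 'a \<Rightarrow> real" where
  "ext_deriv \<alpha> x u v = tangent_map (\<lambda>y. \<alpha> y v) x u - tangent_map (\<lambda>y. \<alpha> y u) x v"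

definition pullback2 ::
    "('a::euclidean_space \<Rightarrow> 'b::euclidean_space) \<Rightarrow> ('b \<Rightarrow> 'b \<Rightarrow> 'b \<Rightarrow> real) \<Rightarrow> 'a \<Rightarrow> 'a \<Rightarrow> 'a \<Rightarrow> real"
  where
  "pullback2 f \<omega> x u v = \<omega> (f x) (tangent_map f x u) (tangent_map f x v)"

text \<open>
  \<open>(L\<^sub>X \<omega>)(U,V) = X(\<omega>(U,V)) - \<omega>([X,U],V) - \<omega>(U,[X,V])\<close>, evaluated on constant \<open>U\<close> and \<open>V\<close>,
  for which \<open>[X,U] = - DX(U)\<close>.
\<close>

definition lie_deriv2 ::
    "('a::euclidean_space \<Rightarrow> 'a) \<Rightarrow> ('a \<Rightarrow> 'a \<Rightarrow> 'a \<Rightarrow> real) \<Rightarrow> 'a \<Rightarrow> 'a \<Rightarrow> 'a \<Rightarrow> real" where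
  "lie_deriv2 X \<omega> x u v =
     tangent_map (\<lambda>y. \<omega> y u v) x (X x)
     + \<omega> x (tangent_map X x u) v + \<omega> x u (tangent_map X x v)"


section \<open>Smooth manifolds and fibre bundles over the real line\<close>

text \<open>A chart is a pair of an open domain and a coordinate map (whose values outside the
  domain are irrelevant).\<close>

type_synonym ('a, 'b) chart = "'a set \<times> ('a \<Rightarrow> 'b)"

abbreviation chart_image :: "('a, 'b) chart \<Rightarrow> 'b set" where
  "chart_image c \<equiv> snd c ` fst c"

abbreviation chart_inv :: "('a, 'b) chart \<Rightarrow> 'b \<Rightarrow> 'a" where
  "chart_inv c \<equiv> inv_into (fst c) (snd c)"

definition is_chart :: "('a::topological_space, 'b::euclidean_space) chart \<Rightarrow> bool" where
  "is_chart c \<longleftrightarrow> open (fst c) \<and> open (chart_image c)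
     \<and> homeomorphism (fst c) (chart_image c) (snd c) (chart_inv c)"

definition transition :: "('a, 'b) chart \<Rightarrow> ('a, 'b) chart \<Rightarrow> 'b \<Rightarrow> 'b" where
  "transition c d = snd d \<circ> chart_inv c"

definition compatible :: "('a, 'b::euclidean_space) chart \<Rightarrow> ('a, 'b) chart \<Rightarrow> bool" where
  "compatible c d \<longleftrightarrow> smooth_on (transition c d) (snd c ` (fst c \<inter> fst d))
     \<and> smooth_on (transition d c) (snd d ` (fst c \<inter> fst d))"

definition smooth_atlas :: "('a::topological_space, 'b::euclidean_space) chart set \<Rightarrow> bool" where
  "smooth_atlas A \<longleftrightarrow> (\<forall>c\<in>A. is_chart c) \<and> (\<Union>c\<in>A. fst c) = UNIV
     \<and> (\<forall>c\<in>A. \<forall>d\<in>A. compatible c d)"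

definition smooth_map ::
    "('a::topological_space, 'b::euclidean_space) chart set
     \<Rightarrow> ('c::topological_space, 'd::euclidean_space) chart set \<Rightarrow> ('a \<Rightarrow> 'c) \<Rightarrow> 'a set \<Rightarrow> bool" where
  "smooth_map A B f W \<longleftrightarrow> continuous_on W f
     \<and> (\<forall>c\<in>A. \<forall>d\<in>B. smooth_on (snd d \<circ> f \<circ> chart_inv c) (snd c ` (fst c \<inter> W \<inter> f -` fst d)))"

definition line_times :: "('f, 'b) chart set \<Rightarrow> (real \<times> 'f, real \<times> 'b) chart set" where
  "line_times B = {(UNIV \<times> V, map_prod id g) | V g. (V, g) \<in> B}"

text \<open>
  A locally trivial smooth bundle \<open>\<tau>\<close> from the manifold \<open>'e\<close> (with atlas \<open>A\<close>, dimension
  \<open>n + 1\<close> for \<open>n = CARD('n)\<close>) to the real line, with typical fibre the manifold \<open>'f\<close>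
  (with atlas \<open>B\<close>).
\<close>

definition bundle_over_line ::
    "('e::{t2_space,second_countable_topology}, real \<times> (real^'n)) chart set
     \<Rightarrow> ('f::{t2_space,second_countable_topology}, real^'n) chart set \<Rightarrow> ('e \<Rightarrow> real) \<Rightarrow> bool" where
  "bundle_over_line A B \<tau> \<longleftrightarrow>
     smooth_atlas A \<and> smooth_atlas B \<and> smooth_map A {(UNIV, id)} \<tau> UNIV
     \<and> (\<forall>s. \<exists>I \<phi>. open I \<and> s \<in> I \<and> bij_betw \<phi> (\<tau> -` I) (I \<times> UNIV)
          \<and> (\<forall>e\<in>\<tau> -` I. fst (\<phi> e) = \<tau> e)
          \<and> smooth_map A (line_times B) \<phi> (\<tau> -` I)
          \<and> smooth_map (line_times B) A (inv_into (\<tau> -` I) \<phi>) (I \<times> UNIV))"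

text \<open>The charts \<open>(t,q)\<close> of the smooth structure whose first coordinate is that of the base.\<close>

definition bundle_charts ::
    "('e::topological_space, real \<times> (real^'n)) chart set \<Rightarrow> ('e \<Rightarrow> real)
     \<Rightarrow> ('e, real \<times> (real^'n)) chart set" where
  "bundle_charts A \<tau> = {c. is_chart c \<and> (\<forall>d\<in>A. compatible c d)
     \<and> (\<forall>e\<in>fst c. fst (snd c e) = \<tau> e)}"

definition charts_at ::
    "('e::topological_space, real \<times> (real^'n)) chart set \<Rightarrow> ('e \<Rightarrow> real) \<Rightarrow> 'e
     \<Rightarrow> ('e, real \<times> (real^'n)) chart set" where
  "charts_at A \<tau> e = {c \<in> bundle_charts A \<tau>. e \<in> fst c}"


section \<open>Type (1,1) tensor fields on the total space\<close>

text \<open>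
  A tensor at a point is the family of its representatives in the bundle charts, subject to the
  transformation law: \<open>R e c\<close> is the representative in the chart \<open>c\<close> of the endomorphism
  \<open>R\<^sub>e\<close> of the tangent space at \<open>e\<close>.
\<close>

type_synonym ('e, 'n) tensor11 =
  "'e \<Rightarrow> ('e, real \<times> (real, 'n) vec) chart \<Rightarrow> real \<times> (real, 'n) vec \<Rightarrow> real \<times> (real, 'n) vec"

definition local_tensor ::
    "('e, real \<times> (real^'n)) chart \<Rightarrow> ('e, 'n) tensor11
     \<Rightarrow> real \<times> (real^'n) \<Rightarrow> real \<times> (real^'n) \<Rightarrow> real \<times> (real^'n)" where
  "local_tensor c R x = R (chart_inv c x) c"

definition smooth_tensor11 ::
    "('e::topological_space, real \<times> (real^'n)) chart set \<Rightarrow> ('e \<Rightarrow> real) \<Rightarrow> ('e, 'n) tensor11 \<Rightarrow> bool"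
  where
  "smooth_tensor11 A \<tau> R \<longleftrightarrow>
     (\<forall>e. \<forall>c\<in>charts_at A \<tau> e. linear (R e c))
     \<and> (\<forall>e. \<forall>c\<in>charts_at A \<tau> e. \<forall>d\<in>charts_at A \<tau> e. \<forall>v.
          R e d (tangent_map (transition c d) (snd c e) v)
          = tangent_map (transition c d) (snd c e) (R e c v))
     \<and> (\<forall>c\<in>bundle_charts A \<tau>. \<forall>v. smooth_on (\<lambda>x. local_tensor c R x v) (chart_image c))"

text \<open>\<open>R(dt) = 0\<close>, in view of \<open>\<langle>v, R(dt)\<rangle> = \<langle>R v, dt\<rangle>\<close>.\<close>

definition kills_dt ::
    "('e::topological_space, real \<times> (real^'n)) chart set \<Rightarrow> ('e \<Rightarrow> real) \<Rightarrow> ('e, 'n) tensor11 \<Rightarrow> bool"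
  where
  "kills_dt A \<tau> R \<longleftrightarrow> (\<forall>e. \<forall>c\<in>charts_at A \<tau> e. \<forall>v. fst (R e c v) = 0)"

definition torsion_free ::
    "('e::topological_space, real \<times> (real^'n)) chart set \<Rightarrow> ('e \<Rightarrow> real) \<Rightarrow> ('e, 'n) tensor11 \<Rightarrow> bool"
  where
  "torsion_free A \<tau> R \<longleftrightarrow>
     (\<forall>c\<in>bundle_charts A \<tau>. \<forall>X Y.
        smooth_on X (chart_image c) \<and> smooth_on Y (chart_image c)
        \<longrightarrow> (\<forall>x\<in>chart_image c. nijenhuis_torsion (local_tensor c R) X Y x = 0))"

text \<open>There is a basis of eigenvectors with pairwise distinct eigenvalues.\<close>

definition diagonalizable_distinct :: "('a::euclidean_space \<Rightarrow> 'a) \<Rightarrow> bool" where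
  "diagonalizable_distinct f \<longleftrightarrow>
     (\<exists>S \<mu>. independent S \<and> span S = UNIV \<and> inj_on \<mu> S \<and> (\<forall>b\<in>S. f b = \<mu> b *\<^sub>R b))"


section \<open>The cotangent bundle and its quotient by \<open>dt\<close>\<close>

text \<open>
  A covector at \<open>e\<close> is the family of its component vectors \<open>(p\<^sub>0,p)\<close> in the bundle charts
  around \<open>e\<close> (and 0 in all other charts); components pair with tangent vectors through the
  inner product.
\<close>

type_synonym ('e, 'n) covector =
  "'e \<times> (('e, real \<times> (real, 'n) vec) chart \<Rightarrow> real \<times> (real, 'n) vec)"

definition cotangent_bundle ::
    "('e::topological_space, real \<times> (real^'n)) chart set \<Rightarrow> ('e \<Rightarrow> real) \<Rightarrow> ('e, 'n) covector set" where
  "cotangent_bundle A \<tau> = {(e, a).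
     (\<forall>c. c \<notin> charts_at A \<tau> e \<longrightarrow> a c = 0)
     \<and> (\<forall>c\<in>charts_at A \<tau> e. \<forall>d\<in>charts_at A \<tau> e. \<forall>v.
          a d \<bullet> tangent_map (transition c d) (snd c e) v = a c \<bullet> v)}"

definition mod_dt ::
    "('e::topological_space, real \<times> (real^'n)) chart set \<Rightarrow> ('e \<Rightarrow> real)
     \<Rightarrow> (('e, 'n) covector \<times> ('e, 'n) covector) set" where
  "mod_dt A \<tau> = {((e, a), (e', b)).
     (e, a) \<in> cotangent_bundle A \<tau> \<and> (e', b) \<in> cotangent_bundle A \<tau> \<and> e' = e
     \<and> (\<exists>s. \<forall>c\<in>charts_at A \<tau> e. b c = a c + s *\<^sub>R (1, 0))}"

definition J1_dual ::
    "('e::topological_space, real \<times> (real^'n)) chart set \<Rightarrow> ('e \<Rightarrow> real) \<Rightarrow> ('e, 'n) covector set set"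
  where
  "J1_dual A \<tau> = cotangent_bundle A \<tau> // mod_dt A \<tau>"

definition rho ::
    "('e::topological_space, real \<times> (real^'n)) chart set \<Rightarrow> ('e \<Rightarrow> real)
     \<Rightarrow> ('e, 'n) covector \<Rightarrow> ('e, 'n) covector set" where
  "rho A \<tau> z = mod_dt A \<tau> `` {z}"

text \<open>Coordinates \<open>((t,q),(p\<^sub>0,p))\<close> on the cotangent bundle and \<open>((t,q),p)\<close> on its quotient;
  in these, \<open>rho\<close> is \<open>rho_loc\<close> and the projection of the quotient to the total space is \<open>fst\<close>.\<close>

type_synonym 'n base_coords = "real \<times> (real, 'n) vec"
type_synonym 'n cot_coords = "(real \<times> (real, 'n) vec) \<times> (real \<times> (real, 'n) vec)"
type_synonym 'n J1_coords = "(real \<times> (real, 'n) vec) \<times> (real, 'n) vec"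

definition rho_loc :: "'n::finite cot_coords \<Rightarrow> 'n J1_coords" where
  "rho_loc z = (fst z, snd (snd z))"

definition cot_chart :: "('e, real \<times> (real^'n)) chart \<Rightarrow> ('e, 'n) covector \<Rightarrow> 'n cot_coords" where
  "cot_chart c z = (snd c (fst z), snd z c)"

definition J1_chart :: "('e, real \<times> (real^'n)) chart \<Rightarrow> ('e, 'n) covector set \<Rightarrow> 'n J1_coords" where
  "J1_chart c m = rho_loc (cot_chart c (SOME z. z \<in> m))"

definition J1_over ::
    "('e::topological_space, real \<times> (real^'n)) chart set \<Rightarrow> ('e \<Rightarrow> real)
     \<Rightarrow> ('e, real \<times> (real^'n)) chart \<Rightarrow> ('e, 'n) covector set set" where
  "J1_over A \<tau> c = {m \<in> J1_dual A \<tau>. fst (SOME z. z \<in> m) \<in> fst c}"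

definition J1_image :: "('e, real \<times> (real^'n)) chart \<Rightarrow> 'n J1_coords set" where
  "J1_image c = chart_image c \<times> UNIV"

definition local_section ::
    "('e::topological_space, real \<times> (real^'n)) chart set \<Rightarrow> ('e \<Rightarrow> real)
     \<Rightarrow> ('e, real \<times> (real^'n)) chart \<Rightarrow> (('e, 'n) covector set \<Rightarrow> ('e, 'n) covector)
     \<Rightarrow> 'n J1_coords \<Rightarrow> 'n cot_coords" where
  "local_section A \<tau> c h x = cot_chart c (h (inv_into (J1_over A \<tau> c) (J1_chart c) x))"

definition smooth_section ::
    "('e::topological_space, real \<times> (real^'n)) chart set \<Rightarrow> ('e \<Rightarrow> real)
     \<Rightarrow> (('e, 'n) covector set \<Rightarrow> ('e, 'n) covector) \<Rightarrow> bool" where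
  "smooth_section A \<tau> h \<longleftrightarrow>
     (\<forall>m\<in>J1_dual A \<tau>. h m \<in> cotangent_bundle A \<tau> \<and> rho A \<tau> (h m) = m)
     \<and> (\<forall>c\<in>bundle_charts A \<tau>. smooth_on (local_section A \<tau> c h) (J1_image c))"


section \<open>Hamiltonian vector field and lifts, in bundle coordinates\<close>

text \<open>In this section \<open>h\<close> and \<open>L\<close> are the local representatives of the section and of the
  (1,1) tensor field in a fixed bundle chart.\<close>

definition theta :: "'n::finite cot_coords \<Rightarrow> 'n cot_coords \<Rightarrow> real" where
  "theta z Z = snd z \<bullet> fst Z"

definition omega :: "'n::finite cot_coords \<Rightarrow> 'n cot_coords \<Rightarrow> 'n cot_coords \<Rightarrow> real" where
  "omega = ext_deriv theta"

definition hamiltonian_vf ::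
    "('n::finite J1_coords \<Rightarrow> 'n cot_coords) \<Rightarrow> 'n J1_coords \<Rightarrow> 'n J1_coords" where
  "hamiltonian_vf h m = (THE X. (\<forall>v. pullback2 h omega m X v = 0) \<and> fst (fst X) = 1)"

text \<open>The adjoint of \<open>L x\<close> is the action of the tensor on covectors.\<close>

definition tau_map ::
    "('n::finite base_coords \<Rightarrow> 'n base_coords \<Rightarrow> 'n base_coords) \<Rightarrow> 'n cot_coords \<Rightarrow> 'n cot_coords"
  where
  "tau_map L z = (fst z, adjoint (L (fst z)) (snd z))"

definition lift_cot ::
    "('n::finite base_coords \<Rightarrow> 'n base_coords \<Rightarrow> 'n base_coords)
     \<Rightarrow> 'n cot_coords \<Rightarrow> 'n cot_coords \<Rightarrow> 'n cot_coords" where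
  "lift_cot L z Z = (THE W. \<forall>V. omega z W V = pullback2 (tau_map L) omega z Z V)"

text \<open>The tensor that is \<open>rho\<close>-related to \<open>lift_cot L\<close>.\<close>

definition lift_J1 ::
    "('n::finite base_coords \<Rightarrow> 'n base_coords \<Rightarrow> 'n base_coords)
     \<Rightarrow> 'n J1_coords \<Rightarrow> 'n J1_coords \<Rightarrow> 'n J1_coords" where
  "lift_J1 L m v = (THE w. \<forall>z Z. rho_loc z = m \<and> tangent_map rho_loc z Z = v
     \<longrightarrow> tangent_map rho_loc z (lift_cot L z Z) = w)"

text \<open>The class \<open>m\<close> with coordinates \<open>(x,p)\<close> is represented by the covector \<open>(0,p)\<close>; the choice
  of the component \<open>p\<^sub>0\<close> is immaterial because the tensor annihilates \<open>dt\<close>.\<close>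

definition horizontal_lift ::
    "('n::finite base_coords \<Rightarrow> 'n base_coords \<Rightarrow> 'n base_coords)
     \<Rightarrow> 'n J1_coords \<Rightarrow> 'n J1_coords \<Rightarrow> real" where
  "horizontal_lift L m v = tangent_map fst m v \<bullet> adjoint (L (fst m)) (0, snd m)"

definition omega_R ::
    "('n::finite base_coords \<Rightarrow> 'n base_coords \<Rightarrow> 'n base_coords)
     \<Rightarrow> 'n J1_coords \<Rightarrow> 'n J1_coords \<Rightarrow> 'n J1_coords \<Rightarrow> real" where
  "omega_R L = ext_deriv (horizontal_lift L)"

definition iterate ::
    "('n::finite base_coords \<Rightarrow> 'n base_coords \<Rightarrow> 'n base_coords)
     \<Rightarrow> ('n J1_coords \<Rightarrow> 'n cot_coords) \<Rightarrow> nat \<Rightarrow> 'n J1_coords \<Rightarrow> 'n J1_coords" where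
  "iterate L h k m = (lift_J1 L m ^^ k) (hamiltonian_vf h m)"

definition D_h ::
    "('n::finite base_coords \<Rightarrow> 'n base_coords \<Rightarrow> 'n base_coords)
     \<Rightarrow> ('n J1_coords \<Rightarrow> 'n cot_coords) \<Rightarrow> 'n J1_coords \<Rightarrow> 'n J1_coords set" where
  "D_h L h m = span ((\<lambda>k. iterate L h k m) ` {..CARD('n)})"

text \<open>
  A distribution of rank \<open>n + 1\<close> is integrable if through every point passes an integral manifold, i.e.
  the image of an injective immersion of an open subset of \<open>(n + 1)\<close>-space whose tangent
  spaces are those of the distribution.
\<close>

definition integral_manifold ::
    "('n::finite J1_coords \<Rightarrow> 'n J1_coords set) \<Rightarrow> 'n base_coords set
     \<Rightarrow> ('n base_coords \<Rightarrow> 'n J1_coords) \<Rightarrow> bool" where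
  "integral_manifold \<Delta> W \<phi> \<longleftrightarrow> open W \<and> smooth_on \<phi> W \<and> inj_on \<phi> W
     \<and> (\<forall>w\<in>W. inj (tangent_map \<phi> w) \<and> range (tangent_map \<phi> w) = \<Delta> (\<phi> w))"

definition integrable_distribution ::
    "'n::finite J1_coords set \<Rightarrow> ('n J1_coords \<Rightarrow> 'n J1_coords set) \<Rightarrow> bool" where
  "integrable_distribution S \<Delta> \<longleftrightarrow>
     (\<forall>m\<in>S. \<exists>W \<phi>. integral_manifold \<Delta> W \<phi> \<and> m \<in> \<phi> ` W \<and> \<phi> ` W \<subseteq> S)"

end

theory Submission
  imports Defs
begin

text \<open>
  Work in one bundle chart and put \<open>Y\<^sub>k = N\<^sup>k X\<close>, where \<open>X\<close> is the Hamiltonian field and \<open>N\<close> the complete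
  lift. Let \<open>\<omega>\<^sub>0 = h\<^sup>* \<omega>\<^sub>E\<close> and let \<open>\<omega>\<^sub>k\<close> be the differential of the horizontal lift of \<open>L\<^sup>k\<close>. Vanishing
  torsion gives \<open>\<omega>\<^sub>k (N u, v) = \<omega>\<^sub>k\<^sub>+\<^sub>1 (u, v)\<close> (for \<open>k = 0\<close> only if \<open>dt(v) = 0\<close>), so all \<open>\<omega>\<^sub>k\<close> vanish on
  the span \<open>D\<close> of the \<open>Y\<^sub>k\<close>. As \<open>\<omega>\<^sub>0\<close> has kernel spanned by \<open>X\<close>, counting dimensions shows that \<open>D\<close> is its own
  \<open>\<omega>\<^sub>0\<close>-orthogonal space.

  The Lie derivative of \<open>\<omega>\<^sub>1\<close> along \<open>X\<close> is the differential of \<open>i\<^sub>X \<omega>\<^sub>1\<close>, a 1-form that vanishes on \<open>D\<close>; so it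
  vanishes on \<open>D\<close> if \<open>D\<close> has integral manifolds. Conversely, with \<open>c(i,j,k) = \<omega>\<^sub>0 ([Y\<^sub>i, Y\<^sub>j], Y\<^sub>k)\<close> the hypothesis
  is \<open>c(i,j,1) = 0\<close>, and closedness of \<open>\<omega>\<^sub>q\<close> gives
  \<open>c(i,j,k+q) + c(j,k,i+q) + c(k,i,j+q) = 0\<close> for all \<open>q\<close>. The cases \<open>q = 0\<close> and \<open>q = 1\<close> with \<open>i = 0\<close> force
  \<open>c(0,j,k) = 0\<close>, then \<open>i = 0\<close> and arbitrary \<open>q\<close> force \<open>c = 0\<close>. Hence \<open>D\<close> is involutive, and the
  Frobenius theorem applies.
\<close>

text \<open>Self-orthogonality of \<open>D\<close> matters because it turns the membership of a
  bracket in \<open>D\<close> into the scalar equations \<open>c(i,j,k) = 0\<close>. The indices run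
  over all natural numbers although \<open>D\<close> is spanned by \<open>n + 1\<close> fields:
  every later \<open>Y\<^sub>k\<close> lies in \<open>D\<close> too, being
  \<open>\<omega>\<^sub>0\<close>-orthogonal to it. The unbounded third index is what allows the
  descent \<open>c(0,j+1,k) = c(0,k,j+1) = c(0,j,k+1)\<close>, which lowers \<open>j\<close> at the
  price of raising \<open>k\<close> and stops at \<open>c(0,0,k) = 0\<close>. The restriction
  \<open>dt(v) = 0\<close> for \<open>k = 0\<close> has its origin in the term \<open>-H dt\<close>
  of the canonical form, which \<open>N\<close> does not see. It is met wherever it matters:
  \<open>dt(Y\<^sub>k)\<close> is constant, so \<open>dt\<close> annihilates every bracket and every
  \<open>Y\<^sub>k\<close> with \<open>k > 0\<close>. This also yields
  \<open>\<omega>\<^sub>q([Y\<^sub>i,Y\<^sub>j],Y\<^sub>k) = c(i,j,k+q)\<close>, which lets one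
  function \<open>c\<close> carry the closedness of all the forms at once.\<close>

section \<open>Smooth functions on open sets\<close>

lemma differentiable_cong_open:
  assumes "open S" "x \<in> S" "\<And>y. y \<in> S \<Longrightarrow> f y = g y" "f differentiable (at x)"
  shows "g differentiable (at x)"
  using assms has_derivative_transform_within_open unfolding differentiable_def by blast

lemma tangent_map_eq:
  assumes "(f has_derivative f') (at x)"
  shows "tangent_map f x = f'"
  using frechet_derivative_at[OF assms] by simp

lemma has_derivative_tangent_map:
  "f differentiable (at x) \<Longrightarrow> (f has_derivative tangent_map f x) (at x)"
  using frechet_derivative_works by blast

lemma tangent_map_cong_open:
  assumes "open S" "x \<in> S" "\<And>y. y \<in> S \<Longrightarrow> f y = g y" "f differentiable (at x)"
  shows "tangent_map g x = tangent_map f x"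
  using frechet_derivative_transform_within_open[of f x S g] assms by simp

text \<open>Smoothness of a family \<open>L x\<close> is always stated for a fixed argument. This
  expansion reduces a moving argument to finitely many fixed ones with scalar coefficients.\<close>

lemma linear_expand_Basis:
  fixes f :: "'a::euclidean_space \<Rightarrow> 'b::real_vector"
  assumes "linear f"
  shows "f v = (\<Sum>b\<in>Basis. (v \<bullet> b) *\<^sub>R f b)"
proof -
  have "f v = f (\<Sum>b\<in>Basis. (v \<bullet> b) *\<^sub>R b)" by (simp add: euclidean_representation)
  also have "\<dots> = (\<Sum>b\<in>Basis. (v \<bullet> b) *\<^sub>R f b)"
    using assms by (simp add: linear_sum linear_cmul)
  finally show ?thesis .
qed

section \<open>Closure properties of finitely differentiable maps\<close>

lemma Ck_on_cong:
  assumes "open S" "\<And>x. x \<in> S \<Longrightarrow> f x = g x" "Ck_on k f S"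
  shows "Ck_on k g S"
  using assms(2,3)
proof (induction k arbitrary: f g)
  case 0 then show ?case by (auto cong: continuous_on_cong)
next
  case (Suc k)
  have d: "f differentiable (at x)" if "x \<in> S" for x using Suc.prems that by auto
  have "Ck_on k (\<lambda>x. tangent_map g x v) S" for v
  proof (rule Suc.IH)
    show "Ck_on k (\<lambda>x. tangent_map f x v) S" using Suc.prems by auto
    show "tangent_map f x v = tangent_map g x v" if "x \<in> S" for x
      using tangent_map_cong_open[OF assms(1) that _ d[OF that], of g] Suc.prems by auto
  qed
  then show ?case
    using differentiable_cong_open[OF assms(1)] d Suc.prems(1) by (metis Ck_on.simps(2))
qed

lemma Ck_on_imp_continuous_on: "Ck_on k f S \<Longrightarrow> continuous_on S f"
proof (cases k)
  case (Suc j)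
  assume "Ck_on k f S"
  then show ?thesis using Suc
    by (auto simp: continuous_on_eq_continuous_within
        intro: differentiable_imp_continuous_within differentiable_at_withinI)
qed auto

lemma Ck_on_SucD: "Ck_on (Suc k) f S \<Longrightarrow> Ck_on k f S"
proof (induction k arbitrary: f)
  case 0 then show ?case using Ck_on_imp_continuous_on[of "Suc 0"] by simp
next
  case (Suc k) then show ?case by (metis Ck_on.simps(2))
qed

lemma Ck_on_subset: "Ck_on k f S \<Longrightarrow> T \<subseteq> S \<Longrightarrow> Ck_on k f T"
  by (induction k arbitrary: f) (auto intro: continuous_on_subset)

text \<open>The induction step of most closure properties below: exhibit a formula for the
  derivative and show that it has one order of smoothness less.\<close>

lemma Ck_on_SucI:
  assumes "open S" "\<And>x. x \<in> S \<Longrightarrow> (f has_derivative f' x) (at x)" "\<And>v. Ck_on k (\<lambda>x. f' x v) S"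
  shows "Ck_on (Suc k) f S"
proof -
  have "Ck_on k (\<lambda>x. tangent_map f x v) S" for v
    by (rule Ck_on_cong[OF assms(1) _ assms(3)[of v]]) (use tangent_map_eq assms(2) in metis)
  then show ?thesis using assms(2) by (auto simp: differentiable_def)
qed

lemma Ck_on_const: "Ck_on k (\<lambda>x. c) S"
  by (induction k arbitrary: c) auto

lemma Ck_on_bounded_linear:
  assumes "open S" "Ck_on k f S" "bounded_linear g"
  shows "Ck_on k (\<lambda>x. g (f x)) S"
  using assms(2)
proof (induction k arbitrary: f)
  case 0 then show ?case using assms(3) by (auto intro: bounded_linear.continuous_on)
next
  case (Suc k)
  show ?case
    by (rule Ck_on_SucI[OF assms(1), where f' = "\<lambda>x v. g (tangent_map f x v)"])
      (use Suc in \<open>auto intro!: bounded_linear.has_derivative[OF assms(3)] has_derivative_tangent_map\<close>)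
qed

lemma Ck_on_add:
  assumes "open S" "Ck_on k f S" "Ck_on k g S"
  shows "Ck_on k (\<lambda>x. f x + g x) S"
  using assms(2,3)
proof (induction k arbitrary: f g)
  case 0 then show ?case by (auto intro: continuous_intros)
next
  case (Suc k)
  show ?case
    by (rule Ck_on_SucI[OF assms(1), where f' = "\<lambda>x v. tangent_map f x v + tangent_map g x v"])
      (use Suc in \<open>auto intro!: derivative_intros has_derivative_tangent_map\<close>)
qed

lemma Ck_on_bilinear:
  assumes "open S" "Ck_on k f S" "Ck_on k g S" "bounded_bilinear h"
  shows "Ck_on k (\<lambda>x. h (f x) (g x)) S"
  using assms(2,3)
proof (induction k arbitrary: f g)
  case 0 then show ?case using assms(4) by (auto intro: bounded_bilinear.continuous_on)
next
  case (Suc k)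
  have fg: "Ck_on k f S" "Ck_on k g S" using Suc.prems Ck_on_SucD by blast+
  show ?case
    by (rule Ck_on_SucI[OF assms(1),
          where f' = "\<lambda>x v. h (f x) (tangent_map g x v) + h (tangent_map f x v) (g x)"])
      (use Suc fg in \<open>auto intro!: bounded_bilinear.FDERIV[OF assms(4)] has_derivative_tangent_map
         Ck_on_add assms(1)\<close>)
qed

lemma Ck_on_sum:
  assumes "open S" "\<And>i. i \<in> I \<Longrightarrow> Ck_on k (f i) S"
  shows "Ck_on k (\<lambda>x. \<Sum>i\<in>I. f i x) S"
  using assms(2)
  by (induction I rule: infinite_finite_induct) (auto intro: Ck_on_const Ck_on_add[OF assms(1)])

lemma Ck_on_compose:
  assumes "open S" "Ck_on k f S" "Ck_on k g T" "f ` S \<subseteq> T" 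
  shows "Ck_on k (\<lambda>x. g (f x)) S"
  using assms(2,3)
proof (induction k arbitrary: g)
  case 0 then show ?case using assms(4) by (auto intro: continuous_on_compose2)
next
  case (Suc k)
  have fg: "Ck_on k f S" using Suc.prems Ck_on_SucD by blast
  have d: "(g has_derivative tangent_map g (f x)) (at (f x))" if "x \<in> S" for x
    using Suc.prems(2) assms(4) that by (auto intro!: has_derivative_tangent_map)
  have lin: "linear (tangent_map g (f x))" if "x \<in> S" for x
    using d[OF that] has_derivative_linear by blast
  show ?case
  proof (rule Ck_on_SucI[OF assms(1)])
    show "((\<lambda>x. g (f x)) has_derivative (\<lambda>v. tangent_map g (f x) (tangent_map f x v))) (at x)"
      if "x \<in> S" for x
    proof -
      have "(f has_derivative tangent_map f x) (at x)"
        using Suc.prems(1) that by (auto intro: has_derivative_tangent_map)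
      from diff_chain_at[OF this d[OF that]] show ?thesis by (simp add: o_def)
    qed
    fix v
    \<comment> \<open>The chain rule evaluates the derivative of \<open>g\<close> in a direction
      that moves with \<open>x\<close>, whereas the induction hypothesis covers constant directions
      only; hence the expansion in a basis.\<close>
    have "Ck_on k (\<lambda>x. \<Sum>b\<in>Basis. (tangent_map f x v \<bullet> b) *\<^sub>R tangent_map g (f x) b) S"
      using Suc fg
      by (intro Ck_on_sum assms(1) Ck_on_bilinear[OF _ _ _ bounded_bilinear_scaleR]
          Ck_on_bounded_linear[OF _ _ bounded_linear_inner_left] Suc.IH) auto
    then show "Ck_on k (\<lambda>x. tangent_map g (f x) (tangent_map f x v)) S"
      by (rule Ck_on_cong[OF assms(1), rotated]) (metis linear_expand_Basis lin)
  qed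
qed

lemma smooth_on_subset: "smooth_on f S \<Longrightarrow> T \<subseteq> S \<Longrightarrow> smooth_on f T"
  unfolding smooth_on_def using Ck_on_subset by blast

lemma smooth_on_const [intro, simp]: "smooth_on (\<lambda>x. c) S"
  unfolding smooth_on_def using Ck_on_const by blast

lemma smooth_on_add: "open S \<Longrightarrow> smooth_on f S \<Longrightarrow> smooth_on g S \<Longrightarrow> smooth_on (\<lambda>x. f x + g x) S"
  unfolding smooth_on_def using Ck_on_add by blast

lemma smooth_on_bounded_linear:
  "open S \<Longrightarrow> smooth_on f S \<Longrightarrow> bounded_linear g \<Longrightarrow> smooth_on (\<lambda>x. g (f x)) S"
  unfolding smooth_on_def using Ck_on_bounded_linear by blast

lemma smooth_on_bilinear:
  "open S \<Longrightarrow> smooth_on f S \<Longrightarrow> smooth_on g S \<Longrightarrow> bounded_bilinear h \<Longrightarrow> smooth_on (\<lambda>x. h (f x) (g x)) S"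
  unfolding smooth_on_def using Ck_on_bilinear by blast

lemmas smooth_on_scaleR = smooth_on_bilinear[OF _ _ _ bounded_bilinear_scaleR]
lemmas smooth_on_inner = smooth_on_bilinear[OF _ _ _ bounded_bilinear_inner]

lemma smooth_on_minus: "open S \<Longrightarrow> smooth_on f S \<Longrightarrow> smooth_on (\<lambda>x. - f x) S"
  using smooth_on_bounded_linear[of S f uminus] by (simp add: bounded_linear_minus)

lemma smooth_on_diff: "open S \<Longrightarrow> smooth_on f S \<Longrightarrow> smooth_on g S \<Longrightarrow> smooth_on (\<lambda>x. f x - g x) S"
  using smooth_on_add[OF _ _ smooth_on_minus, of S f g] by simp

lemma smooth_on_sum:
  "open S \<Longrightarrow> (\<And>i. i \<in> I \<Longrightarrow> smooth_on (f i) S) \<Longrightarrow> smooth_on (\<lambda>x. \<Sum>i\<in>I. f i x) S"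
  unfolding smooth_on_def using Ck_on_sum[of S I] by blast

lemma smooth_on_compose:
  "open S \<Longrightarrow> smooth_on f S \<Longrightarrow> smooth_on g T \<Longrightarrow> f ` S \<subseteq> T \<Longrightarrow> smooth_on (\<lambda>x. g (f x)) S"
  unfolding smooth_on_def using Ck_on_compose by blast

lemma smooth_on_tangent_map: "smooth_on f S \<Longrightarrow> smooth_on (\<lambda>x. tangent_map f x v) S"
  unfolding smooth_on_def
proof
  fix k assume "\<forall>k. Ck_on k f S"
  then have "Ck_on (Suc k) f S" by blast
  then show "Ck_on k (\<lambda>x. tangent_map f x v) S" by simp
qed

lemma smooth_on_has_derivative:
  assumes "smooth_on f S" "x \<in> S"
  shows "(f has_derivative tangent_map f x) (at x)"
proof -
  have "Ck_on (Suc 0) f S" using assms unfolding smooth_on_def by blast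
  then show ?thesis using assms(2) by (auto intro: has_derivative_tangent_map)
qed

lemma smooth_on_linear_tangent_map:
  "smooth_on f S \<Longrightarrow> x \<in> S \<Longrightarrow> linear (tangent_map f x)"
  using smooth_on_has_derivative has_derivative_linear by blast

lemma smooth_on_continuous_on: "smooth_on f S \<Longrightarrow> continuous_on S f"
  unfolding smooth_on_def using Ck_on_imp_continuous_on by blast

lemma smooth_on_ident: "open S \<Longrightarrow> smooth_on (\<lambda>x. x) S"
  unfolding smooth_on_def
proof
  fix k assume "open S" then show "Ck_on k (\<lambda>x. x) S"
    by (cases k) (auto simp: Ck_on_const)
qed

section \<open>Families of linear maps depending smoothly on a point\<close>

lemma Ck_on_apply_linear:
  fixes Y :: "'a::euclidean_space \<Rightarrow> 'b::euclidean_space"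
    and L :: "'a \<Rightarrow> 'b \<Rightarrow> 'c::euclidean_space"
  assumes S: "open S" and L: "\<And>v. Ck_on k (\<lambda>x. L x v) S" and lin: "\<And>x. x \<in> S \<Longrightarrow> linear (L x)"
    and Y: "Ck_on k Y S"
  shows "Ck_on k (\<lambda>x. L x (Y x)) S"
proof -
  have "Ck_on k (\<lambda>x. \<Sum>b\<in>Basis. (Y x \<bullet> b) *\<^sub>R L x b) S"
    by (intro Ck_on_sum Ck_on_bilinear[OF _ _ _ bounded_bilinear_scaleR] S
        Ck_on_bounded_linear[OF _ _ bounded_linear_inner_left] Y L)
  then show ?thesis
    by (rule Ck_on_cong[OF S, rotated]) (metis linear_expand_Basis lin)
qed

lemma smooth_on_apply_linear:
  fixes Y :: "'a::euclidean_space \<Rightarrow> 'b::euclidean_space"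
    and L :: "'a \<Rightarrow> 'b \<Rightarrow> 'c::euclidean_space"
  assumes "open S" "\<And>v. smooth_on (\<lambda>x. L x v) S" "\<And>x. x \<in> S \<Longrightarrow> linear (L x)" "smooth_on Y S"
  shows "smooth_on (\<lambda>x. L x (Y x)) S"
  using assms Ck_on_apply_linear unfolding smooth_on_def by blast

lemma has_derivative_apply_linear:
  fixes Y :: "'a::euclidean_space \<Rightarrow> 'b::euclidean_space"
    and L :: "'a \<Rightarrow> 'b \<Rightarrow> 'c::euclidean_space"
  assumes S: "open S" "x \<in> S" and L: "\<And>v. ((\<lambda>y. L y v) has_derivative (\<lambda>u. L' u v)) (at x)"
    and lin: "\<And>y. y \<in> S \<Longrightarrow> linear (L y)" and lin': "\<And>u. linear (L' u)"
    and Y: "(Y has_derivative Y') (at x)"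
  shows "((\<lambda>y. L y (Y y)) has_derivative (\<lambda>u. L' u (Y x) + L x (Y' u))) (at x)"
proof -
  have "((\<lambda>y. \<Sum>b\<in>Basis. (Y y \<bullet> b) *\<^sub>R L y b) has_derivative
      (\<lambda>u. \<Sum>b\<in>Basis. (Y x \<bullet> b) *\<^sub>R L' u b + (Y' u \<bullet> b) *\<^sub>R L x b)) (at x)"
    by (intro has_derivative_sum has_derivative_scaleR has_derivative_inner_left Y L)
  moreover have "(\<Sum>b\<in>Basis. (Y x \<bullet> b) *\<^sub>R L' u b + (Y' u \<bullet> b) *\<^sub>R L x b) = L' u (Y x) + L x (Y' u)" for u
    using linear_expand_Basis[OF lin'[of u], of "Y x"] linear_expand_Basis[OF lin[OF S(2)], of "Y' u"]
    by (simp add: sum.distrib)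
  ultimately have "((\<lambda>y. \<Sum>b\<in>Basis. (Y y \<bullet> b) *\<^sub>R L y b) has_derivative
      (\<lambda>u. L' u (Y x) + L x (Y' u))) (at x)" by simp
  then show ?thesis
    by (rule has_derivative_transform_within_open[OF _ S]) (metis linear_expand_Basis lin)
qed

lemma linear_tangent_map_family:
  fixes L :: "'a::euclidean_space \<Rightarrow> 'b::euclidean_space \<Rightarrow> 'c::euclidean_space"
  assumes S: "open S" "x \<in> S" and L: "\<And>v. (\<lambda>y. L y v) differentiable (at x)"
    and lin: "\<And>y. y \<in> S \<Longrightarrow> linear (L y)"
  shows "linear (\<lambda>v. tangent_map (\<lambda>y. L y v) x u)"
proof (rule linearI)
  have h: "((\<lambda>y. L y v) has_derivative (tangent_map (\<lambda>y. L y v) x)) (at x)" for v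
    using L has_derivative_tangent_map by blast
  show "tangent_map (\<lambda>y. L y (v + w)) x u = tangent_map (\<lambda>y. L y v) x u + tangent_map (\<lambda>y. L y w) x u" for v w
  proof -
    have "((\<lambda>y. L y v + L y w) has_derivative (\<lambda>u. tangent_map (\<lambda>y. L y v) x u + tangent_map (\<lambda>y. L y w) x u)) (at x)"
      by (intro derivative_intros h)
    then have "((\<lambda>y. L y (v + w)) has_derivative (\<lambda>u. tangent_map (\<lambda>y. L y v) x u + tangent_map (\<lambda>y. L y w) x u)) (at x)"
      by (rule has_derivative_transform_within_open[OF _ S]) (simp add: lin linear_add)
    then show ?thesis by (simp add: tangent_map_eq)
  qed
  show "tangent_map (\<lambda>y. L y (c *\<^sub>R v)) x u = c *\<^sub>R tangent_map (\<lambda>y. L y v) x u" for v c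
  proof -
    have "((\<lambda>y. c *\<^sub>R L y v) has_derivative (\<lambda>u. c *\<^sub>R tangent_map (\<lambda>y. L y v) x u)) (at x)"
      by (intro derivative_intros h)
    then have "((\<lambda>y. L y (c *\<^sub>R v)) has_derivative (\<lambda>u. c *\<^sub>R tangent_map (\<lambda>y. L y v) x u)) (at x)"
      by (rule has_derivative_transform_within_open[OF _ S]) (simp add: lin linear_cmul)
    then show ?thesis by (simp add: tangent_map_eq)
  qed
qed

text \<open>A Leibniz rule in which the argument is frozen at \<open>Y x\<close> in the first
  summand. This shape fits \<open>ext_deriv\<close>, \<open>lie_deriv2\<close> and the torsion
  identity, all of which are expressed through constant vectors.\<close>

lemma tangent_map_apply_linear:
  fixes Y :: "'a::euclidean_space \<Rightarrow> 'b::euclidean_space"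
    and L :: "'a \<Rightarrow> 'b \<Rightarrow> 'c::euclidean_space"
  assumes S: "open S" "x \<in> S" and L: "\<And>v. (\<lambda>y. L y v) differentiable (at x)"
    and lin: "\<And>y. y \<in> S \<Longrightarrow> linear (L y)" and Y: "Y differentiable (at x)"
  shows "tangent_map (\<lambda>y. L y (Y y)) x u = tangent_map (\<lambda>y. L y (Y x)) x u + L x (tangent_map Y x u)"
proof -
  have "((\<lambda>y. L y (Y y)) has_derivative (\<lambda>u. tangent_map (\<lambda>y. L y (Y x)) x u + L x (tangent_map Y x u))) (at x)"
  proof (rule has_derivative_apply_linear[OF S _ lin linear_tangent_map_family[OF S L lin]])
    show "((\<lambda>y. L y v) has_derivative (\<lambda>u. tangent_map (\<lambda>y. L y v) x u)) (at x)" for v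
      using L has_derivative_tangent_map by blast
  qed (use Y has_derivative_tangent_map in auto)
  then show ?thesis by (simp add: tangent_map_eq)
qed

section \<open>Second derivatives and exterior derivatives\<close>

lemma DERIV_along_line:
  fixes f :: "'a::euclidean_space \<Rightarrow> real"
  assumes "(f has_derivative f') (at (p + t *\<^sub>R v))"
  shows "((\<lambda>t. f (p + t *\<^sub>R v)) has_real_derivative f' v) (at t)"
proof -
  have "((\<lambda>t. p + t *\<^sub>R v) has_derivative (\<lambda>s. s *\<^sub>R v)) (at t)"
    by (auto intro!: derivative_eq_intros)
  from diff_chain_at[OF this assms]
  have "((\<lambda>t. f (p + t *\<^sub>R v)) has_derivative (\<lambda>s. f' (s *\<^sub>R v))) (at t)"
    by (simp add: o_def)
  moreover have "f' (s *\<^sub>R v) = s * f' v" for s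
    using has_derivative_linear[OF assms] by (simp add: linear_cmul)
  ultimately show ?thesis by (simp add: has_field_derivative_def mult_commute_abs)
qed

text \<open>The left side is symmetric in \<open>u\<close> and \<open>v\<close>, the right side is
  not: the mean value theorem is applied first along \<open>v\<close> and then along
  \<open>u\<close>. Exchanging the roles will give the symmetry of second derivatives.\<close>

lemma second_difference_mean_value:
  fixes f :: "'a::euclidean_space \<Rightarrow> real"
  assumes f: "smooth_on f S" and S: "cball x (h * (norm u + norm v)) \<subseteq> S" and h: "h > 0"
  shows "\<exists>y\<in>cball x (h * (norm u + norm v)).
    f (x + h *\<^sub>R u + h *\<^sub>R v) - f (x + h *\<^sub>R u) - f (x + h *\<^sub>R v) + f x
      = h\<^sup>2 * tangent_map (\<lambda>y. tangent_map f y v) y u"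
proof -
  have inS: "x + s *\<^sub>R u + t *\<^sub>R v \<in> cball x (h * (norm u + norm v))"
    if "0 \<le> s" "s \<le> h" "0 \<le> t" "t \<le> h" for s t
  proof -
    have "norm (s *\<^sub>R u + t *\<^sub>R v) \<le> s * norm u + t * norm v"
      using that norm_triangle_ineq[of "s *\<^sub>R u" "t *\<^sub>R v"] by simp
    also have "\<dots> \<le> h * (norm u + norm v)"
      using that by (simp add: distrib_left add_mono mult_right_mono)
    finally show ?thesis
      by (simp add: dist_norm add.assoc norm_minus_commute[of x] flip: minus_add_distrib)
  qed
  have S': "x + s *\<^sub>R u + t *\<^sub>R v \<in> S" if "0 \<le> s" "s \<le> h" "0 \<le> t" "t \<le> h" for s t
    using inS[OF that] S by blast
  define \<phi> where "\<phi> t = f ((x + h *\<^sub>R u) + t *\<^sub>R v) - f (x + t *\<^sub>R v)" for t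
  have d: "DERIV \<phi> t :> tangent_map f ((x + h *\<^sub>R u) + t *\<^sub>R v) v - tangent_map f (x + t *\<^sub>R v) v"
    if "0 \<le> t" "t \<le> h" for t
    unfolding \<phi>_def
    using S'[of h t] S'[of 0 t] that h
    by (intro DERIV_diff DERIV_along_line smooth_on_has_derivative[OF f]) auto
  obtain t where t: "0 < t" "t < h"
    "\<phi> h - \<phi> 0 = (h - 0) * (tangent_map f ((x + h *\<^sub>R u) + t *\<^sub>R v) v - tangent_map f (x + t *\<^sub>R v) v)"
    using MVT2[OF h d] by blast
  define \<psi> where "\<psi> s = tangent_map f ((x + t *\<^sub>R v) + s *\<^sub>R u) v" for s
  have d2: "DERIV \<psi> s :> tangent_map (\<lambda>y. tangent_map f y v) ((x + t *\<^sub>R v) + s *\<^sub>R u) u"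
    if "0 \<le> s" "s \<le> h" for s
    unfolding \<psi>_def
    using S'[of s t] that t
    by (intro DERIV_along_line smooth_on_has_derivative[OF smooth_on_tangent_map[OF f]])
      (auto simp: algebra_simps)
  obtain s where s: "0 < s" "s < h"
    "\<psi> h - \<psi> 0 = (h - 0) * tangent_map (\<lambda>y. tangent_map f y v) ((x + t *\<^sub>R v) + s *\<^sub>R u) u"
    using MVT2[OF h d2] by blast
  show ?thesis
  proof (rule bexI)
    show "x + s *\<^sub>R u + t *\<^sub>R v \<in> cball x (h * (norm u + norm v))" using inS s t by simp
    have "f (x + h *\<^sub>R u + h *\<^sub>R v) - f (x + h *\<^sub>R u) - f (x + h *\<^sub>R v) + f x = \<phi> h - \<phi> 0"
      by (simp add: \<phi>_def)
    also have "\<dots> = h * (\<psi> h - \<psi> 0)" using t(3) by (simp add: \<psi>_def algebra_simps)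
    also have "\<dots> = h\<^sup>2 * tangent_map (\<lambda>y. tangent_map f y v) (x + s *\<^sub>R u + t *\<^sub>R v) u"
      using s(3) by (simp add: algebra_simps power2_eq_square)
    finally show "f (x + h *\<^sub>R u + h *\<^sub>R v) - f (x + h *\<^sub>R u) - f (x + h *\<^sub>R v) + f x
      = h\<^sup>2 * tangent_map (\<lambda>y. tangent_map f y v) (x + s *\<^sub>R u + t *\<^sub>R v) u" .
  qed
qed

lemma second_derivative_symmetric:
  fixes f :: "'a::euclidean_space \<Rightarrow> real"
  assumes S: "open S" "x \<in> S" and f: "smooth_on f S"
  shows "tangent_map (\<lambda>y. tangent_map f y v) x u = tangent_map (\<lambda>y. tangent_map f y u) x v"
proof -
  obtain r where r: "r > 0" "cball x r \<subseteq> S" using S open_contains_cball by blast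
  \<comment> \<open>The summand 1 keeps \<open>c\<close> positive when \<open>u = v = 0\<close>. The
    step sizes \<open>h n\<close> then tend to 0 and keep every parallelogram inside
    \<open>cball x r\<close>.\<close>
  define c where "c = norm u + norm v + 1"
  have c: "c > 0" unfolding c_def by (simp add: add_nonneg_pos)
  define h where "h n = r / c / real (Suc n)" for n
  have h0: "h n > 0" for n unfolding h_def using r c by simp
  have hr: "h n * (norm u + norm v) \<le> r / real (Suc n)" for n
  proof -
    have "h n * (norm u + norm v) \<le> h n * c" using h0[of n] by (simp add: c_def)
    also have "\<dots> = r / real (Suc n)" using c by (simp add: h_def)
    finally show ?thesis .
  qed
  have "r / real (Suc n) \<le> r" for n using r by (simp add: field_simps)
  then have sub: "cball x (h n * (norm u + norm v)) \<subseteq> S" for n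
    using r(2) hr[of n] by (meson order_trans subset_cball)
  define Q where "Q v u y = tangent_map (\<lambda>y. tangent_map f y v) y u" for v u y
  have "\<exists>y y'. y \<in> cball x (h n * (norm u + norm v)) \<and> y' \<in> cball x (h n * (norm u + norm v))
      \<and> Q v u y = Q u v y'" for n
  proof -
    obtain y where y: "y \<in> cball x (h n * (norm u + norm v))"
      "f (x + h n *\<^sub>R u + h n *\<^sub>R v) - f (x + h n *\<^sub>R u) - f (x + h n *\<^sub>R v) + f x
      = (h n)\<^sup>2 * Q v u y"
      using second_difference_mean_value[OF f sub[of n] h0[of n]] unfolding Q_def by blast
    have "cball x (h n * (norm v + norm u)) \<subseteq> S" using sub[of n] by (simp add: add.commute)
    from second_difference_mean_value[OF f this h0[of n]]
    obtain y' where y': "y' \<in> cball x (h n * (norm v + norm u))"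
      "f (x + h n *\<^sub>R v + h n *\<^sub>R u) - f (x + h n *\<^sub>R v) - f (x + h n *\<^sub>R u) + f x
      = (h n)\<^sup>2 * Q u v y'"
      unfolding Q_def by blast
    have eq: "x + h n *\<^sub>R u + h n *\<^sub>R v = x + h n *\<^sub>R v + h n *\<^sub>R u" by (simp add: algebra_simps)
    have "(h n)\<^sup>2 * Q v u y = (h n)\<^sup>2 * Q u v y'"
      using y(2) y'(2) unfolding eq by linarith
    then have "Q v u y = Q u v y'" using h0[of n] by simp
    then show ?thesis using y(1) y'(1) by (auto simp: add.commute)
  qed
  then obtain y y' where y: "\<And>n. y n \<in> cball x (h n * (norm u + norm v))"
    "\<And>n. y' n \<in> cball x (h n * (norm u + norm v))" "\<And>n. Q v u (y n) = Q u v (y' n)"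
    by metis
  have lim: "(\<lambda>n. r / real (Suc n)) \<longlonglongrightarrow> 0"
    by (rule LIMSEQ_Suc[OF lim_const_over_n])
  have conv: "z \<longlonglongrightarrow> x" if "\<And>n. z n \<in> cball x (h n * (norm u + norm v))" for z
  proof -
    have "dist (z n) x \<le> r / real (Suc n)" for n using that[of n] hr[of n] by (simp add: dist_commute)
    then have "(\<lambda>n. dist (z n) x) \<longlonglongrightarrow> 0"
      by (intro tendsto_sandwich[OF _ _ tendsto_const lim] always_eventually allI) simp_all
    then show ?thesis using tendsto_dist_iff by blast
  qed
  have cont: "isCont (Q v u) x" for v u
  proof -
    have "continuous_on S (Q v u)" unfolding Q_def
      by (intro smooth_on_continuous_on smooth_on_tangent_map f)
    then show ?thesis using S by (simp add: continuous_on_eq_continuous_at)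
  qed
  have "(\<lambda>n. Q v u (y n)) \<longlonglongrightarrow> Q v u x" "(\<lambda>n. Q u v (y' n)) \<longlonglongrightarrow> Q u v x"
    by (rule isCont_tendsto_compose[OF cont conv], rule y)+
  then have "Q v u x = Q u v x" unfolding y(3) by (rule LIMSEQ_unique)
  then show ?thesis by (simp add: Q_def)
qed

section \<open>Exterior derivatives and their closedness\<close>

lemma smooth_on_ext_deriv_form:
  assumes "open S" "\<And>v. smooth_on (\<lambda>y. \<alpha> y v) S"
  shows "smooth_on (\<lambda>y. ext_deriv \<alpha> y u v) S"
  unfolding ext_deriv_def by (intro smooth_on_diff smooth_on_tangent_map assms)

lemma ext_deriv_skew: "ext_deriv \<alpha> x u v = - ext_deriv \<alpha> x v u"
  by (simp add: ext_deriv_def)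

lemma linear_ext_deriv:
  fixes \<alpha> :: "'a::euclidean_space \<Rightarrow> 'a \<Rightarrow> real"
  assumes "open S" "x \<in> S" "\<And>v. smooth_on (\<lambda>y. \<alpha> y v) S" "\<And>y. y \<in> S \<Longrightarrow> linear (\<alpha> y)"
  shows "linear (ext_deriv \<alpha> x u)"
proof -
  have d: "(\<lambda>y. \<alpha> y v) differentiable (at x)" for v
    using smooth_on_has_derivative[OF assms(3,2)] differentiable_def by blast
  have "linear (\<lambda>v. tangent_map (\<lambda>y. \<alpha> y v) x u)"
    by (rule linear_tangent_map_family[OF assms(1,2) d assms(4)])
  moreover have "linear (tangent_map (\<lambda>y. \<alpha> y u) x)"
    by (rule smooth_on_linear_tangent_map[OF assms(3,2)])
  ultimately show ?thesis unfolding ext_deriv_def by (rule linear_compose_sub)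
qed

lemma linear_ext_deriv_left:
  fixes \<alpha> :: "'a::euclidean_space \<Rightarrow> 'a \<Rightarrow> real"
  assumes "open S" "x \<in> S" "\<And>v. smooth_on (\<lambda>y. \<alpha> y v) S" "\<And>y. y \<in> S \<Longrightarrow> linear (\<alpha> y)"
  shows "linear (\<lambda>u. ext_deriv \<alpha> x u v)"
proof -
  have "(\<lambda>u. ext_deriv \<alpha> x u v) = (\<lambda>u. - ext_deriv \<alpha> x v u)"
    by (rule ext) (rule ext_deriv_skew)
  then show ?thesis using linear_compose_neg[OF linear_ext_deriv[OF assms]] by simp
qed

lemma tangent_map_ext_deriv_skew:
  assumes "open S" "x \<in> S" "\<And>v. smooth_on (\<lambda>y. \<alpha> y v) S"
  shows "tangent_map (\<lambda>y. ext_deriv \<alpha> y u v) x w = - tangent_map (\<lambda>y. ext_deriv \<alpha> y v u) x w"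
proof -
  have "((\<lambda>y. - ext_deriv \<alpha> y v u) has_derivative (\<lambda>w. - tangent_map (\<lambda>y. ext_deriv \<alpha> y v u) x w)) (at x)"
    by (intro has_derivative_minus smooth_on_has_derivative[OF smooth_on_ext_deriv_form[OF assms(1,3)] assms(2)])
  moreover have "(\<lambda>y. ext_deriv \<alpha> y u v) = (\<lambda>y. - ext_deriv \<alpha> y v u)"
    by (rule ext) (rule ext_deriv_skew)
  ultimately show ?thesis by (simp add: tangent_map_eq)
qed

text \<open>This is \<open>d(d\<alpha>) = 0\<close> on constant fields: the six second derivatives
  cancel in pairs by symmetry.\<close>

lemma ext_deriv_closed:
  fixes \<alpha> :: "'a::euclidean_space \<Rightarrow> 'a \<Rightarrow> real"
  assumes S: "open S" "x \<in> S" and \<alpha>: "\<And>v. smooth_on (\<lambda>y. \<alpha> y v) S"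
  shows "tangent_map (\<lambda>y. ext_deriv \<alpha> y u v) x w + tangent_map (\<lambda>y. ext_deriv \<alpha> y v w) x u
    + tangent_map (\<lambda>y. ext_deriv \<alpha> y w u) x v = 0"
proof -
  have 1: "tangent_map (\<lambda>y. ext_deriv \<alpha> y u v) x w =
      tangent_map (\<lambda>y. tangent_map (\<lambda>y. \<alpha> y v) y u) x w - tangent_map (\<lambda>y. tangent_map (\<lambda>y. \<alpha> y u) y v) x w"
    for u v w
    unfolding ext_deriv_def
    using smooth_on_has_derivative[OF smooth_on_tangent_map[OF \<alpha>] S(2)]
    by (intro tangent_map_eq[THEN fun_cong] has_derivative_diff) auto
  have 2: "tangent_map (\<lambda>y. tangent_map (\<lambda>y. \<alpha> y w) y v) x u = tangent_map (\<lambda>y. tangent_map (\<lambda>y. \<alpha> y w) y u) x v"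
    for u v w by (rule second_derivative_symmetric[OF S \<alpha>])
  show ?thesis
    unfolding 1 using 2[of w v u] 2[of v u w] 2[of u w v] by linarith
qed

text \<open>Cartan's formula, in which the term with the differential of \<open>d\<alpha>\<close> vanishes.\<close>

lemma lie_deriv2_exact:
  fixes \<alpha> :: "'a::euclidean_space \<Rightarrow> 'a \<Rightarrow> real"
  assumes S: "open S" "x \<in> S" and \<alpha>: "\<And>v. smooth_on (\<lambda>y. \<alpha> y v) S" "\<And>y. y \<in> S \<Longrightarrow> linear (\<alpha> y)"
    and X: "smooth_on X S"
  shows "lie_deriv2 X (ext_deriv \<alpha>) x u v = ext_deriv (\<lambda>y. ext_deriv \<alpha> y (X y)) x u v"
proof -
  let ?w = "ext_deriv \<alpha>"
  have sm: "smooth_on (\<lambda>y. ?w y a b) S" for a b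
    by (rule smooth_on_ext_deriv_form[OF S(1) \<alpha>(1)])
  have lin2: "linear (?w y a)" if "y \<in> S" for a y
    by (rule linear_ext_deriv[OF S(1) that \<alpha>])
  have lin1: "linear (\<lambda>a. ?w y a b)" if "y \<in> S" for b y
    by (rule linear_ext_deriv_left[OF S(1) that \<alpha>])
  have dif: "(\<lambda>y. ?w y a b) differentiable (at x)" for a b
    using smooth_on_has_derivative[OF sm S(2)] differentiable_def by blast
  have Xd: "X differentiable (at x)"
    using smooth_on_has_derivative[OF X S(2)] differentiable_def by blast
  have 1: "tangent_map (\<lambda>y. ?w y (X y) v) x u = tangent_map (\<lambda>y. ?w y (X x) v) x u + ?w x (tangent_map X x u) v" for u v
    by (rule tangent_map_apply_linear[OF S dif lin1 Xd])
  have 2: "tangent_map (\<lambda>y. ?w y (X x) u) x v = - tangent_map (\<lambda>y. ?w y u (X x)) x v" for u v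
    by (rule tangent_map_ext_deriv_skew[OF S \<alpha>(1)])
  have 3: "tangent_map (\<lambda>y. ?w y u v) x (X x) + tangent_map (\<lambda>y. ?w y v (X x)) x u
    + tangent_map (\<lambda>y. ?w y (X x) u) x v = 0"
    by (rule ext_deriv_closed[OF S \<alpha>(1)])
  show ?thesis
    unfolding lie_deriv2_def ext_deriv_def[of "\<lambda>y. ?w y (X y)"] 1
    using 2[of v u] 3 ext_deriv_skew[of \<alpha> x u "tangent_map X x v"] by linarith
qed

text \<open>In the invariant formula for the differential of \<open>d\<alpha>\<close> on three of
  the fields, the terms that differentiate \<open>d\<alpha>(Y\<^sub>i,Y\<^sub>j)\<close> vanish by
  isotropy, so closedness leaves a cyclic sum over brackets.\<close>

lemma ext_deriv_isotropic_bianchi: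
  fixes \<alpha> :: "'a::euclidean_space \<Rightarrow> 'a \<Rightarrow> real"
  assumes S: "open S" "x \<in> S" and \<alpha>: "\<And>v. smooth_on (\<lambda>y. \<alpha> y v) S" "\<And>y. y \<in> S \<Longrightarrow> linear (\<alpha> y)"
    and Y: "\<And>i. smooth_on (Y i) S"
    and iso: "\<And>y i j. y \<in> S \<Longrightarrow> ext_deriv \<alpha> y (Y i y) (Y j y) = 0"
  shows "ext_deriv \<alpha> x (lie_bracket (Y a) (Y b) x) (Y c x)
    + ext_deriv \<alpha> x (lie_bracket (Y b) (Y c) x) (Y a x)
    + ext_deriv \<alpha> x (lie_bracket (Y c) (Y a) x) (Y b x) = 0"
proof -
  let ?w = "ext_deriv \<alpha>"
  have sm: "smooth_on (\<lambda>y. ?w y a b) S" for a b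
    by (rule smooth_on_ext_deriv_form[OF S(1) \<alpha>(1)])
  have lin2: "linear (?w y a)" if "y \<in> S" for a y
    by (rule linear_ext_deriv[OF S(1) that \<alpha>])
  have lin1: "linear (\<lambda>a. ?w y a b)" if "y \<in> S" for b y
    by (rule linear_ext_deriv_left[OF S(1) that \<alpha>])
  have dif: "(\<lambda>y. ?w y a b) differentiable (at x)" for a b
    using smooth_on_has_derivative[OF sm S(2)] differentiable_def by blast
  have Yd: "Y i differentiable (at x)" for i
    using smooth_on_has_derivative[OF Y S(2)] differentiable_def by blast
  have sm1: "smooth_on (\<lambda>y. ?w y (Y i y) b) S" for i b
    by (rule smooth_on_apply_linear[OF S(1) sm lin1 Y])
  have dif1: "(\<lambda>y. ?w y (Y i y) b) differentiable (at x)" for i b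
    using smooth_on_has_derivative[OF sm1 S(2)] differentiable_def by blast
  have 3: "tangent_map (\<lambda>y. ?w y (Y i y) (Y j y)) x u =
     tangent_map (\<lambda>y. ?w y (Y i x) (Y j x)) x u + ?w x (tangent_map (Y i) x u) (Y j x)
     + ?w x (Y i x) (tangent_map (Y j) x u)" for i j u
  proof -
    have "tangent_map (\<lambda>y. ?w y (Y i y) (Y j y)) x u =
      tangent_map (\<lambda>y. ?w y (Y i y) (Y j x)) x u + ?w x (Y i x) (tangent_map (Y j) x u)"
      by (rule tangent_map_apply_linear[OF S dif1 lin2 Yd])
    also have "tangent_map (\<lambda>y. ?w y (Y i y) (Y j x)) x u =
      tangent_map (\<lambda>y. ?w y (Y i x) (Y j x)) x u + ?w x (tangent_map (Y i) x u) (Y j x)"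
      by (rule tangent_map_apply_linear[OF S dif lin1 Yd])
    finally show ?thesis .
  qed
  have 0: "tangent_map (\<lambda>y. ?w y (Y i y) (Y j y)) x u = 0" for i j u
    using tangent_map_cong_open[OF S, of "\<lambda>y. 0" "\<lambda>y. ?w y (Y i y) (Y j y)"] iso by simp
  \<comment> \<open>Isotropy holds on all of \<open>S\<close> and can therefore be differentiated.
    This trades derivatives of the form for derivatives of the fields, which combine into
    brackets.\<close>
  have 1: "tangent_map (\<lambda>y. ?w y (Y i x) (Y j x)) x u = - ?w x (tangent_map (Y i) x u) (Y j x)
     + ?w x (tangent_map (Y j) x u) (Y i x)" for i j u
    using 0[of i j u] 3[of i j u] ext_deriv_skew[of \<alpha> x "Y i x" "tangent_map (Y j) x u"] by linarith
  have 2: "?w x (lie_bracket (Y i) (Y j) x) v = ?w x (tangent_map (Y j) x (Y i x)) v - ?w x (tangent_map (Y i) x (Y j x)) v" for i j v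
    unfolding lie_bracket_def using linear_diff[OF lin1[OF S(2)]] by blast
  have "tangent_map (\<lambda>y. ?w y (Y a x) (Y b x)) x (Y c x) + tangent_map (\<lambda>y. ?w y (Y b x) (Y c x)) x (Y a x)
    + tangent_map (\<lambda>y. ?w y (Y c x) (Y a x)) x (Y b x) = 0"
    by (rule ext_deriv_closed[OF S \<alpha>(1)])
  then show ?thesis unfolding 1 2 by linarith
qed

section \<open>Integral curves\<close>

lemma linear_norm_le_sum_Basis:
  fixes f :: "'a::euclidean_space \<Rightarrow> 'b::real_normed_vector"
  assumes "linear f" "\<And>b. b \<in> Basis \<Longrightarrow> norm (f b) \<le> B b"
  shows "norm (f v) \<le> (\<Sum>b\<in>Basis. B b) * norm v"
proof -
  have "norm (f v) \<le> (\<Sum>b\<in>Basis. norm ((v \<bullet> b) *\<^sub>R f b))"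
    by (subst linear_expand_Basis[OF assms(1)]) (rule norm_sum)
  also have "\<dots> \<le> (\<Sum>b\<in>Basis. norm v * B b)"
    using assms(2) by (intro sum_mono) (auto intro!: mult_mono Basis_le_norm)
  also have "\<dots> = (\<Sum>b\<in>Basis. B b) * norm v" by (simp add: sum_distrib_left mult.commute)
  finally show ?thesis .
qed

text \<open>Continuity is given for each vector separately; bounding the family on the finitely many
  basis vectors makes the bound uniform in \<open>v\<close>.\<close>

lemma compact_linear_family_bound:
  fixes L :: "'c::topological_space \<Rightarrow> 'a::euclidean_space \<Rightarrow> 'b::real_normed_vector"
  assumes "compact K" "\<And>v. continuous_on K (\<lambda>x. L x v)" "\<And>x. x \<in> K \<Longrightarrow> linear (L x)"
  obtains B where "B \<ge> 0" "\<And>x v. x \<in> K \<Longrightarrow> norm (L x v) \<le> B * norm v"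
proof -
  have "\<exists>B. B \<ge> 0 \<and> (\<forall>x\<in>K. norm (L x b) \<le> B)" for b
  proof -
    have "bounded ((\<lambda>x. L x b) ` K)"
      by (rule compact_imp_bounded[OF compact_continuous_image[OF assms(2,1)]])
    then obtain B where "B > 0" "\<forall>x\<in>(\<lambda>x. L x b) ` K. norm x \<le> B" by (auto simp: bounded_pos)
    then show ?thesis by (intro exI[of _ B]) auto
  qed
  then obtain B where B: "\<And>b. B b \<ge> 0" "\<And>b x. x \<in> K \<Longrightarrow> norm (L x b) \<le> B b" by metis
  show ?thesis
    by (rule that[of "\<Sum>b\<in>Basis. B b"]) (auto intro!: sum_nonneg B linear_norm_le_sum_Basis assms(3))
qed

lemma smooth_on_lipschitz_cball:
  fixes f :: "'a::euclidean_space \<Rightarrow> 'b::euclidean_space"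
  assumes "smooth_on f S" "cball m r \<subseteq> S"
  shows "\<exists>K\<ge>0. \<forall>x\<in>cball m r. \<forall>y\<in>cball m r. norm (f x - f y) \<le> K * norm (x - y)"
proof -
  obtain B where B: "B \<ge> 0" "\<And>x v. x \<in> cball m r \<Longrightarrow> norm (tangent_map f x v) \<le> B * norm v"
  proof (rule compact_linear_family_bound[of "cball m r" "tangent_map f"])
    show "continuous_on (cball m r) (\<lambda>x. tangent_map f x v)" for v
      using smooth_on_continuous_on[OF smooth_on_tangent_map[OF assms(1)]] assms(2)
      by (rule continuous_on_subset)
    show "linear (tangent_map f x)" if "x \<in> cball m r" for x
      using that assms(2) by (intro smooth_on_linear_tangent_map[OF assms(1)]) auto
  qed auto
  show ?thesis
  proof (intro exI conjI ballI)
    show "B \<ge> 0" by (rule B(1))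
    fix x y assume xy: "x \<in> cball m r" "y \<in> cball m r"
    show "norm (f x - f y) \<le> B * norm (x - y)"
    proof (rule differentiable_bound[OF convex_cball _ _ xy])
      show "(f has_derivative tangent_map f z) (at z within cball m r)" if "z \<in> cball m r" for z
        by (rule has_derivative_at_withinI[OF smooth_on_has_derivative[OF assms(1)]]) (use that assms(2) in blast)
      show "onorm (tangent_map f z) \<le> B" if "z \<in> cball m r" for z
        by (rule onorm_le) (rule B(2)[OF that])
    qed
  qed
qed

lemma smooth_on_lipschitz_linear_family:
  fixes A :: "'a::euclidean_space \<Rightarrow> 'c::euclidean_space \<Rightarrow> 'b::euclidean_space"
  assumes "\<And>v. smooth_on (\<lambda>x. A x v) S" "cball m r \<subseteq> S" "\<And>x. x \<in> S \<Longrightarrow> linear (A x)"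
  shows "\<exists>K\<ge>0. \<forall>x\<in>cball m r. \<forall>y\<in>cball m r. \<forall>v. norm (A x v - A y v) \<le> K * norm (x - y) * norm v"
proof -
  have "\<forall>b. \<exists>K. K \<ge> 0 \<and> (\<forall>x\<in>cball m r. \<forall>y\<in>cball m r. norm (A x b - A y b) \<le> K * norm (x - y))"
    (is "\<forall>b. \<exists>K. ?P b K")
    by (intro allI smooth_on_lipschitz_cball[OF assms(1,2)])
  then obtain K where "\<forall>b. ?P b (K b)" by (rule exE[OF choice])
  then have K: "K b \<ge> 0"
    "x \<in> cball m r \<Longrightarrow> y \<in> cball m r \<Longrightarrow> norm (A x b - A y b) \<le> K b * norm (x - y)" for b x y by auto
  show ?thesis
  proof (intro exI[of _ "\<Sum>b\<in>Basis. K b"] conjI ballI allI)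
    fix x y v assume xy: "x \<in> cball m r" "y \<in> cball m r"
    have "linear (\<lambda>v. A x v - A y v)"
      using xy assms(2) by (intro linear_compose_sub assms(3)) auto
    then have "norm (A x v - A y v) \<le> (\<Sum>b\<in>Basis. K b * norm (x - y)) * norm v"
      by (rule linear_norm_le_sum_Basis) (rule K(2)[OF xy])
    then show "norm (A x v - A y v) \<le> (\<Sum>b\<in>Basis. K b) * norm (x - y) * norm v"
      by (simp add: sum_distrib_right)
  qed (auto intro!: sum_nonneg K)
qed

text \<open>A substitute for Gronwall's inequality on the unit interval: at a point \<open>t\<close>
  where \<open>norm (g t)\<close> is maximal, the mean value inequality gives
  \<open>norm (g t) \<le> norm (g t) / 2 + K\<close>.\<close>

lemma norm_le_of_contracting_derivative:
  fixes g :: "real \<Rightarrow> 'a::real_normed_vector"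
  assumes d: "\<And>s. s \<in> {0..1} \<Longrightarrow> (g has_vector_derivative g' s) (at s within {0..1})"
    and g0: "g 0 = 0" and b: "\<And>s. s \<in> {0..1} \<Longrightarrow> norm (g' s) \<le> norm (g s) / 2 + K"
    and s: "s \<in> {0..1}"
  shows "norm (g s) \<le> 2 * K"
proof -
  have "continuous_on {0..1} g"
    unfolding continuous_on_eq_continuous_within using d has_vector_derivative_continuous by blast
  then have "continuous_on {0..1} (\<lambda>s. norm (g s))" by (rule continuous_on_norm)
  then obtain t where t: "t \<in> {0..1}" "\<And>s. s \<in> {0..1} \<Longrightarrow> norm (g s) \<le> norm (g t)"
    using continuous_attains_sup[of "{0..1::real}" "\<lambda>s. norm (g s)"] by auto
  have *: "norm (g' s) \<le> norm (g t) / 2 + K" if "s \<in> {0..1}" for s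
    using b[OF that] t(2)[OF that] by simp
  have "norm (g t - g 0) \<le> (norm (g t) / 2 + K) * norm (t - 0)"
  proof (rule differentiable_bound[of "{0..1}" g "\<lambda>s h. h *\<^sub>R g' s"])
    show "(g has_derivative (\<lambda>h. h *\<^sub>R g' s)) (at s within {0..1})" if "s \<in> {0..1}" for s
      using d[OF that] by (simp add: has_vector_derivative_def)
    show "onorm (\<lambda>h. h *\<^sub>R g' s) \<le> norm (g t) / 2 + K" if "s \<in> {0..1}" for s
      using *[OF that] by (intro onorm_le) (simp add: mult.commute mult_left_mono)
  qed (use t in auto)
  also have "\<dots> \<le> norm (g t) / 2 + K"
    using t(1) order_trans[OF norm_ge_zero *[of 0]] by (intro mult_left_le) auto
  finally have "norm (g t) \<le> 2 * K" using g0 by simp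
  then show ?thesis using t(2)[OF s] by linarith
qed

text \<open>With Lipschitz constant 1/2 and speed at most \<open>r\<close>, the integral operator
  \<open>T\<close> preserves the curves in \<open>cball m r\<close> over unit time and halves their
  uniform distance. A fixed time interval suffices because the length of the parameter
  \<open>w\<close> will take over the role of time.\<close>

lemma picard_unit_interval:
  fixes f :: "'a::euclidean_space \<Rightarrow> 'a"
  assumes r: "r \<ge> 0"
    and lip: "\<And>x y. x \<in> cball m r \<Longrightarrow> y \<in> cball m r \<Longrightarrow> norm (f x - f y) \<le> norm (x - y) / 2"
    and bnd: "\<And>x. x \<in> cball m r \<Longrightarrow> norm (f x) \<le> r"
  obtains z where "z 0 = m" "\<And>s. s \<in> {0..1} \<Longrightarrow> z s \<in> cball m r"
    "\<And>s. s \<in> {0..1} \<Longrightarrow> (z has_vector_derivative f (z s)) (at s within {0..1})"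
proof -
  define T where "T z s = m + integral {0..s} (\<lambda>t. f (z t))" for z and s :: real
  define p where "p i = (T ^^ i) (\<lambda>s. m)" for i
  have p0: "p 0 = (\<lambda>s. m)" and pS: "p (Suc i) = T (p i)" for i by (simp_all add: p_def)
  have fcont: "continuous_on (cball m r) f"
  proof (rule continuous_onI)
    fix x :: "'a" and \<epsilon> :: real assume x: "x \<in> cball m r" and \<epsilon>: "\<epsilon> > 0"
    have "dist (f x') (f x) \<le> \<epsilon>" if "x' \<in> cball m r" "dist x' x < \<epsilon>" for x'
      using lip[OF that(1) x] that(2) norm_ge_zero[of "x' - x"] unfolding dist_norm by linarith
    then show "\<exists>d>0. \<forall>x'\<in>cball m r. dist x' x < d \<longrightarrow> dist (f x') (f x) \<le> \<epsilon>"
      using \<epsilon> by blast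
  qed
  have comp: "continuous_on {0..1} (\<lambda>t. f (z t))" if "continuous_on {0..1} z" "z ` {0..1} \<subseteq> cball m r" for z :: "real \<Rightarrow> 'a"
    using continuous_on_compose2[OF fcont that] .
  have comp': "continuous_on {0..s} (\<lambda>t. f (z t))" if "continuous_on {0..1} z" "z ` {0..1} \<subseteq> cball m r" "s \<le> 1" for s and z :: "real \<Rightarrow> 'a"
    by (rule continuous_on_subset[OF comp[OF that(1,2)]]) (use that in auto)
  have T: "continuous_on {0..1} (T z)" "T z ` {0..1} \<subseteq> cball m r"
    if z: "continuous_on {0..1} z" "z ` {0..1} \<subseteq> cball m r" for z
  proof -
    show "continuous_on {0..1} (T z)" unfolding T_def
      by (intro continuous_on_add continuous_on_const indefinite_integral_continuous_1
          integrable_continuous_real comp[OF z])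
    show "T z ` {0..1} \<subseteq> cball m r"
    proof clarify
      fix s :: real assume s: "s \<in> {0..1}"
      have "norm (integral {0..s} (\<lambda>t. f (z t))) \<le> r * (s - 0)"
      proof (rule integral_bound)
        fix t assume "t \<in> {0..s}"
        then have "t \<in> {0..1}" using s by auto
        then show "norm (f (z t)) \<le> r" using z(2) by (intro bnd) blast
      qed (use s in \<open>simp_all add: comp'[OF z]\<close>)
      also have "\<dots> \<le> r" using r s by (simp add: mult_left_le)
      finally show "T z s \<in> cball m r" by (simp add: T_def dist_norm)
    qed
  qed
  have Tdiff: "norm (T z s - T y s) \<le> B / 2"
    if z: "continuous_on {0..1} z" "z ` {0..1} \<subseteq> cball m r" 
      and y: "continuous_on {0..1} y" "y ` {0..1} \<subseteq> cball m r"
      and B: "\<And>s. s \<in> {0..1} \<Longrightarrow> norm (z s - y s) \<le> B" and s: "s \<in> {0..1}" for z y B s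
  proof -
    have B0: "B \<ge> 0" using B[OF s] norm_ge_zero order_trans by blast
    have "T z s - T y s = integral {0..s} (\<lambda>t. f (z t) - f (y t))"
      unfolding T_def using s
      by (subst integral_diff) (simp_all add: integrable_continuous_real comp'[OF z] comp'[OF y])
    also have "norm \<dots> \<le> (B / 2) * (s - 0)"
    proof (rule integral_bound)
      fix t assume "t \<in> {0..s}"
      then have t: "t \<in> {0..1}" using s by auto
      then have "norm (f (z t) - f (y t)) \<le> norm (z t - y t) / 2"
        using z(2) y(2) by (intro lip) blast+
      then show "norm (f (z t) - f (y t)) \<le> B / 2" using B[OF t] by simp
    qed (use s in \<open>simp_all add: continuous_on_diff comp'[OF z] comp'[OF y]\<close>)
    also have "\<dots> \<le> B / 2" using B0 s by (simp add: mult_left_le)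
    finally show ?thesis .
  qed
  have "continuous_on {0..1} (p i) \<and> p i ` {0..1} \<subseteq> cball m r" for i
  proof (induction i)
    case 0
    show ?case using r by (auto simp: p0)
  next
    case (Suc i)
    then show ?case using T[of "p i"] by (simp add: pS)
  qed
  then have p: "continuous_on {0..1} (p i)" "p i ` {0..1} \<subseteq> cball m r" for i by auto
  have step: "norm (p (Suc i) s - p i s) \<le> r * (1/2) ^ i" if "s \<in> {0..1}" for i s
    using that
  proof (induction i arbitrary: s)
    case 0
    then have "p (Suc 0) s \<in> cball m r" using p(2)[of "Suc 0"] by blast
    then show ?case by (simp add: p0 dist_norm norm_minus_commute)
  next
    case (Suc i)
    have "norm (T (p (Suc i)) s - T (p i) s) \<le> (r * (1/2) ^ i) / 2"
      by (rule Tdiff[OF p p Suc.IH Suc.prems])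
    then show ?case by (simp add: pS)
  qed
  \<comment> \<open>The iterates are the partial sums of a telescoping series with geometric
    majorant, so they converge uniformly and the limit is continuous.\<close>
  define z where "z s = m + (\<Sum>i. p (Suc i) s - p i s)" for s
  have "uniform_limit {0..1} (\<lambda>n s. \<Sum>i<n. p (Suc i) s - p i s) (\<lambda>s. \<Sum>i. p (Suc i) s - p i s) sequentially"
  proof (rule Weierstrass_m_test)
    show "summable (\<lambda>i. r * (1/2) ^ i)" by (intro summable_mult summable_geometric) auto
  qed (use step in auto)
  then have "uniform_limit {0..1} (\<lambda>n s. m + (\<Sum>i<n. p (Suc i) s - p i s)) z sequentially"
    unfolding z_def by (intro uniform_limit_add uniform_limit_const)
  moreover have "(\<lambda>n s. m + (\<Sum>i<n. p (Suc i) s - p i s)) = p"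
  proof (intro ext)
    show "m + (\<Sum>i<n. p (Suc i) s - p i s) = p n s" for n s
      using sum_lessThan_telescope[of "\<lambda>i. p i s" n] by (simp add: p0)
  qed
  ultimately have lim: "uniform_limit {0..1} p z sequentially" by simp
  have zc: "continuous_on {0..1} z"
    by (rule uniform_limit_theorem[OF always_eventually lim]) (simp_all add: p)
  have pw: "(\<lambda>n. p n s) \<longlonglongrightarrow> z s" if "s \<in> {0..1}" for s
    using tendsto_uniform_limitI[OF lim that] .
  have zb: "z ` {0..1} \<subseteq> cball m r"
  proof clarify
    fix s :: real assume s: "s \<in> {0..1}"
    show "z s \<in> cball m r"
      by (rule closed_sequentially[OF closed_cball _ pw[OF s]]) (use p(2) s in blast)
  qed
  have fix_pt: "z s = T z s" if s: "s \<in> {0..1}" for s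
  proof -
    have "(\<lambda>n. p (Suc n) s) \<longlonglongrightarrow> T z s"
    proof (rule metric_LIMSEQ_I)
      fix e :: real assume e: "e > 0"
      then obtain N where N: "\<And>n t. n \<ge> N \<Longrightarrow> t \<in> {0..1} \<Longrightarrow> dist (p n t) (z t) < e"
        using uniform_limitD[OF lim e] unfolding eventually_sequentially by blast
      have "dist (p (Suc n) s) (T z s) < e" if "n \<ge> N" for n
      proof -
        have "norm (T (p n) s - T z s) \<le> e / 2"
        proof (rule Tdiff[OF p zc zb _ s])
          show "norm (p n t - z t) \<le> e" if "t \<in> {0..1}" for t
            using N[OF \<open>n \<ge> N\<close> that] by (simp add: dist_norm)
        qed
        then show ?thesis using e by (simp add: pS dist_norm)
      qed
      then show "\<exists>N. \<forall>n\<ge>N. dist (p (Suc n) s) (T z s) < e" by blast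
    qed
    then show ?thesis by (rule LIMSEQ_unique[OF LIMSEQ_Suc[OF pw[OF s]]])
  qed
  show ?thesis
  proof
    show "z 0 = m" using fix_pt[of 0] by (simp add: T_def)
    show "z s \<in> cball m r" if "s \<in> {0..1}" for s using zb that by blast
    show "(z has_vector_derivative f (z s)) (at s within {0..1})" if s: "s \<in> {0..1}" for s
    proof (rule has_vector_derivative_transform[OF s])
      show "z x = T z x" if "x \<in> {0..1}" for x by (rule fix_pt[OF that])
      show "(T z has_vector_derivative f (z s)) (at s within {0..1})"
        unfolding T_def
        using has_vector_derivative_add[OF has_vector_derivative_const
            integral_has_vector_derivative[OF comp[OF zc zb] s]] by simp
    qed
  qed
qed

text \<open>The two estimates needed to compare neighbouring integral curves to second order: a
  bound \<open>M\<close> for the derivative as a bilinear map, and a quadratic remainder whose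
  constant \<open>K\<close> is a Lipschitz constant of that derivative.\<close>

lemma linear_family_taylor:
  fixes A :: "'a::euclidean_space \<Rightarrow> 'e::euclidean_space \<Rightarrow> 'b::euclidean_space"
  assumes sm: "\<And>v. smooth_on (\<lambda>x. A x v) S" and S: "open S" "cball m r \<subseteq> S"
    and lin: "\<And>x. x \<in> S \<Longrightarrow> linear (A x)"
  shows "\<exists>K\<ge>0. \<exists>M\<ge>0.
    (\<forall>x\<in>cball m r. \<forall>u v. norm (tangent_map (\<lambda>y. A y v) x u) \<le> M * norm u * norm v)
    \<and> (\<forall>x\<in>cball m r. \<forall>y\<in>cball m r. \<forall>v.
      norm (A y v - A x v - tangent_map (\<lambda>y. A y v) x (y - x)) \<le> K * (norm (y - x))\<^sup>2 * norm v)"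
proof -
  define D where "D x u v = tangent_map (\<lambda>y. A y v) x u" for x u v
  have hd: "((\<lambda>y. A y v) has_derivative (\<lambda>u. D x u v)) (at x)" if "x \<in> S" for x v
    unfolding D_def by (rule smooth_on_has_derivative[OF sm that])
  have linu: "linear (\<lambda>u. D x u v)" if "x \<in> S" for x v
    by (rule has_derivative_linear[OF hd[OF that]])
  have linv: "linear (D x u)" if "x \<in> S" for x u
    unfolding D_def using smooth_on_has_derivative[OF sm that]
    by (intro linear_tangent_map_family[OF S(1) that _ lin]) (auto simp: differentiable_def)
  have smD: "smooth_on (\<lambda>x. D x u v) S" for u v
    unfolding D_def by (rule smooth_on_tangent_map[OF sm])
  have "\<forall>b. \<exists>M. M \<ge> 0 \<and> (\<forall>x\<in>cball m r. \<forall>v. norm (D x b v) \<le> M * norm v)" (is "\<forall>b. \<exists>M. ?P b M")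
  proof
    fix b
    show "\<exists>M. ?P b M"
    proof (rule compact_linear_family_bound[of "cball m r" "\<lambda>x. D x b"])
      show "continuous_on (cball m r) (\<lambda>x. D x b v)" for v
        by (rule continuous_on_subset[OF smooth_on_continuous_on[OF smD] S(2)])
      show "linear (D x b)" if "x \<in> cball m r" for x using linv that S(2) by blast
    qed auto
  qed
  then obtain M where "\<forall>b. ?P b (M b)" by (rule exE[OF choice])
  then have M: "M b \<ge> 0" "x \<in> cball m r \<Longrightarrow> norm (D x b v) \<le> M b * norm v" for b x v by auto
  have "\<forall>b. \<exists>K. K \<ge> 0 \<and> (\<forall>x\<in>cball m r. \<forall>y\<in>cball m r. \<forall>v. norm (D x b v - D y b v) \<le> K * norm (x - y) * norm v)"
    (is "\<forall>b. \<exists>K. ?Q b K")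
  proof
    fix b
    show "\<exists>K. ?Q b K"
      by (rule smooth_on_lipschitz_linear_family[OF smD S(2) linv])
  qed
  then obtain K where "\<forall>b. ?Q b (K b)" by (rule exE[OF choice])
  then have K: "K b \<ge> 0"
    "x \<in> cball m r \<Longrightarrow> y \<in> cball m r \<Longrightarrow> norm (D x b v - D y b v) \<le> K b * norm (x - y) * norm v" for b x y v by auto
  define K' where "K' = (\<Sum>b\<in>Basis. K b)"
  define M' where "M' = (\<Sum>b\<in>Basis. M b)"
  have K'0: "K' \<ge> 0" and M'0: "M' \<ge> 0" unfolding K'_def M'_def by (auto intro!: sum_nonneg K M)
  have Dbound: "norm (D x u v) \<le> M' * norm u * norm v" if x: "x \<in> cball m r" for x u v
  proof -
    have "norm (D x u v) \<le> (\<Sum>b\<in>Basis. M b * norm v) * norm u"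
      by (rule linear_norm_le_sum_Basis[of "\<lambda>u. D x u v"], rule linu) (use x S(2) M(2)[OF x] in auto)
    then show ?thesis by (simp add: M'_def sum_distrib_right[symmetric] mult_ac)
  qed
  have Dlip: "norm (D x u v - D y u v) \<le> K' * norm (x - y) * norm u * norm v"
    if xy: "x \<in> cball m r" "y \<in> cball m r" for x y u v
  proof -
    have "linear (\<lambda>u. D x u v - D y u v)"
      using xy S(2) by (intro linear_compose_sub linu) auto
    then have "norm (D x u v - D y u v) \<le> (\<Sum>b\<in>Basis. K b * norm (x - y) * norm v) * norm u"
      by (rule linear_norm_le_sum_Basis) (rule K(2)[OF xy])
    then show ?thesis by (simp add: K'_def sum_distrib_right[symmetric] mult_ac)
  qed
  have taylor: "norm (A y v - A x v - D x (y - x) v) \<le> K' * (norm (y - x))\<^sup>2 * norm v"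
    if xy: "x \<in> cball m r" "y \<in> cball m r" for x y v
  proof -
    have seg: "closed_segment x y \<subseteq> cball m r"
      by (rule closed_segment_subset[OF xy convex_cball])
    \<comment> \<open>Along the segment the derivative differs from its value at \<open>x\<close> by
      at most \<open>K' * norm (y - x) * norm v\<close>; the mean value inequality supplies the
      second factor \<open>norm (y - x)\<close>.\<close>
    have "norm (A y v - A x v - D x (y - x) v) \<le> norm (y - x) * (K' * norm (y - x) * norm v)"
    proof (rule differentiable_bound_linearization[where S = "closed_segment x y" and f' = "\<lambda>z u. D z u v"])
      show "x + t *\<^sub>R (y - x) \<in> closed_segment x y" if "t \<in> {0..1}" for t
        using that by (auto simp: in_segment algebra_simps intro!: exI[of _ t])
      show "((\<lambda>y. A y v) has_derivative (\<lambda>u. D z u v)) (at z within closed_segment x y)"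
        if "z \<in> closed_segment x y" for z
        by (rule has_derivative_at_withinI[OF hd]) (use that seg S(2) in blast)
      show "onorm ((\<lambda>u. D z u v) - (\<lambda>u. D x u v)) \<le> K' * norm (y - x) * norm v"
        if z: "z \<in> closed_segment x y" for z
      proof (rule onorm_le)
        fix u
        have "norm (z - x) \<le> norm (y - x)" using segment_bound1[OF z] by (simp add: norm_minus_commute)
        have "norm (D z u v - D x u v) \<le> K' * norm (z - x) * norm u * norm v"
          using z seg xy by (intro Dlip) auto
        also have "\<dots> \<le> K' * norm (y - x) * norm u * norm v"
          using \<open>norm (z - x) \<le> norm (y - x)\<close> K'0 by (intro mult_right_mono mult_left_mono) auto
        finally show "norm (((\<lambda>u. D z u v) - (\<lambda>u. D x u v)) u) \<le> K' * norm (y - x) * norm v * norm u"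
          by (simp add: mult_ac)
      qed
    qed auto
    then show ?thesis by (simp add: power2_eq_square mult_ac)
  qed
  show ?thesis
  proof (rule exI, rule conjI[OF K'0], rule exI, rule conjI[OF M'0], intro conjI ballI allI)
    show "norm (tangent_map (\<lambda>y. A y v) x u) \<le> M' * norm u * norm v" if "x \<in> cball m r" for x u v
      using Dbound[OF that] unfolding D_def .
    show "norm (A y v - A x v - tangent_map (\<lambda>y. A y v) x (y - x)) \<le> K' * (norm (y - x))\<^sup>2 * norm v"
      if "x \<in> cball m r" "y \<in> cball m r" for x y v
      using taylor[OF that] unfolding D_def .
  qed
qed

text \<open>
  The solution \<open>\<phi> w\<close> is the value at time 1 of the integral curve of the vector field \<open>A _ w\<close>; the
  symmetry hypothesis (\<open>A _ u\<close> and \<open>A _ v\<close> commute) makes \<open>z\<^sub>w + s A (z\<^sub>w) u\<close> agree with the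
  curve of \<open>w + u\<close> up to second order in \<open>u\<close>. No smooth dependence of flows on parameters is needed.
\<close>

lemma total_differential_equation:
  fixes A :: "'a::euclidean_space \<Rightarrow> 'e::euclidean_space \<Rightarrow> 'a"
  assumes S: "open S" "m \<in> S" and sm: "\<And>v. smooth_on (\<lambda>x. A x v) S"
    and lin: "\<And>x. x \<in> S \<Longrightarrow> linear (A x)"
    and sym: "\<And>x u v. x \<in> S \<Longrightarrow> tangent_map (\<lambda>y. A y v) x (A x u) = tangent_map (\<lambda>y. A y u) x (A x v)"
  obtains \<phi> d where "d > 0" "\<phi> 0 = m" "\<And>w. w \<in> ball 0 d \<Longrightarrow> \<phi> w \<in> S"
    "\<And>w. w \<in> ball 0 d \<Longrightarrow> (\<phi> has_derivative A (\<phi> w)) (at w)"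
proof -
  obtain r where r: "r > 0" "cball m r \<subseteq> S" using S open_contains_cball by blast
  obtain B where B: "B \<ge> 0" "\<And>x v. x \<in> cball m r \<Longrightarrow> norm (A x v) \<le> B * norm v"
  proof (rule compact_linear_family_bound[of "cball m r" A])
    show "continuous_on (cball m r) (\<lambda>x. A x v)" for v
      by (rule continuous_on_subset[OF smooth_on_continuous_on[OF sm] r(2)])
    show "linear (A x)" if "x \<in> cball m r" for x using lin that r(2) by blast
  qed auto
  obtain L where L: "L \<ge> 0" "\<And>x y v. x \<in> cball m r \<Longrightarrow> y \<in> cball m r \<Longrightarrow>
     norm (A x v - A y v) \<le> L * norm (x - y) * norm v"
    using smooth_on_lipschitz_linear_family[of A S m r, OF sm r(2) lin] by blast
  obtain K M where KM: "K \<ge> 0" "M \<ge> 0"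
    "\<And>x u v. x \<in> cball m r \<Longrightarrow> norm (tangent_map (\<lambda>y. A y v) x u) \<le> M * norm u * norm v"
    "\<And>x y v. x \<in> cball m r \<Longrightarrow> y \<in> cball m r \<Longrightarrow>
      norm (A y v - A x v - tangent_map (\<lambda>y. A y v) x (y - x)) \<le> K * (norm (y - x))\<^sup>2 * norm v"
    using linear_family_taylor[of A S m r, OF sm S(1) r(2) lin] by blast
  \<comment> \<open>\<open>B * d \<le> r\<close> keeps the curves in the ball,
    \<open>L * d \<le> 1 / 2\<close> makes the Picard operator and the first-order comparison
    contract, and \<open>M * d \<le> 1 / 2\<close> does so for the second-order comparison. The
    added ones avoid division by zero.\<close>
  define d where "d = min (r / (B + 1)) (min (1 / (2 * (L + 1))) (1 / (2 * (M + 1))))"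
  have d: "d > 0" using r B L KM unfolding d_def by auto
  have "B * d \<le> (B + 1) * (r / (B + 1))"
    using B(1) d by (intro mult_mono) (auto simp: d_def)
  then have Bd: "B * d \<le> r" using B(1) by simp
  have "L * d \<le> (L + 1) * (1 / (2 * (L + 1)))"
    using L(1) d by (intro mult_mono) (auto simp: d_def)
  also have "\<dots> = 1 / 2" using L(1) by simp
  finally have Ld: "L * d \<le> 1 / 2" .
  have "M * d \<le> (M + 1) * (1 / (2 * (M + 1)))"
    using KM(2) d by (intro mult_mono) (auto simp: d_def)
  also have "\<dots> = 1 / 2" using KM(2) by simp
  finally have Md: "M * d \<le> 1 / 2" .
  have half: "c * norm w \<le> 1 / 2" if "c \<ge> 0" "c * d \<le> 1 / 2" "norm w < d" for c and w :: 'e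
    using that mult_left_mono[of "norm w" d c] by linarith
  have "\<forall>w. \<exists>z. norm w < d \<longrightarrow> z 0 = m \<and> (\<forall>s\<in>{0..1}. z s \<in> cball m r
      \<and> (z has_vector_derivative A (z s) w) (at s within {0..1}))" (is "\<forall>w. \<exists>z. ?P w z")
  proof
    fix w
    show "\<exists>z. ?P w z"
    proof (cases "norm w < d")
      case True
      show ?thesis
      proof (rule picard_unit_interval[of r m "\<lambda>x. A x w"])
        fix x y assume xy: "x \<in> cball m r" "y \<in> cball m r"
        have "norm (A x w - A y w) \<le> (L * norm w) * norm (x - y)"
          using L(2)[OF xy, of w] by (simp add: mult_ac)
        also have "\<dots> \<le> (1 / 2) * norm (x - y)"
          by (rule mult_right_mono[OF half[OF L(1) Ld True]]) simp
        finally show "norm (A x w - A y w) \<le> norm (x - y) / 2" by simp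
      next
        fix x assume "x \<in> cball m r"
        then have "norm (A x w) \<le> B * norm w" by (rule B(2))
        also have "\<dots> \<le> B * d" using True B(1) by (intro mult_left_mono) auto
        finally show "norm (A x w) \<le> r" using Bd by linarith
      qed (use r in auto)
    qed auto
  qed
  then obtain z where "\<forall>w. ?P w (z w)" by (rule exE[OF choice])
  then have z0: "z w 0 = m"
    and zb: "s \<in> {0..1} \<Longrightarrow> z w s \<in> cball m r"
    and zd: "s \<in> {0..1} \<Longrightarrow> (z w has_vector_derivative A (z w s) w) (at s within {0..1})"
    if "norm w < d" for w s using that by blast+
  have close: "norm (z (w + u) s - z w s) \<le> 2 * (B * norm u)"
    if w: "norm w < d" and wu: "norm (w + u) < d" and s: "s \<in> {0..1}" for w u s
  proof (rule norm_le_of_contracting_derivative[OF _ _ _ s, where g = "\<lambda>s. z (w + u) s - z w s"])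
    fix s :: real assume s: "s \<in> {0..1}"
    show "((\<lambda>s. z (w + u) s - z w s) has_vector_derivative A (z (w + u) s) (w + u) - A (z w s) w) (at s within {0..1})"
      by (rule has_vector_derivative_diff[OF zd[OF wu s] zd[OF w s]])
    have zz: "z w s \<in> cball m r" "z (w + u) s \<in> cball m r" using zb s w wu by blast+
    have "A (z (w + u) s) (w + u) - A (z w s) w
       = (A (z (w + u) s) (w + u) - A (z w s) (w + u)) + A (z w s) u"
      using lin[of "z w s"] zz r(2) by (simp add: linear_add subset_iff)
    also have "norm \<dots> \<le> (L * norm (w + u)) * norm (z (w + u) s - z w s) + B * norm u"
      using L(2)[OF zz(2,1), of "w + u"] B(2)[OF zz(1), of u] norm_triangle_ineq
      by (smt (verit, best) mult.assoc mult.commute)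
    also have "\<dots> \<le> (1 / 2) * norm (z (w + u) s - z w s) + B * norm u"
      by (intro add_right_mono mult_right_mono half L(1) Ld wu) simp
    finally show "norm (A (z (w + u) s) (w + u) - A (z w s) w) \<le> norm (z (w + u) s - z w s) / 2 + B * norm u"
      by simp
  qed (use z0 w wu in simp)
  \<comment> \<open>\<open>M * B\<close> bounds the quadratic term \<open>G (A ?z u) u\<close>. The
    other summand is the Taylor remainder, with \<open>2 * B * norm u\<close> for the distance of
    the curves from \<open>close\<close> and \<open>d\<close> for \<open>norm (w + u)\<close>. The
    factor 2 comes from \<open>norm_le_of_contracting_derivative\<close>.\<close>
  define C where "C = 2 * (M * B + K * (2 * B)\<^sup>2 * d)"
  have second: "norm (z (w + u) 1 - z w 1 - A (z w 1) u) \<le> C * (norm u)\<^sup>2"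
    if w: "norm w < d" and wu: "norm (w + u) < d" for w u
  proof -
    let ?D = "\<lambda>x u v. tangent_map (\<lambda>y. A y v) x u"
    \<comment> \<open>\<open>?e\<close> is the error of the predicted first variation
      \<open>s *\<^sub>R A (z w s) u\<close>; its value at \<open>s = 1\<close> is the remainder in
      the derivative of the solution.\<close>
    let ?e = "\<lambda>s. z (w + u) s - z w s - s *\<^sub>R A (z w s) u"
    let ?e' = "\<lambda>s. A (z (w + u) s) (w + u) - A (z w s) w - (s *\<^sub>R ?D (z w s) (A (z w s) w) u + A (z w s) u)"
    have "norm (?e 1) \<le> 2 * ((M * B + K * (2 * B)\<^sup>2 * d) * (norm u)\<^sup>2)"
    proof (rule norm_le_of_contracting_derivative[where g = ?e and g' = ?e'])
      fix s :: real assume s: "s \<in> {0..1}"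
      have zz: "z w s \<in> cball m r" "z (w + u) s \<in> cball m r" using zb s w wu by blast+
      then have zS: "z w s \<in> S" using r(2) by blast
      have "((\<lambda>s. A (z w s) u) has_vector_derivative ?D (z w s) (A (z w s) w) u) (at s within {0..1})"
      proof -
        have "((\<lambda>y. A y u) has_derivative (\<lambda>v. ?D (z w s) v u)) (at (z w s))"
          by (rule smooth_on_has_derivative[OF sm zS])
        from diff_chain_within[OF zd[OF w s, unfolded has_vector_derivative_def] has_derivative_at_withinI[OF this]]
        show ?thesis
          using smooth_on_linear_tangent_map[OF sm zS, of u]
          by (simp add: has_vector_derivative_def o_def linear_cmul)
      qed
      from has_vector_derivative_scaleR[OF DERIV_ident this]
      have "((\<lambda>s. s *\<^sub>R A (z w s) u) has_vector_derivative
          s *\<^sub>R ?D (z w s) (A (z w s) w) u + A (z w s) u) (at s within {0..1})" by simp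
      then show "(?e has_vector_derivative ?e' s) (at s within {0..1})"
        by (intro has_vector_derivative_diff zd s w wu)
      let ?y = "z (w + u) s" and ?z = "z w s"
      define G where "G a v = ?D ?z a v" for a v
      have linG: "linear (G a)" for a
        unfolding G_def using smooth_on_has_derivative[OF sm zS]
        by (intro linear_tangent_map_family[OF S(1) zS _ lin]) (auto simp: differentiable_def)
      have linG': "linear (\<lambda>a. G a v)" for v
        unfolding G_def by (rule smooth_on_linear_tangent_map[OF sm zS])
      \<comment> \<open>The symmetry hypothesis enters here: differentiating the prediction along
        the curve produces \<open>s *\<^sub>R G (A ?z w) u\<close>, and linearising the field
        produces \<open>s *\<^sub>R G (A ?z u) w\<close>. Their cancellation removes the only term
        that is merely linear in \<open>u\<close> and not proportional to \<open>?e\<close>.\<close>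
      have symG: "G (A ?z w) u = G (A ?z u) w"
        unfolding G_def by (rule sym[OF zS])
      have MG: "norm (G a v) \<le> M * norm a * norm v" for a v
        unfolding G_def by (rule KM(3)[OF zz(1)])
      define \<rho> where "\<rho> = A ?y (w + u) - A ?z (w + u) - G (?y - ?z) (w + u)"
      have "G (?y - ?z) (w + u) = G (?e s) (w + u) + s *\<^sub>R G (A ?z u) (w + u)"
        using linear_add[OF linG', of "?e s" "s *\<^sub>R A ?z u" "w + u"]
        by (simp add: linear_cmul[OF linG'])
      moreover have "G (A ?z u) (w + u) = G (A ?z w) u + G (A ?z u) u"
        using linear_add[OF linG] symG by simp
      moreover have "A ?z (w + u) = A ?z w + A ?z u" by (rule linear_add[OF lin[OF zS]])
      ultimately have "?e' s = G (?e s) (w + u) + s *\<^sub>R G (A ?z u) u + \<rho>"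
        unfolding \<rho>_def G_def[symmetric] by (simp add: scaleR_add_right)
      also have "norm \<dots> \<le> norm (G (?e s) (w + u)) + norm (s *\<^sub>R G (A ?z u) u) + norm \<rho>"
        by (rule norm_triangle_le[OF add_right_mono[OF norm_triangle_ineq]])
      also have "\<dots> \<le> (1 / 2) * norm (?e s) + M * B * (norm u)\<^sup>2 + K * (2 * B)\<^sup>2 * d * (norm u)\<^sup>2"
      proof (intro add_mono)
        have "norm (G (?e s) (w + u)) \<le> (M * norm (w + u)) * norm (?e s)"
          using MG[of "?e s" "w + u"] by (simp only: mult_ac)
        also have "\<dots> \<le> (1 / 2) * norm (?e s)"
          by (intro mult_right_mono half KM(2) Md wu) simp
        finally show "norm (G (?e s) (w + u)) \<le> (1 / 2) * norm (?e s)" .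
        have "norm (s *\<^sub>R G (A ?z u) u) \<le> norm (G (A ?z u) u)"
          using s by (simp add: mult_left_le_one_le)
        also have "\<dots> \<le> M * norm (A ?z u) * norm u" by (rule MG)
        also have "\<dots> \<le> M * (B * norm u) * norm u"
          by (intro mult_right_mono mult_left_mono B(2) zz KM(2)) simp
        finally show "norm (s *\<^sub>R G (A ?z u) u) \<le> M * B * (norm u)\<^sup>2"
          by (simp add: power2_eq_square mult_ac)
        have "norm \<rho> \<le> K * (norm (?y - ?z))\<^sup>2 * norm (w + u)"
          unfolding \<rho>_def G_def by (rule KM(4)[OF zz])
        also have "\<dots> \<le> K * (2 * (B * norm u))\<^sup>2 * d"
          using close[OF w wu s] wu KM(1) by (intro mult_mono power_mono) auto
        finally show "norm \<rho> \<le> K * (2 * B)\<^sup>2 * d * (norm u)\<^sup>2"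
          by (simp add: power_mult_distrib mult_ac)
      qed
      finally show "norm (?e' s) \<le> norm (?e s) / 2 + (M * B + K * (2 * B)\<^sup>2 * d) * (norm u)\<^sup>2"
        by (simp add: algebra_simps)
    qed (use z0 w wu in auto)
    then show ?thesis by (simp add: C_def algebra_simps)
  qed
  show ?thesis
  proof (rule that[of d "\<lambda>w. z w 1"])
    show "z 0 1 = m"
    proof -
      have "norm (z 0 1 - m) \<le> 2 * 0"
      proof (rule norm_le_of_contracting_derivative[where g = "\<lambda>s. z 0 s - m" and g' = "\<lambda>s. A (z 0 s) 0 - 0"])
        fix s :: real assume s: "s \<in> {0..1}"
        show "((\<lambda>s. z 0 s - m) has_vector_derivative A (z 0 s) 0 - 0) (at s within {0..1})"
          using d s by (intro has_vector_derivative_diff zd has_vector_derivative_const) auto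
        show "norm (A (z 0 s) 0 - 0) \<le> norm (z 0 s - m) / 2 + 0"
          using B(2)[OF zb[OF _ s], of 0 0] d by simp
      qed (use z0 d in auto)
      then show ?thesis by simp
    qed
    fix w :: 'e assume "w \<in> ball 0 d"
    then have w: "norm w < d" by simp
    show "z w 1 \<in> S" using zb[OF w, of 1] r(2) by auto
    show "((\<lambda>w. z w 1) has_derivative A (z w 1)) (at w)"
      unfolding has_derivative_at_alt
    proof (intro conjI allI impI)
      show "bounded_linear (A (z w 1))"
        using lin \<open>z w 1 \<in> S\<close> by (auto intro: linear_conv_bounded_linear[THEN iffD1])
      fix e :: real assume e: "e > 0"
      have C0: "C \<ge> 0" using KM B d by (simp add: C_def)
      define \<delta> where "\<delta> = min (d - norm w) (e / (C + 1))"
      have \<delta>: "\<delta> > 0" using w e C0 by (auto simp: \<delta>_def)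
      have "norm (z y 1 - z w 1 - A (z w 1) (y - w)) \<le> e * norm (y - w)" if y: "norm (y - w) < \<delta>" for y
      proof -
        have "norm y \<le> norm w + norm (y - w)" using norm_triangle_ineq[of w "y - w"] by simp
        then have ny: "norm (w + (y - w)) < d" using y by (simp add: \<delta>_def)
        have "norm (z y 1 - z w 1 - A (z w 1) (y - w)) \<le> C * (norm (y - w))\<^sup>2"
          using second[OF w ny] by simp
        also have "\<dots> = (C * norm (y - w)) * norm (y - w)" by (simp add: power2_eq_square mult_ac)
        also have "C * norm (y - w) \<le> (C + 1) * (e / (C + 1))"
          using y C0 e by (intro mult_mono) (auto simp: \<delta>_def)
        also have "\<dots> = e" using C0 by simp
        finally show ?thesis by (simp add: mult_right_mono)
      qed
      then show "\<exists>\<delta>>0. \<forall>y. norm (y - w) < \<delta> \<longrightarrow> norm (z y 1 - z w 1 - A (z w 1) (y - w)) \<le> e * norm (y - w)"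
        using \<delta> by blast
    qed
  qed (use d in auto)
qed

section \<open>The Frobenius theorem\<close>

text \<open>Since \<open>a\<close> vanishes at \<open>x\<close>, mere continuity of \<open>c\<close>
  there gives the product rule. This lets an inverse be differentiated before its differentiability
  is known.\<close>

lemma has_derivative_scaleR_zero:
  fixes a :: "'a::real_normed_vector \<Rightarrow> real" and c :: "'a \<Rightarrow> 'b::real_normed_vector"
  assumes a: "(a has_derivative a') (at x)" "a x = 0" and c: "isCont c x"
  shows "((\<lambda>y. a y *\<^sub>R c y) has_derivative (\<lambda>u. a' u *\<^sub>R c x)) (at x)"
  unfolding has_derivative_at_within
proof
  have bl: "bounded_linear a'" using a(1) has_derivative_bounded_linear by blast
  show "bounded_linear (\<lambda>u. a' u *\<^sub>R c x)"
    by (rule bounded_linear_compose[OF bounded_linear_scaleR_left bl])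
  obtain K where K: "\<forall>u. norm (a' u) \<le> norm u * K"
    by (rule exE[OF bounded_linear.bounded[OF bl]])
  have lim: "((\<lambda>y. (a y - a x - a' (y - x)) /\<^sub>R norm (y - x)) \<longlongrightarrow> 0) (at x)"
    using a(1) unfolding has_derivative_at_within by blast
  have cl: "(c \<longlongrightarrow> c x) (at x)" using c by (simp add: isCont_def)
  have "((\<lambda>y. ((a y - a x - a' (y - x)) /\<^sub>R norm (y - x)) *\<^sub>R c y) \<longlongrightarrow> 0 *\<^sub>R c x) (at x)"
    by (rule tendsto_scaleR[OF lim cl])
  moreover have "((\<lambda>y. (a' (y - x) / norm (y - x)) *\<^sub>R (c y - c x)) \<longlongrightarrow> 0) (at x)"
  proof (rule Lim_null_comparison)
    have "norm ((a' (y - x) / norm (y - x)) *\<^sub>R (c y - c x)) \<le> K * norm (c y - c x)" if "y \<noteq> x" for y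
    proof -
      have "norm (a' (y - x)) / norm (y - x) \<le> K"
        using K[rule_format, of "y - x"] that by (simp add: divide_le_eq mult.commute)
      then have "norm (a' (y - x)) / norm (y - x) * norm (c y - c x) \<le> K * norm (c y - c x)"
        by (rule mult_right_mono) simp
      then show ?thesis by simp
    qed
    then show "\<forall>\<^sub>F y in at x. norm ((a' (y - x) / norm (y - x)) *\<^sub>R (c y - c x)) \<le> K * norm (c y - c x)"
      by (auto simp: eventually_at_filter)
    have "((\<lambda>y. norm (c y - c x)) \<longlongrightarrow> 0) (at x)"
      using cl by (simp add: tendsto_norm_zero_iff LIM_zero_iff)
    from tendsto_mult_right_zero[OF this] show "((\<lambda>y. K * norm (c y - c x)) \<longlongrightarrow> 0) (at x)" .
  qed
  ultimately have "((\<lambda>y. ((a y - a x - a' (y - x)) /\<^sub>R norm (y - x)) *\<^sub>R c y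
      + (a' (y - x) / norm (y - x)) *\<^sub>R (c y - c x)) \<longlongrightarrow> 0) (at x)"
    using tendsto_add_zero by fastforce
  then show "((\<lambda>y. ((a y *\<^sub>R c y - a x *\<^sub>R c x) - a' (y - x) *\<^sub>R c x) /\<^sub>R norm (y - x)) \<longlongrightarrow> 0) (at x)"
    by (rule Lim_transform_eventually)
      (simp add: a(2) scaleR_diff_left scaleR_diff_right divide_inverse_commute algebra_simps)
qed

lemma linear_family_eventually_close:
  fixes G :: "'a::euclidean_space \<Rightarrow> 'e::euclidean_space \<Rightarrow> 'b::real_normed_vector"
  assumes S: "open S" "x \<in> S" and lin: "\<And>y. y \<in> S \<Longrightarrow> linear (G y)"
    and cont: "\<And>v. continuous_on S (\<lambda>y. G y v)" and e: "e > 0"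
  shows "\<forall>\<^sub>F y in nhds x. \<forall>v. norm (G y v - G x v) \<le> e * norm v"
proof -
  let ?n = "real DIM('e)"
  have n: "?n > 0" by simp
  have "\<forall>\<^sub>F y in nhds x. norm (G y b - G x b) \<le> e / ?n" for b
  proof -
    have "isCont (\<lambda>y. G y b) x"
      using cont[of b] S(2) continuous_on_eq_continuous_at[OF S(1)] by blast
    then have "((\<lambda>y. G y b) \<longlongrightarrow> G x b) (nhds x)"
      unfolding isCont_def by (rule tendsto_at_iff_tendsto_nhds[THEN iffD1])
    then have "\<forall>\<^sub>F y in nhds x. dist (G y b) (G x b) < e / ?n"
      using e n by (intro tendstoD) auto
    then show ?thesis by eventually_elim (simp add: dist_norm)
  qed
  then have "\<forall>\<^sub>F y in nhds x. \<forall>b\<in>Basis. norm (G y b - G x b) \<le> e / ?n"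
    by (intro eventually_ball_finite finite_Basis ballI)
  moreover have "\<forall>\<^sub>F y in nhds x. y \<in> S" using S eventually_nhds_in_open by blast
  ultimately show ?thesis
  proof eventually_elim
    case (elim y)
    show ?case
    proof
      fix v
      have "norm (G y v - G x v) \<le> (\<Sum>b\<in>(Basis::'e set). e / ?n) * norm v"
        using elim by (intro linear_norm_le_sum_Basis linear_compose_sub lin S) auto
      then show "norm (G y v - G x v) \<le> e * norm v" by simp
    qed
  qed
qed

text \<open>Everything rests on \<open>C y e - C x e = C y (G x (C x e) - G y (C x e))\<close>: it
  gives first continuity, then the derivative, and then each order of smoothness from the preceding
  one.\<close>

lemma smooth_on_inverse_family:
  fixes G C :: "'a::euclidean_space \<Rightarrow> 'e::euclidean_space \<Rightarrow> 'e"
  assumes S: "open S" and sm: "\<And>v. smooth_on (\<lambda>y. G y v) S"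
    and linG: "\<And>y. y \<in> S \<Longrightarrow> linear (G y)" and linC: "\<And>y. y \<in> S \<Longrightarrow> linear (C y)"
    and CG: "\<And>y v. y \<in> S \<Longrightarrow> C y (G y v) = v" and GC: "\<And>y v. y \<in> S \<Longrightarrow> G y (C y v) = v"
  shows "smooth_on (\<lambda>y. C y e) S"
proof -
  have diff: "C y e - C x e = C y (G x (C x e) - G y (C x e))" if "x \<in> S" "y \<in> S" for x y e
    using that by (simp add: linear_diff[OF linC] CG GC)
  have cont: "isCont (\<lambda>y. C y e) x" if x: "x \<in> S" for x e
  proof -
    obtain K where K: "K > 0" "\<And>v. norm (C x v) \<le> K * norm v"
      using linear_bounded_pos[OF linC[OF x]] by blast
    \<comment> \<open>With this closeness the perturbation costs at most half of
      \<open>norm v\<close> in the estimate below and can be absorbed into the left side, so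
      \<open>C y\<close> is bounded by \<open>2 * K\<close> near \<open>x\<close>.\<close>
    have near: "\<forall>\<^sub>F y in nhds x. \<forall>v. norm (G y v - G x v) \<le> 1 / (2 * K) * norm v"
      using K by (intro linear_family_eventually_close[OF S x] linG smooth_on_continuous_on sm) auto
    moreover have "\<forall>\<^sub>F y in nhds x. y \<in> S" using S x eventually_nhds_in_open by blast
    ultimately have ev: "\<forall>\<^sub>F y in nhds x. norm (C y e - C x e) \<le> 2 * K * norm (G x (C x e) - G y (C x e))"
    proof eventually_elim
      case (elim y)
      define w where "w = G x (C x e) - G y (C x e)"
      define v where "v = C y w"
      have "norm v = norm (C x (G x v))" by (simp add: CG x)
      also have "\<dots> \<le> K * norm (G x v)" by (rule K(2))
      also have "\<dots> \<le> K * (norm (G y v) + 1 / (2 * K) * norm v)"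
        using elim(1)[rule_format, of v] K(1) norm_triangle_sub[of "G x v" "G y v"]
        by (intro mult_left_mono) (auto simp: norm_minus_commute)
      also have "\<dots> = K * norm w + norm v / 2"
        using K(1) elim(2) by (simp add: v_def GC field_simps)
      finally have "norm v \<le> 2 * K * norm w" by simp
      then show ?case using diff[OF x elim(2), of e] by (simp add: v_def w_def)
    qed
    have "((\<lambda>y. C y e - C x e) \<longlongrightarrow> 0) (at x)"
    proof (rule Lim_null_comparison)
      show "\<forall>\<^sub>F y in at x. norm (C y e - C x e) \<le> 2 * K * norm (G x (C x e) - G y (C x e))"
        using ev by (simp add: eventually_at_filter eventually_mono)
      have "isCont (\<lambda>y. G y (C x e)) x"
        using smooth_on_continuous_on[OF sm] x continuous_on_eq_continuous_at[OF S] by blast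
      then have "((\<lambda>y. G x (C x e) - G y (C x e)) \<longlongrightarrow> G x (C x e) - G x (C x e)) (at x)"
        unfolding isCont_def by (intro tendsto_diff tendsto_const)
      then have "((\<lambda>y. norm (G x (C x e) - G y (C x e))) \<longlongrightarrow> 0) (at x)"
        by (simp add: tendsto_norm_zero_iff)
      from tendsto_mult_right_zero[OF this]
      show "((\<lambda>y. 2 * K * norm (G x (C x e) - G y (C x e))) \<longlongrightarrow> 0) (at x)" .
    qed
    then show ?thesis by (simp add: isCont_def LIM_zero_iff)
  qed
  define D where "D x u v = tangent_map (\<lambda>y. G y v) x u" for x u v
  have hd: "((\<lambda>y. G y v) has_derivative (\<lambda>u. D x u v)) (at x)" if "x \<in> S" for x v
    unfolding D_def by (rule smooth_on_has_derivative[OF sm that])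
  have linD: "linear (D x u)" if "x \<in> S" for x u
    unfolding D_def using smooth_on_has_derivative[OF sm that]
    by (intro linear_tangent_map_family[OF S(1) that _ linG]) (auto simp: differentiable_def)
  have der: "((\<lambda>y. C y e) has_derivative (\<lambda>u. - C x (D x u (C x e)))) (at x)" if x: "x \<in> S" for x e
  proof -
    \<comment> \<open>\<open>w\<close> vanishes at \<open>x\<close>, so in the expansion of
      \<open>C y (w y)\<close> the factors \<open>C y b\<close> need only be continuous.\<close>
    define w where "w y = G x (C x e) - G y (C x e)" for y
    have "(w has_derivative (\<lambda>u. 0 - D x u (C x e))) (at x)"
      unfolding w_def by (intro has_derivative_diff has_derivative_const hd x)
    then have "((\<lambda>y. w y \<bullet> b) has_derivative (\<lambda>u. (- D x u (C x e)) \<bullet> b)) (at x)" for b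
      using has_derivative_inner_left by fastforce
    then have "((\<lambda>y. (w y \<bullet> b) *\<^sub>R C y b) has_derivative (\<lambda>u. ((- D x u (C x e)) \<bullet> b) *\<^sub>R C x b)) (at x)" for b
      by (rule has_derivative_scaleR_zero) (simp_all add: w_def cont x)
    then have "((\<lambda>y. C x e + (\<Sum>b\<in>Basis. (w y \<bullet> b) *\<^sub>R C y b)) has_derivative
       (\<lambda>u. 0 + (\<Sum>b\<in>Basis. ((- D x u (C x e)) \<bullet> b) *\<^sub>R C x b))) (at x)"
      by (intro has_derivative_add has_derivative_const has_derivative_sum)
    moreover have "(\<Sum>b\<in>Basis. ((- D x u (C x e)) \<bullet> b) *\<^sub>R C x b) = - C x (D x u (C x e))" for u
      using linear_expand_Basis[OF linC[OF x], of "- D x u (C x e)"] linear_neg[OF linC[OF x]] by simp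
    ultimately have "((\<lambda>y. C x e + (\<Sum>b\<in>Basis. (w y \<bullet> b) *\<^sub>R C y b)) has_derivative
       (\<lambda>u. - C x (D x u (C x e)))) (at x)" by simp
    moreover have "C x e + (\<Sum>b\<in>Basis. (w y \<bullet> b) *\<^sub>R C y b) = C y e" if "y \<in> S" for y
      using linear_expand_Basis[OF linC[OF that], of "w y"] diff[OF x that, of e]
      by (simp add: w_def algebra_simps)
    ultimately show ?thesis by (rule has_derivative_transform_within_open[OF _ S x])
  qed
  have "Ck_on k (\<lambda>y. C y e) S" for k e
  proof (induction k arbitrary: e)
    case 0
    show ?case using cont by (simp add: continuous_at_imp_continuous_on)
  next
    case (Suc k)
    show ?case
    proof (rule Ck_on_SucI[OF S der])
      fix u
      have "smooth_on (\<lambda>x. D x u v) S" for v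
        unfolding D_def by (rule smooth_on_tangent_map[OF sm])
      then have DC: "Ck_on k (\<lambda>x. D x u v) S" for v by (simp add: smooth_on_def)
      have "Ck_on k (\<lambda>x. D x u (C x e)) S"
        by (rule Ck_on_apply_linear[OF S DC linD Suc])
      from Ck_on_apply_linear[of S k C, OF S Suc linC this]
      have "Ck_on k (\<lambda>x. C x (D x u (C x e))) S" by simp
      from Ck_on_bounded_linear[OF S this bounded_linear_minus[OF bounded_linear_ident]]
      show "Ck_on k (\<lambda>x. - C x (D x u (C x e))) S" .
    qed
  qed
  then show ?thesis by (simp add: smooth_on_def)
qed

text \<open>Normalising the frame \<open>F\<close> by a fixed left inverse \<open>P\<close> makes it commute: \<open>P\<close> annihilates
  all brackets of the normalised frame \<open>A\<close>, and is injective on the distribution.\<close>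

lemma frobenius:
  fixes F :: "'a::euclidean_space \<Rightarrow> 'e::euclidean_space \<Rightarrow> 'a"
  assumes S: "open S" "m \<in> S" and sm: "\<And>v. smooth_on (\<lambda>y. F y v) S"
    and lin: "\<And>y. y \<in> S \<Longrightarrow> linear (F y)" and inj: "inj (F m)"
    and invol: "\<And>x u v. x \<in> S \<Longrightarrow> lie_bracket (\<lambda>y. F y u) (\<lambda>y. F y v) x \<in> range (F x)"
  shows "\<exists>(W :: 'e set) \<phi>. open W \<and> smooth_on \<phi> W \<and> inj_on \<phi> W
    \<and> (\<forall>w\<in>W. inj (tangent_map \<phi> w) \<and> range (tangent_map \<phi> w) = range (F (\<phi> w)))
    \<and> m \<in> \<phi> ` W \<and> \<phi> ` W \<subseteq> S"
proof -
  obtain P where P: "linear P" "P \<circ> F m = id"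
    using linear_injective_left_inverse[OF lin[OF S(2)] inj] by blast
  have blP: "bounded_linear P" using P(1) linear_conv_bounded_linear by blast
  define G where "G y v = P (F y v)" for y v
  have Gm: "G m v = v" for v using P(2) by (simp add: G_def fun_eq_iff)
  have smG: "smooth_on (\<lambda>y. G y v) S" for v
    unfolding G_def by (rule smooth_on_bounded_linear[OF S(1) sm blP])
  have linG: "linear (G y)" if "y \<in> S" for y
    unfolding G_def using linear_compose[OF lin[OF that] P(1)] by (simp add: o_def)
  \<comment> \<open>\<open>G m\<close> is the identity, and a linear map within 1/2 of the identity
    has trivial kernel.\<close>
  have "\<forall>\<^sub>F y in nhds m. \<forall>v. norm (G y v - G m v) \<le> 1 / 2 * norm v"
    by (rule linear_family_eventually_close[OF S linG smooth_on_continuous_on[OF smG]]) auto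
  moreover have "\<forall>\<^sub>F y in nhds m. y \<in> S" using S eventually_nhds_in_open by blast
  ultimately have "\<forall>\<^sub>F y in nhds m. y \<in> S \<and> (\<forall>v. norm (G y v - v) \<le> 1 / 2 * norm v)"
    by eventually_elim (simp add: Gm)
  then obtain T where T: "open T" "m \<in> T" "\<And>y. y \<in> T \<Longrightarrow> y \<in> S"
    "\<And>y v. y \<in> T \<Longrightarrow> norm (G y v - v) \<le> 1 / 2 * norm v"
    unfolding eventually_nhds by blast
  have TS: "T \<subseteq> S" using T(3) by blast
  have injG: "inj (G y)" if y: "y \<in> T" for y
  proof -
    have "v = 0" if "G y v = 0" for v using T(4)[OF y, of v] that by simp
    then show ?thesis using linear_injective_0[OF linG[OF T(3)[OF y]]] by blast
  qed
  have "\<forall>y. \<exists>C. y \<in> T \<longrightarrow> linear C \<and> (\<forall>v. C (G y v) = v) \<and> (\<forall>v. G y (C v) = v)" (is "\<forall>y. \<exists>C. ?P y C")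
    using linear_injective_isomorphism[OF linG[OF T(3)] injG] by blast
  then obtain C where "\<forall>y. ?P y (C y)" by (rule exE[OF choice])
  then have C: "linear (C y)" "C y (G y v) = v" "G y (C y v) = v" if "y \<in> T" for y v
    using that by auto
  have smC: "smooth_on (\<lambda>y. C y e) T" for e
    by (rule smooth_on_inverse_family[OF T(1) smooth_on_subset[OF smG TS] linG[OF T(3)] C])
  define A where "A y v = F y (C y v)" for y v
  have smA: "smooth_on (\<lambda>y. A y v) T" for v
    unfolding A_def by (rule smooth_on_apply_linear[OF T(1) smooth_on_subset[OF sm TS] lin[OF T(3)] smC])
  have linA: "linear (A y)" if "y \<in> T" for y
    unfolding A_def using linear_compose[OF C(1)[OF that] lin[OF T(3)[OF that]]] by (simp add: o_def)
  have PA: "P (A y v) = v" if "y \<in> T" for y v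
    using C(3)[OF that] by (simp add: A_def G_def)
  have sym: "tangent_map (\<lambda>y. A y v) x (A x u) = tangent_map (\<lambda>y. A y u) x (A x v)" if x: "x \<in> T" for x u v
  proof -
    have xS: "x \<in> S" by (rule T(3)[OF x])
    have dF: "(\<lambda>y. F y v) differentiable (at x)" for v
      using smooth_on_has_derivative[OF sm xS] differentiable_def by blast
    have dC: "(\<lambda>y. C y v) differentiable (at x)" for v
      using smooth_on_has_derivative[OF smC x] differentiable_def by blast
    have 1: "tangent_map (\<lambda>y. A y v) x (A x u) = tangent_map (\<lambda>y. F y (C x v)) x (F x (C x u))
      + F x (tangent_map (\<lambda>y. C y v) x (A x u))" for u v
      unfolding A_def by (rule tangent_map_apply_linear[OF S(1) xS dF lin dC])
    have P0: "P (tangent_map (\<lambda>y. A y v) x w) = 0" for v w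
    proof -
      have "((\<lambda>y. P (A y v)) has_derivative (\<lambda>w. P (tangent_map (\<lambda>y. A y v) x w))) (at x)"
        by (rule bounded_linear.has_derivative[OF blP smooth_on_has_derivative[OF smA x]])
      then have "((\<lambda>y. v) has_derivative (\<lambda>w. P (tangent_map (\<lambda>y. A y v) x w))) (at x)"
        by (rule has_derivative_transform_within_open[OF _ T(1) x]) (simp add: PA)
      then show ?thesis using has_derivative_unique[OF _ has_derivative_const] by metis
    qed
    obtain e where e: "lie_bracket (\<lambda>y. F y (C x u)) (\<lambda>y. F y (C x v)) x = F x e"
      using invol[OF xS] by blast
    \<comment> \<open>The Leibniz rule splits the bracket of the normalised fields into the bracket
      of the fields with coefficients frozen at \<open>x\<close> and the derivatives of the
      coefficients; both lie in the range of \<open>F x\<close>.\<close>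
    define e' where "e' = e + tangent_map (\<lambda>y. C y v) x (A x u) - tangent_map (\<lambda>y. C y u) x (A x v)"
    have "tangent_map (\<lambda>y. A y v) x (A x u) - tangent_map (\<lambda>y. A y u) x (A x v) = F x e'"
      unfolding 1 e'_def using e by (simp add: lie_bracket_def linear_add[OF lin[OF xS]] linear_diff[OF lin[OF xS]])
    moreover have "P (tangent_map (\<lambda>y. A y v) x (A x u) - tangent_map (\<lambda>y. A y u) x (A x v)) = 0"
      by (simp add: linear_diff[OF P(1)] P0)
    ultimately have "G x e' = 0" by (simp add: G_def)
    then have "e' = 0" using C(2)[OF x, of e'] linear_0[OF C(1)[OF x]] by simp
    then have "F x e' = 0" using linear_0[OF lin[OF xS]] by simp
    with \<open>_ = F x e'\<close> show ?thesis by simp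
  qed
  obtain \<phi> d where \<phi>: "d > 0" "\<phi> 0 = m" "\<And>w. w \<in> ball 0 d \<Longrightarrow> \<phi> w \<in> T"
    "\<And>w. w \<in> ball 0 d \<Longrightarrow> (\<phi> has_derivative A (\<phi> w)) (at w)"
    using total_differential_equation[OF T(1,2) smA linA sym] by metis
  let ?W = "ball (0::'e) d"
  have tm: "tangent_map \<phi> w = A (\<phi> w)" if "w \<in> ?W" for w
    by (rule tangent_map_eq[OF \<phi>(4)[OF that]])
  have "Ck_on k \<phi> ?W" for k
  proof (induction k)
    case 0
    show ?case
      using has_derivative_continuous[OF \<phi>(4)] by (simp add: continuous_at_imp_continuous_on)
  next
    case (Suc k)
    have "Ck_on k (\<lambda>w. A (\<phi> w) v) ?W" for v
      using smA by (intro Ck_on_compose[OF open_ball Suc, of "\<lambda>y. A y v" T]) (auto simp: smooth_on_def \<phi>(3))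
    then show ?case by (intro Ck_on_SucI[OF open_ball \<phi>(4)])
  qed
  then have smooth: "smooth_on \<phi> ?W" by (simp add: smooth_on_def)
  \<comment> \<open>\<open>P\<close> inverts the derivative of \<open>\<phi>\<close> everywhere, so
    \<open>P\<close> inverts \<open>\<phi>\<close> itself up to a translation; this gives
    injectivity on the whole ball.\<close>
  have "\<exists>c. \<forall>w\<in>?W. P (\<phi> w) - w = c"
  proof (rule has_derivative_zero_constant[OF convex_ball])
    fix w assume w: "w \<in> ?W"
    have "((\<lambda>w. P (\<phi> w) - w) has_derivative (\<lambda>v. P (A (\<phi> w) v) - v)) (at w)"
      by (intro has_derivative_diff bounded_linear.has_derivative[OF blP \<phi>(4)[OF w]] has_derivative_ident)
    then have "((\<lambda>w. P (\<phi> w) - w) has_derivative (\<lambda>v. 0)) (at w)"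
      by (simp add: PA[OF \<phi>(3)[OF w]])
    then show "((\<lambda>w. P (\<phi> w) - w) has_derivative (\<lambda>v. 0)) (at w within ?W)"
      by (rule has_derivative_at_withinI)
  qed
  then obtain c where c: "\<And>w. w \<in> ?W \<Longrightarrow> P (\<phi> w) - w = c" by blast
  have "inj_on \<phi> ?W"
  proof (rule inj_onI)
    fix v w assume "v \<in> ?W" "w \<in> ?W" "\<phi> v = \<phi> w"
    then show "v = w" using c[of v] c[of w] by (simp add: algebra_simps)
  qed
  moreover have "inj (tangent_map \<phi> w) \<and> range (tangent_map \<phi> w) = range (F (\<phi> w))" if w: "w \<in> ?W" for w
  proof
    have wT: "\<phi> w \<in> T" by (rule \<phi>(3)[OF w])
    show "inj (tangent_map \<phi> w)"
      unfolding tm[OF w] by (rule inj_on_inverseI[of _ P]) (rule PA[OF wT])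
    have "F (\<phi> w) v = A (\<phi> w) (G (\<phi> w) v)" for v by (simp add: A_def C(2)[OF wT])
    then show "range (tangent_map \<phi> w) = range (F (\<phi> w))"
      unfolding tm[OF w] by (auto simp: A_def)
  qed
  moreover have "m \<in> \<phi> ` ?W"
    by (rule image_eqI[of _ _ 0]) (simp_all add: \<phi>(1,2))
  moreover have "\<phi> ` ?W \<subseteq> S" using \<phi>(3) TS by auto
  ultimately have "open ?W \<and> smooth_on \<phi> ?W \<and> inj_on \<phi> ?W
    \<and> (\<forall>w\<in>?W. inj (tangent_map \<phi> w) \<and> range (tangent_map \<phi> w) = range (F (\<phi> w)))
    \<and> m \<in> \<phi> ` ?W \<and> \<phi> ` ?W \<subseteq> S"
    using smooth by simp
  then have "\<exists>\<phi>. open ?W \<and> smooth_on \<phi> ?W \<and> inj_on \<phi> ?W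
    \<and> (\<forall>w\<in>?W. inj (tangent_map \<phi> w) \<and> range (tangent_map \<phi> w) = range (F (\<phi> w)))
    \<and> m \<in> \<phi> ` ?W \<and> \<phi> ` ?W \<subseteq> S"
    by (rule exI[of _ \<phi>])
  then show ?thesis by (rule exI[of _ ?W])
qed

section \<open>The complete lift and the associated 2-forms\<close>

lemma second_derivative_symmetric_vector:
  fixes f :: "'a::euclidean_space \<Rightarrow> 'b::euclidean_space"
  assumes S: "open S" "x \<in> S" and f: "smooth_on f S"
  shows "tangent_map (\<lambda>y. tangent_map f y v) x u = tangent_map (\<lambda>y. tangent_map f y u) x v"
proof (rule euclidean_eqI)
  fix b :: 'b assume "b \<in> Basis"
  have fb: "smooth_on (\<lambda>y. f y \<bullet> b) S"
    by (rule smooth_on_bounded_linear[OF S(1) f bounded_linear_inner_left])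
  have 1: "tangent_map (\<lambda>y. f y \<bullet> b) y v = tangent_map f y v \<bullet> b" if "y \<in> S" for y v
    using has_derivative_inner_left[OF smooth_on_has_derivative[OF f that]] tangent_map_eq by metis
  have 2: "tangent_map (\<lambda>y. tangent_map (\<lambda>y. f y \<bullet> b) y v) x u = tangent_map (\<lambda>y. tangent_map f y v) x u \<bullet> b" for u v
  proof -
    have "((\<lambda>y. tangent_map f y v \<bullet> b) has_derivative (\<lambda>u. tangent_map (\<lambda>y. tangent_map f y v) x u \<bullet> b)) (at x)"
      by (rule has_derivative_inner_left[OF smooth_on_has_derivative[OF smooth_on_tangent_map[OF f] S(2)]])
    then have "((\<lambda>y. tangent_map (\<lambda>y. f y \<bullet> b) y v) has_derivative (\<lambda>u. tangent_map (\<lambda>y. tangent_map f y v) x u \<bullet> b)) (at x)"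
      by (rule has_derivative_transform_within_open[OF _ S]) (simp add: 1)
    then show ?thesis by (simp add: tangent_map_eq)
  qed
  show "tangent_map (\<lambda>y. tangent_map f y v) x u \<bullet> b = tangent_map (\<lambda>y. tangent_map f y u) x v \<bullet> b"
    using second_derivative_symmetric[OF S fb] by (simp only: 2[symmetric])
qed

section \<open>Smooth maps into products and coordinate spaces\<close>

lemma smooth_on_Pair:
  assumes "open S" "smooth_on f S" "smooth_on g S"
  shows "smooth_on (\<lambda>x. (f x, g x)) S"
proof -
  have "bounded_linear (\<lambda>a. (a, 0::'c))" "bounded_linear (\<lambda>b. (0::'b, b))"
    by (auto intro!: bounded_linear_Pair bounded_linear_ident bounded_linear_zero)
  then have "smooth_on (\<lambda>x. (f x, 0) + (0, g x)) S"
    using smooth_on_bounded_linear[OF assms(1,2)] smooth_on_bounded_linear[OF assms(1,3)]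
    by (intro smooth_on_add assms) auto
  then show ?thesis by simp
qed

lemma smooth_on_vec:
  fixes f :: "'a::euclidean_space \<Rightarrow> 'n::finite \<Rightarrow> real"
  assumes "open S" "\<And>i. smooth_on (\<lambda>x. f x i) S"
  shows "smooth_on (\<lambda>x. \<chi> i. f x i) S"
proof -
  have "smooth_on (\<lambda>x. \<Sum>i\<in>UNIV. f x i *\<^sub>R (axis i 1 :: real^'n)) S"
    by (intro smooth_on_sum smooth_on_scaleR assms smooth_on_const)
  moreover have "(\<Sum>i\<in>UNIV. f x i *\<^sub>R (axis i 1 :: real^'n)) = (\<chi> i. f x i)" for x
    by (simp add: vec_eq_iff axis_def if_distrib[of "\<lambda>y. _ * y"] cong: if_cong)
  ultimately show ?thesis by simp
qed

lemma linear_snd_expand: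
  fixes g :: "real \<times> (real^'n) \<Rightarrow> real"
  assumes "linear g"
  shows "g (0, q) = (\<Sum>i\<in>UNIV. q $ i * g (0, axis i 1))"
proof -
  have "(0, q) = (\<Sum>i\<in>UNIV. q $ i *\<^sub>R ((0::real), axis i (1::real)))"
    by (simp add: prod_eq_iff fst_sum snd_sum vec_eq_iff axis_def if_distrib[of "\<lambda>y. _ * y"] cong: if_cong)
  then have "g (0, q) = g (\<Sum>i\<in>UNIV. q $ i *\<^sub>R (0, axis i 1))" by simp
  also have "\<dots> = (\<Sum>i\<in>UNIV. q $ i * g (0, axis i 1))"
    by (simp only: linear_sum[OF assms] linear_cmul[OF assms] real_scaleR_def)
  finally show ?thesis .
qed

text \<open>The situation in one bundle chart: the section has momentum components
  \<open>(-H, p)\<close>, and \<open>torsion\<close> is the Nijenhuis torsion evaluated on constant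
  fields \<open>a\<close> and \<open>b\<close>.\<close>

locale jet_system =
  fixes U :: "'n::finite base_coords set"
    and L :: "'n base_coords \<Rightarrow> 'n base_coords \<Rightarrow> 'n base_coords"
    and H :: "'n J1_coords \<Rightarrow> real"
  assumes U: "open U"
    and smL: "\<And>v. smooth_on (\<lambda>x. L x v) U"
    and linL: "\<And>x. x \<in> U \<Longrightarrow> linear (L x)"
    and dtL: "\<And>x v. x \<in> U \<Longrightarrow> fst (L x v) = 0"
    and torsion: "\<And>x a b. x \<in> U \<Longrightarrow>
       tangent_map (\<lambda>y. L y b) x (L x a) - tangent_map (\<lambda>y. L y a) x (L x b)
       + L x (tangent_map (\<lambda>y. L y a) x b) - L x (tangent_map (\<lambda>y. L y b) x a) = 0"
    and smH: "smooth_on H (U \<times> UNIV)"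
begin

abbreviation M :: "'n J1_coords set" where "M \<equiv> U \<times> UNIV"

abbreviation DL where "DL x a b \<equiv> tangent_map (\<lambda>y. L y b) x a"

abbreviation DS where "DS k x a b \<equiv> tangent_map (\<lambda>y. (L y ^^ k) b) x a"

definition hm :: "'n J1_coords \<Rightarrow> 'n base_coords" where
  "hm m = (- H m, snd m)"

definition Dhm :: "'n J1_coords \<Rightarrow> 'n J1_coords \<Rightarrow> 'n base_coords" where
  "Dhm m u = (- tangent_map H m u, snd u)"

text \<open>For \<open>k = 0\<close> this is the pullback of the canonical form by the section; for \<open>k \<ge> 1\<close> it
  is the horizontal lift of \<open>L\<^sup>k\<close> (the component \<open>-H\<close> drops out).\<close>

definition th :: "nat \<Rightarrow> 'n J1_coords \<Rightarrow> 'n J1_coords \<Rightarrow> real" where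
  "th k m v = hm m \<bullet> (L (fst m) ^^ k) (fst v)"

definition w :: "nat \<Rightarrow> 'n J1_coords \<Rightarrow> 'n J1_coords \<Rightarrow> 'n J1_coords \<Rightarrow> real" where
  "w k = ext_deriv (th k)"

definition X :: "'n J1_coords \<Rightarrow> 'n J1_coords" where
  "X m = ((1, \<chi> i. tangent_map H m (0, axis i 1)), - (\<chi> i. tangent_map H m ((0, axis i 1), 0)))"

text \<open>The coordinate formula of the complete lift, with the momentum part given by its
  pairings with the fibre directions of the base. The 0 stands for the momentum
  \<open>p\<^sub>0\<close>, which is harmless because the values of \<open>L\<close> and of its
  derivatives have no \<open>dt\<close> component.\<close>

definition N :: "'n J1_coords \<Rightarrow> 'n J1_coords \<Rightarrow> 'n J1_coords" where
  "N m u = (L (fst m) (fst u), \<chi> i. (0, snd u) \<bullet> L (fst m) (0, axis i 1)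
      + (0, snd m) \<bullet> (DL (fst m) (fst u) (0, axis i 1) - DL (fst m) (0, axis i 1) (fst u)))"

definition Y :: "nat \<Rightarrow> 'n J1_coords \<Rightarrow> 'n J1_coords" where
  "Y k m = (N m ^^ k) (X m)"

lemma openM: "open M"
  by (rule open_Times[OF U open_UNIV])

lemma fstM: "m \<in> M \<Longrightarrow> fst m \<in> U"
  by auto

lemma smooth_on_fst_compose: "smooth_on g U \<Longrightarrow> smooth_on (\<lambda>m. g (fst m)) M"
  by (rule smooth_on_compose[OF openM smooth_on_bounded_linear[OF openM smooth_on_ident[OF openM] bounded_linear_fst]])
    auto

lemma smooth_on_snd: "smooth_on snd M"
  using smooth_on_bounded_linear[OF openM smooth_on_ident[OF openM] bounded_linear_snd] by simp

section \<open>Powers of the tensor field and their derivatives\<close>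

lemma linS: "x \<in> U \<Longrightarrow> linear (L x ^^ k)"
proof (induction k)
  case 0
  show ?case by (simp add: linear_id[unfolded id_def] id_def)
next
  case (Suc k)
  then show ?case using linear_compose[OF Suc.IH[OF Suc.prems] linL[OF Suc.prems]]
    by (simp only: funpow.simps)
qed

lemma smS: "smooth_on (\<lambda>x. (L x ^^ k) v) U"
proof (induction k)
  case (Suc k)
  then show ?case using smooth_on_apply_linear[OF U smL linL Suc] by simp
qed simp

lemma hdS: "x \<in> U \<Longrightarrow> ((\<lambda>y. (L y ^^ k) v) has_derivative (\<lambda>u. DS k x u v)) (at x)"
  by (rule smooth_on_has_derivative[OF smS])

lemma difS: "x \<in> U \<Longrightarrow> (\<lambda>y. (L y ^^ k) v) differentiable (at x)"
  using hdS differentiable_def by blast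

lemma difL: "x \<in> U \<Longrightarrow> (\<lambda>y. L y v) differentiable (at x)"
  using difS[of x 1] by simp

lemma linDL: "x \<in> U \<Longrightarrow> linear (DL x a)"
  by (rule linear_tangent_map_family[OF U _ difL linL])

lemma linDL': "x \<in> U \<Longrightarrow> linear (\<lambda>a. DL x a b)"
  by (rule smooth_on_linear_tangent_map[OF smL])

text \<open>The power is split here with the extra factor on the outside, in \<open>DS_Suc'\<close>
  with the extra factor on the inside. Using one splitting for each order of the arguments makes the
  concomitant appear in \<open>w_step\<close>.\<close>

lemma DS_Suc: "x \<in> U \<Longrightarrow> DS (Suc k) x a b = DL x a ((L x ^^ k) b) + L x (DS k x a b)"
  using tangent_map_apply_linear[OF U _ difL linL difS] by simp

lemma DS_Suc': "x \<in> U \<Longrightarrow> DS (Suc k) x a b = DS k x a (L x b) + (L x ^^ k) (DL x a b)"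
  using tangent_map_apply_linear[OF U _ difS linS difL] by (simp add: funpow_swap1)

lemma fst_DL: "x \<in> U \<Longrightarrow> fst (DL x a b) = 0"
proof -
  assume x: "x \<in> U"
  have "((\<lambda>y. fst (L y b)) has_derivative (\<lambda>a. fst (DL x a b))) (at x)"
    by (rule has_derivative_fst[OF smooth_on_has_derivative[OF smL x]])
  then have "((\<lambda>y. 0) has_derivative (\<lambda>a. fst (DL x a b))) (at x)"
    by (rule has_derivative_transform_within_open[OF _ U x]) (simp add: dtL)
  then show ?thesis using has_derivative_unique[OF _ has_derivative_const] by metis
qed

text \<open>The concomitant of \<open>L\<close> and \<open>L\<^sup>k\<close>; the induction step is the vanishing of the torsion.\<close>

lemma concomitant_zero:
  assumes x: "x \<in> U"
  shows "DS k x (L x a) b - DL x ((L x ^^ k) b) a - L x (DS k x a b) + (L x ^^ k) (DL x b a) = 0"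
proof (induction k arbitrary: b)
  case 0
  show ?case using linear_0[OF linL[OF x]] by simp
next
  case (Suc k)
  have swap: "(L x ^^ Suc k) c = (L x ^^ k) (L x c)" for c by (simp add: funpow_swap1)
  have comm: "L x ((L x ^^ k) c) = (L x ^^ k) (L x c)" for c by (simp add: funpow_swap1)
  let ?T = "\<lambda>b. DS k x (L x a) b - DL x ((L x ^^ k) b) a - L x (DS k x a b) + (L x ^^ k) (DL x b a)"
  have "DS (Suc k) x (L x a) b - DL x ((L x ^^ Suc k) b) a - L x (DS (Suc k) x a b) + (L x ^^ Suc k) (DL x b a)
     = ?T (L x b) + (L x ^^ k) (DL x (L x a) b - DL x (L x b) a + L x (DL x b a) - L x (DL x a b))"
    unfolding DS_Suc'[OF x] swap
    by (simp add: linear_add[OF linL[OF x]] linear_add[OF linS[OF x]] linear_diff[OF linS[OF x]] comm)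
  also have "\<dots> = 0" using Suc[of "L x b"] torsion[OF x, of b a] linear_0[OF linS[OF x]] by simp
  finally show ?case .
qed

lemma hd_hm: "m \<in> M \<Longrightarrow> (hm has_derivative Dhm m) (at m)"
  unfolding hm_def Dhm_def
  by (intro has_derivative_Pair has_derivative_minus smooth_on_has_derivative[OF smH])
    (auto intro: bounded_linear_imp_has_derivative bounded_linear_snd)

lemma sm_hm: "smooth_on hm M"
  unfolding hm_def by (intro smooth_on_Pair openM smooth_on_minus smH smooth_on_snd)

lemma smth: "smooth_on (\<lambda>m. th k m v) M"
  unfolding th_def
  by (intro smooth_on_inner openM sm_hm smooth_on_fst_compose[OF smS])

lemma linth: "m \<in> M \<Longrightarrow> linear (th k m)"
proof -
  assume "m \<in> M"
  then have l: "linear (L (fst m) ^^ k)" using linS fstM by blast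
  have "linear (\<lambda>v. (L (fst m) ^^ k) (fst v))"
    using linear_compose[OF linear_fst l] by (simp add: o_def)
  from linear_compose[OF this bounded_linear.linear[OF bounded_linear_inner_right]]
  show ?thesis by (simp add: th_def[abs_def] o_def)
qed

lemma w_eq:
  assumes m: "m \<in> M"
  shows "w k m u v = Dhm m u \<bullet> (L (fst m) ^^ k) (fst v) - Dhm m v \<bullet> (L (fst m) ^^ k) (fst u)
    + hm m \<bullet> (DS k (fst m) (fst u) (fst v) - DS k (fst m) (fst v) (fst u))"
proof -
  have "((\<lambda>m. th k m b) has_derivative (\<lambda>u. hm m \<bullet> DS k (fst m) (fst u) (fst b) + Dhm m u \<bullet> (L (fst m) ^^ k) (fst b))) (at m)"
    for b
    unfolding th_def
  proof (rule has_derivative_inner[OF hd_hm[OF m]])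
    have "(fst has_derivative fst) (at m)"
      by (rule bounded_linear_imp_has_derivative[OF bounded_linear_fst])
    from diff_chain_at[OF this hdS[OF fstM[OF m]]]
    show "((\<lambda>m. (L (fst m) ^^ k) (fst b)) has_derivative (\<lambda>u. DS k (fst m) (fst u) (fst b))) (at m)"
      by (simp add: o_def)
  qed
  from tangent_map_eq[OF this] show ?thesis
    unfolding w_def ext_deriv_def by (simp add: inner_diff_right)
qed

lemma w_skew: "w k m u v = - w k m v u"
  unfolding w_def by (rule ext_deriv_skew)

lemma linw: "m \<in> M \<Longrightarrow> linear (w k m u)"
  unfolding w_def by (rule linear_ext_deriv[OF openM _ smth linth])

lemma linw': "m \<in> M \<Longrightarrow> linear (\<lambda>u. w k m u v)"
  unfolding w_def by (rule linear_ext_deriv_left[OF openM _ smth linth])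

text \<open>The zeros in the definition of \<open>N\<close> may be replaced by the components of
  \<open>Dhm\<close> and \<open>hm\<close> that involve \<open>H\<close>, as they are paired with
  vectors without \<open>dt\<close> component. This brings \<open>N\<close> into the form of the
  terms of \<open>w_eq\<close>.\<close>

lemma snd_N:
  assumes m: "m \<in> M" and y: "fst y = 0"
  shows "snd (N m u) \<bullet> snd y = Dhm m u \<bullet> L (fst m) y + hm m \<bullet> (DL (fst m) (fst u) y - DL (fst m) y (fst u))"
proof -
  have x: "fst m \<in> U" by (rule fstM[OF m])
  let ?g = "\<lambda>y. (0, snd u) \<bullet> L (fst m) y + (0, snd m) \<bullet> (DL (fst m) (fst u) y - DL (fst m) y (fst u))"
  have "linear ?g"
    by (intro linear_compose_add linear_compose_sub linL[OF x] linDL[OF x] linDL'[OF x]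
        linear_compose[OF _ bounded_linear.linear[OF bounded_linear_inner_right], unfolded o_def])
  from linear_snd_expand[OF this, of "snd y"]
  have "?g (0, snd y) = snd (N m u) \<bullet> snd y"
    by (simp add: N_def inner_vec_def mult.commute)
  moreover have "(0, snd y) = y" using y by (simp add: prod_eq_iff)
  moreover have "?g y = Dhm m u \<bullet> L (fst m) y + hm m \<bullet> (DL (fst m) (fst u) y - DL (fst m) y (fst u))"
    by (simp add: Dhm_def hm_def inner_prod_def dtL[OF x] fst_DL[OF x])
  ultimately show ?thesis by simp
qed

lemma fst_N: "fst (N m u) = L (fst m) (fst u)"
  by (simp add: N_def)

lemma fst_S: "x \<in> U \<Longrightarrow> k > 0 \<or> fst b = 0 \<Longrightarrow> fst ((L x ^^ k) b) = 0"
  by (cases k) (auto simp: dtL)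

text \<open>The hypothesis on \<open>v\<close> removes the \<open>dt\<close> component of
  \<open>(L ?x ^^ k) ?b\<close>, so the derivative of \<open>H\<close> along \<open>N m u\<close>
  drops out. The momentum part then agrees by \<open>snd_N\<close>, and the discrepancy of the
  remaining derivatives of \<open>L\<close> is the concomitant.\<close>

lemma w_step:
  assumes m: "m \<in> M" and v: "k > 0 \<or> fst (fst v) = 0"
  shows "w k m (N m u) v = w (Suc k) m u v"
proof -
  let ?x = "fst m" and ?a = "fst u" and ?b = "fst v"
  have x: "?x \<in> U" by (rule fstM[OF m])
  let ?y = "(L ?x ^^ k) ?b"
  have y: "fst ?y = 0" by (rule fst_S[OF x v])
  have swap: "(L ?x ^^ k) (L ?x c) = L ?x ((L ?x ^^ k) c)" for c by (simp add: funpow_swap1)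
  have "w k m (N m u) v = snd (N m u) \<bullet> snd ?y - Dhm m v \<bullet> (L ?x ^^ k) (L ?x ?a)
     + hm m \<bullet> (DS k ?x (L ?x ?a) ?b - DS k ?x ?b (L ?x ?a))"
    unfolding w_eq[OF m] fst_N using y by (simp add: Dhm_def inner_prod_def)
  also have "\<dots> = Dhm m u \<bullet> L ?x ?y - Dhm m v \<bullet> L ?x ((L ?x ^^ k) ?a)
     + hm m \<bullet> (DL ?x ?a ?y - DL ?x ?y ?a + DS k ?x (L ?x ?a) ?b - DS k ?x ?b (L ?x ?a))"
    unfolding snd_N[OF m y] swap by (simp add: inner_diff_right inner_add_right)
  also have "DL ?x ?a ?y - DL ?x ?y ?a + DS k ?x (L ?x ?a) ?b - DS k ?x ?b (L ?x ?a)
    = DS (Suc k) ?x ?a ?b - DS (Suc k) ?x ?b ?a"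
  proof -
    have "DS (Suc k) ?x ?a ?b = DL ?x ?a ?y + L ?x (DS k ?x ?a ?b)" by (rule DS_Suc[OF x])
    moreover have "DS (Suc k) ?x ?b ?a = DS k ?x ?b (L ?x ?a) + (L ?x ^^ k) (DL ?x ?b ?a)"
      by (rule DS_Suc'[OF x])
    ultimately show ?thesis using concomitant_zero[OF x, of k ?b ?a] by (simp add: algebra_simps del: funpow.simps)
  qed
  finally show ?thesis unfolding w_eq[OF m] by simp
qed

lemma Y_0: "Y 0 m = X m" and Y_Suc: "Y (Suc k) m = N m (Y k m)"
  by (simp_all add: Y_def)

lemma dt_Y: "m \<in> M \<Longrightarrow> fst (fst (Y k m)) = (if k = 0 then 1 else 0)"
  by (cases k) (auto simp: Y_0 Y_Suc fst_N dtL X_def)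

lemma w_Y_shift:
  assumes m: "m \<in> M" and v: "fst (fst v) = 0"
  shows "w k m (Y j m) v = w 0 m (Y (j + k) m) v"
proof (induction k arbitrary: j)
  case (Suc k)
  have "w (Suc k) m (Y j m) v = w k m (Y (Suc j) m) v"
    using w_step[OF m, of k v] v by (simp add: Y_Suc)
  then show ?case using Suc[of "Suc j"] by simp
qed simp

text \<open>\<open>N\<close> is self-adjoint for \<open>w k\<close>, so the value depends on
  \<open>i + j\<close> only and is symmetric in \<open>i\<close> and \<open>j\<close>; by skewness
  it is its own negative.\<close>

lemma w_isotropic_pos:
  assumes m: "m \<in> M" and k: "k > 0"
  shows "w k m (Y i m) (Y j m) = 0"
proof -
  have sym: "w k m (N m u) v = w k m u (N m v)" for u v
    using w_step[OF m, of k v u] w_step[OF m, of k u v] k w_skew[of "Suc k" m u v] w_skew[of k m u "N m v"] by simp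
  have "w k m (Y i m) (Y j m) = w k m (Y 0 m) (Y (i + j) m)" for i j
  proof (induction i arbitrary: j)
    case (Suc i)
    then show ?case using sym[of "Y i m" "Y j m"] Suc[of "Suc j"] by (simp add: Y_Suc)
  qed simp
  from this[of i j] this[of j i] show ?thesis using w_skew[of k m "Y i m" "Y j m"] by (simp add: add.commute)
qed

section \<open>The kernel of the pulled-back symplectic form\<close>

lemma X_fst_snd: "fst (fst (X m)) = 1" "snd (fst (X m)) = (\<chi> i. tangent_map H m (0, axis i 1))"
   "snd (X m) = - (\<chi> i. tangent_map H m ((0, axis i 1), 0))"
  by (simp_all add: X_def)

lemma w_0_eq:
  assumes m: "m \<in> M"
  shows "w 0 m u v = Dhm m u \<bullet> fst v - Dhm m v \<bullet> fst u"
  using w_eq[OF m, of 0 u v] by simp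

lemma tangent_map_H:
  assumes m: "m \<in> M"
  shows "tangent_map H m u = fst (fst u) * tangent_map H m ((1, 0), 0)
    - snd (X m) \<bullet> snd (fst u) + snd (fst (X m)) \<bullet> snd u"
proof -
  have lin: "linear (tangent_map H m)" by (rule smooth_on_linear_tangent_map[OF smH m])
  have l1: "linear (\<lambda>y. tangent_map H m (y, 0))"
    using linear_compose[OF bounded_linear.linear[OF bounded_linear_Pair[OF bounded_linear_ident bounded_linear_zero]] lin]
    by (simp add: o_def)
  have "bounded_linear (\<lambda>y::'n base_coords. ((0::'n base_coords), snd y))"
    by (intro bounded_linear_Pair bounded_linear_zero bounded_linear_snd)
  from linear_compose[OF bounded_linear.linear[OF this] lin]
  have l2: "linear (\<lambda>y::'n base_coords. tangent_map H m (0, snd y))" by (simp add: o_def)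
  have "u = fst (fst u) *\<^sub>R ((1, 0), 0) + (((0, snd (fst u)), 0) + (0, snd u))"
    by (simp add: prod_eq_iff)
  then have "tangent_map H m u = tangent_map H m (fst (fst u) *\<^sub>R ((1, 0), 0) + (((0, snd (fst u)), 0) + (0, snd u)))"
    by simp
  also have "\<dots> = fst (fst u) * tangent_map H m ((1, 0), 0) + (tangent_map H m ((0, snd (fst u)), 0) + tangent_map H m (0, snd u))"
    by (simp only: linear_add[OF lin] linear_cmul[OF lin] real_scaleR_def)
  also have "tangent_map H m ((0, snd (fst u)), 0) = - (snd (X m) \<bullet> snd (fst u))"
    using linear_snd_expand[OF l1, of "snd (fst u)"] by (simp add: X_def inner_vec_def mult.commute sum_negf)
  also have "tangent_map H m (0, snd u) = snd (fst (X m)) \<bullet> snd u"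
    using linear_snd_expand[OF l2, of "snd u"] by (simp add: X_def inner_vec_def mult.commute)
  finally show ?thesis by simp
qed

lemma w_0_X:
  assumes m: "m \<in> M"
  shows "w 0 m (X m) v = 0"
  unfolding w_0_eq[OF m] Dhm_def inner_prod_def tangent_map_H[OF m, of "X m"] tangent_map_H[OF m, of v]
  by (simp add: X_fst_snd(1) inner_commute algebra_simps)

text \<open>The differences between \<open>u\<close> and the multiple of \<open>X m\<close> with the
  same \<open>dt\<close> component serve as test vectors, each in the conjugate slot: then
  \<open>w 0\<close> returns plus or minus their squared norms.\<close>

lemma w_0_kernel:
  assumes m: "m \<in> M" and u: "\<And>v. w 0 m u v = 0"
  shows "u = fst (fst u) *\<^sub>R X m"
proof -
  let ?s = "fst (fst u)"
  have "snd (fst u) - ?s *\<^sub>R snd (fst (X m)) = 0" (is "?d = 0")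
  proof -
    have "w 0 m u (0, ?d) = - (?d \<bullet> ?d)"
      unfolding w_0_eq[OF m] Dhm_def tangent_map_H[OF m, of "(0, ?d)"]
      by (simp add: inner_prod_def inner_diff_left inner_diff_right inner_commute algebra_simps)
    then show ?thesis using u by simp
  qed
  moreover have "snd u - ?s *\<^sub>R snd (X m) = 0" (is "?d = 0")
  proof -
    have "w 0 m u ((0, ?d), 0) = ?d \<bullet> ?d"
      unfolding w_0_eq[OF m] Dhm_def tangent_map_H[OF m, of "((0, ?d), 0)"]
      by (simp add: inner_prod_def inner_diff_left inner_diff_right inner_commute algebra_simps)
    then show ?thesis using u by simp
  qed
  ultimately show ?thesis by (simp add: prod_eq_iff X_fst_snd(1))
qed

text \<open>For \<open>k = 0\<close> one factor \<open>N\<close> is moved into the form, which leads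
  back to \<open>w 1\<close>. This needs \<open>dt (Y j) = 0\<close>, that is \<open>j > 0\<close>;
  an index 0 stands for \<open>X\<close>, which lies in the kernel.\<close>

lemma w_isotropic:
  assumes m: "m \<in> M"
  shows "w k m (Y i m) (Y j m) = 0"
proof (cases "k > 0")
  case True
  then show ?thesis by (rule w_isotropic_pos[OF m])
next
  case False
  consider "i = 0" | "j = 0" | i' where "i = Suc i'" "j > 0" by (cases i) auto
  then show ?thesis
  proof cases
    case 1
    then show ?thesis using False w_0_X[OF m] by (simp add: Y_0)
  next
    case 2
    then show ?thesis using False w_0_X[OF m] w_skew[of 0 m "Y i m"] by (simp add: Y_0)
  next
    case 3
    then have "w 0 m (Y i m) (Y j m) = w 1 m (Y i' m) (Y j m)"
      using w_step[OF m, of 0 "Y j m" "Y i' m"] dt_Y[OF m, of j] by (simp add: Y_Suc)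
    then show ?thesis using False w_isotropic_pos[OF m, of 1] by simp
  qed
qed

definition D :: "'n J1_coords \<Rightarrow> 'n J1_coords set" where
  "D m = span ((\<lambda>k. Y k m) ` {..CARD('n)})"

text \<open>A dimension count in \<open>2 * n + 1\<close> dimensions: the form is nondegenerate
  enough on the span of \<open>Y 1\<close>, ..., \<open>Y n\<close> to impose \<open>n\<close>
  independent conditions, so the orthogonal space has dimension \<open>n + 1\<close>, the dimension
  of the isotropic space \<open>D m\<close> inside it.\<close>

lemma D_maximal_isotropic:
  assumes m: "m \<in> M"
    and ind: "inj_on (\<lambda>k. Y k m) {..CARD('n)}" "independent ((\<lambda>k. Y k m) ` {..CARD('n)})"
    and v: "\<And>j. w 0 m v (Y j m) = 0"
  shows "v \<in> D m"
proof -
  define J where "J u = (\<Sum>b\<in>Basis. w 0 m u b *\<^sub>R b)" for u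
  have J: "J u \<bullet> z = w 0 m u z" for u z
  proof -
    have "w 0 m u z = (\<Sum>b\<in>Basis. (z \<bullet> b) * w 0 m u b)"
      using linear_expand_Basis[OF linw[OF m], of 0 u z] by simp
    also have "\<dots> = J u \<bullet> z"
      unfolding J_def inner_sum_left inner_scaleR_left
      by (intro sum.cong refl) (simp only: inner_commute mult.commute)
    finally show ?thesis by simp
  qed
  have linJ: "linear J"
    unfolding J_def
    by (intro linear_compose_sum ballI linear_compose[OF linw'[OF m] bounded_linear.linear[OF bounded_linear_scaleR_left], unfolded o_def])
  \<comment> \<open>\<open>Y 0\<close> is left out because it spans the kernel of
    \<open>w 0\<close>. The others have \<open>dt\<close> component 0, so their span meets that
    kernel only in 0 and \<open>J\<close> is injective on it.\<close>
  let ?B = "(\<lambda>k. Y k m) ` {1..CARD('n)}"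
  have sub: "?B \<subseteq> (\<lambda>k. Y k m) ` {..CARD('n)}" by auto
  have indB: "independent ?B" by (rule independent_mono[OF ind(2) sub])
  have "card ?B = CARD('n)"
    by (subst card_image) (auto intro: inj_on_subset[OF ind(1)])
  then have dimB: "dim (span ?B) = CARD('n)"
    using dim_eq_card_independent[OF indB] by simp
  have dt: "fst (fst u) = 0" if "u \<in> span ?B" for u
  proof -
    have "subspace {u::'n J1_coords. fst (fst u) = 0}" by (auto simp: subspace_def)
    moreover have "?B \<subseteq> {u. fst (fst u) = 0}" using dt_Y[OF m] by auto
    ultimately show ?thesis using span_minimal that by blast
  qed
  have "inj_on J (span ?B)"
  proof (subst linear_inj_on_iff_eq_0[OF linJ subspace_span], intro ballI impI)
    fix u assume u: "u \<in> span ?B" "J u = 0"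
    then have "u = fst (fst u) *\<^sub>R X m" using J[of u] by (intro w_0_kernel[OF m]) simp
    then show "u = 0" using dt[OF u(1)] by simp
  qed
  then have "inj_on J (span (span ?B))" by (simp only: span_span)
  then have dimJ: "dim (J ` span ?B) = CARD('n)"
    using dim_image_eq[OF linJ] dimB by metis
  let ?P = "{y \<in> UNIV. \<forall>x\<in>J ` span ?B. orthogonal x y}"
  have subJ: "subspace (J ` span ?B)" by (rule linear_subspace_image[OF linJ subspace_span])
  have "dim ?P + CARD('n) = dim (UNIV :: 'n J1_coords set)"
    using dim_subspace_orthogonal_to_vectors[OF subJ subspace_UNIV] dimJ by simp
  then have dimP: "dim ?P = CARD('n) + 1" by (simp add: dim_UNIV)
  have dimD: "dim (D m) = CARD('n) + 1"
    unfolding D_def using dim_eq_card_independent[OF ind(2)] card_image[OF ind(1)] by simp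
  have perp: "z \<in> ?P" if z: "\<And>j. w 0 m z (Y j m) = 0" for z
  proof -
    have "w 0 m u z = 0" if "u \<in> span ?B" for u
    proof -
      have "subspace {u. w 0 m u z = 0}"
        using linear_subspace_vimage[OF linw'[OF m, of 0 z] subspace_single_0] by (simp add: vimage_def)
      moreover have "?B \<subseteq> {u. w 0 m u z = 0}" using z w_skew[of 0 m _ z] by auto
      ultimately show ?thesis using span_minimal that by blast
    qed
    then show ?thesis by (auto simp: orthogonal_def J)
  qed
  have subP: "subspace ?P" by (auto simp: subspace_def orthogonal_def inner_add_right)
  have "D m \<subseteq> ?P"
    unfolding D_def by (rule span_minimal[OF _ subP]) (use perp w_isotropic[OF m] in blast)
  moreover have "subspace (D m)" by (simp add: D_def)
  ultimately have "D m = ?P" using subspace_dim_equal[OF _ subP] dimP dimD by simp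
  then show ?thesis using perp[OF v] by blast
qed

end

section \<open>Integrability\<close>

text \<open>Only the bracket term of \<open>d\<alpha>\<close> survives when both fields are null.
  Applied to the contraction of \<open>w 1\<close> with \<open>X\<close>, it turns the Lie
  derivative into a bracket component.\<close>

lemma ext_deriv_on_null_fields:
  fixes \<alpha> :: "'a::euclidean_space \<Rightarrow> 'a \<Rightarrow> real"
  assumes S: "open S" "x \<in> S" and \<alpha>: "\<And>v. smooth_on (\<lambda>y. \<alpha> y v) S" "\<And>y. y \<in> S \<Longrightarrow> linear (\<alpha> y)"
    and Y: "smooth_on Y S" "\<And>y. y \<in> S \<Longrightarrow> \<alpha> y (Y y) = 0"
    and Z: "smooth_on Z S" "\<And>y. y \<in> S \<Longrightarrow> \<alpha> y (Z y) = 0"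
  shows "ext_deriv \<alpha> x (Y x) (Z x) = - \<alpha> x (lie_bracket Y Z x)"
proof -
  have dif: "(\<lambda>y. \<alpha> y v) differentiable (at x)" for v
    using smooth_on_has_derivative[OF \<alpha>(1) S(2)] differentiable_def by blast
  have 1: "tangent_map (\<lambda>y. \<alpha> y (V x)) x u = - \<alpha> x (tangent_map V x u)"
    if V: "smooth_on V S" "\<And>y. y \<in> S \<Longrightarrow> \<alpha> y (V y) = 0" for V u
  proof -
    have "V differentiable (at x)"
      using smooth_on_has_derivative[OF V(1) S(2)] differentiable_def by blast
    from tangent_map_apply_linear[OF S dif \<alpha>(2) this]
    have "tangent_map (\<lambda>y. \<alpha> y (V y)) x u = tangent_map (\<lambda>y. \<alpha> y (V x)) x u + \<alpha> x (tangent_map V x u)" .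
    moreover have "tangent_map (\<lambda>y. \<alpha> y (V y)) x u = 0"
      using tangent_map_cong_open[OF S, of "\<lambda>y. 0" "\<lambda>y. \<alpha> y (V y)"] V(2) by simp
    ultimately show ?thesis by simp
  qed
  have "tangent_map (\<lambda>y. \<alpha> y (Y x)) x (Z x) = - \<alpha> x (tangent_map Y x (Z x))"
    "tangent_map (\<lambda>y. \<alpha> y (Z x)) x (Y x) = - \<alpha> x (tangent_map Z x (Y x))"
    using 1[OF Y(1)] 1[OF Z(1)] Y(2) Z(2) by auto
  then show ?thesis
    by (simp add: ext_deriv_def lie_bracket_def linear_diff[OF \<alpha>(2)[OF S(2)]])
qed

text \<open>The pullback of \<open>\<alpha>\<close> along \<open>\<phi>\<close> is 0, hence so is
  its differential. In coordinates, differentiating this vanishing leaves two second derivatives of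
  \<open>\<phi>\<close>, which cancel by symmetry.\<close>

lemma ext_deriv_on_integral_manifold:
  fixes \<alpha> :: "'n::finite J1_coords \<Rightarrow> 'n J1_coords \<Rightarrow> real"
  assumes S: "open S" and \<alpha>: "\<And>v. smooth_on (\<lambda>y. \<alpha> y v) S" "\<And>y. y \<in> S \<Longrightarrow> linear (\<alpha> y)"
    and null: "\<And>y v. y \<in> S \<Longrightarrow> v \<in> \<Delta> y \<Longrightarrow> \<alpha> y v = 0"
    and int: "integral_manifold \<Delta> W \<phi>" "\<phi> ` W \<subseteq> S" "w \<in> W"
    and uv: "u \<in> \<Delta> (\<phi> w)" "v \<in> \<Delta> (\<phi> w)"
  shows "ext_deriv \<alpha> (\<phi> w) u v = 0"
proof -
  have W: "open W" and sm: "smooth_on \<phi> W"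
    and tan: "\<And>z. z \<in> W \<Longrightarrow> range (tangent_map \<phi> z) = \<Delta> (\<phi> z)"
    using int(1) by (auto simp: integral_manifold_def)
  obtain a b where ab: "u = tangent_map \<phi> w a" "v = tangent_map \<phi> w b"
    using uv tan[OF int(3)] by blast
  have in_S: "\<phi> z \<in> S" if "z \<in> W" for z using int(2) that by blast
  have hd: "((\<lambda>z. \<alpha> (\<phi> z) c) has_derivative (\<lambda>e. tangent_map (\<lambda>y. \<alpha> y c) (\<phi> w) (tangent_map \<phi> w e))) (at w)" for c
    using diff_chain_at[OF smooth_on_has_derivative[OF sm int(3)] smooth_on_has_derivative[OF \<alpha>(1) in_S[OF int(3)]]]
    by (simp add: o_def)
  have dif: "(\<lambda>z. \<alpha> (\<phi> z) c) differentiable (at w)" for c using hd differentiable_def by blast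
  have dif2: "(\<lambda>z. tangent_map \<phi> z c) differentiable (at w)" for c
    using smooth_on_has_derivative[OF smooth_on_tangent_map[OF sm] int(3)] differentiable_def by blast
  have lin: "linear (\<alpha> (\<phi> z))" if "z \<in> W" for z by (rule \<alpha>(2)[OF in_S[OF that]])
  have 1: "tangent_map (\<lambda>y. \<alpha> y (tangent_map \<phi> w c)) (\<phi> w) (tangent_map \<phi> w e)
      = - \<alpha> (\<phi> w) (tangent_map (\<lambda>z. tangent_map \<phi> z c) w e)" for c e
  proof -
    have "tangent_map (\<lambda>z. \<alpha> (\<phi> z) (tangent_map \<phi> z c)) w e
      = tangent_map (\<lambda>z. \<alpha> (\<phi> z) (tangent_map \<phi> w c)) w e + \<alpha> (\<phi> w) (tangent_map (\<lambda>z. tangent_map \<phi> z c) w e)"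
      by (rule tangent_map_apply_linear[OF W int(3) dif lin dif2])
    moreover have "\<alpha> (\<phi> z) (tangent_map \<phi> z c) = 0" if "z \<in> W" for z
      using null[OF in_S[OF that]] tan[OF that] by blast
    then have "tangent_map (\<lambda>z. \<alpha> (\<phi> z) (tangent_map \<phi> z c)) w e = 0"
      using tangent_map_cong_open[OF W int(3), of "\<lambda>z. 0" "\<lambda>z. \<alpha> (\<phi> z) (tangent_map \<phi> z c)"] by simp
    ultimately show ?thesis using tangent_map_eq[OF hd, of "tangent_map \<phi> w c"] by (simp add: fun_eq_iff)
  qed
  show ?thesis
    unfolding ext_deriv_def ab 1 using second_derivative_symmetric_vector[OF W int(3) sm, of a b] by simp
qed

context jet_system
begin

section \<open>Smoothness of the frame and brackets of its fields\<close>

lemma sm_DH: "smooth_on (\<lambda>m. tangent_map H m v) M"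
  by (rule smooth_on_tangent_map[OF smH])

lemma smX: "smooth_on X M"
  unfolding X_def
  by (intro smooth_on_Pair smooth_on_minus smooth_on_vec openM smooth_on_const sm_DH)

lemma smDL: "smooth_on (\<lambda>x. DL x a b) U"
  by (rule smooth_on_tangent_map[OF smL])

lemma linN: "m \<in> M \<Longrightarrow> linear (N m)"
proof -
  assume m: "m \<in> M"
  have x: "fst m \<in> U" by (rule fstM[OF m])
  have l1: "linear (\<lambda>u::'n J1_coords. L (fst m) (fst u))"
    using linear_compose[OF linear_fst linL[OF x]] by (simp add: o_def)
  have l2: "linear (\<lambda>u::'n J1_coords. (0, snd u) \<bullet> c)" for c :: "'n base_coords"
    by (rule linearI) (simp_all add: inner_prod_def inner_add_left)
  have l3: "linear (\<lambda>u::'n J1_coords. c \<bullet> (DL (fst m) (fst u) b - DL (fst m) b (fst u)))" for b c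
  proof -
    have "linear (\<lambda>a. c \<bullet> (DL (fst m) a b - DL (fst m) b a))"
      by (intro linear_compose[OF _ bounded_linear.linear[OF bounded_linear_inner_right], unfolded o_def]
          linear_compose_sub linDL[OF x] linDL'[OF x])
    from linear_compose[OF linear_fst this] show ?thesis by (simp add: o_def)
  qed
  note l4 = linear_compose_add[OF l2 l3]
  show ?thesis
    by (rule linearI; simp only: N_def prod_eq_iff vec_eq_iff fst_add snd_add fst_scaleR snd_scaleR fst_conv snd_conv
        vec_lambda_beta vector_add_component vector_scaleR_component; intro conjI allI)
      (use linear_add[OF l1] linear_add[OF l4] linear_cmul[OF l1] linear_cmul[OF l4] in \<open>simp_all\<close>)
qed

lemma smN: "smooth_on (\<lambda>m. N m u) M"
  unfolding N_def
  by (intro smooth_on_Pair smooth_on_vec smooth_on_add smooth_on_inner smooth_on_diff openM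
      smooth_on_const smooth_on_snd smooth_on_fst_compose[OF smL] smooth_on_fst_compose[OF smDL])

lemma smY: "smooth_on (Y k) M"
proof (induction k)
  case 0
  show ?case using smX by (simp add: Y_0[abs_def])
next
  case (Suc k)
  show ?case using smooth_on_apply_linear[OF openM smN linN Suc] by (simp add: Y_Suc[abs_def])
qed

text \<open>The component \<open>dt (Y k)\<close> is constant, so its derivatives vanish. This
  supplies the side condition for shifting \<open>N\<close> past a bracket in
  \<open>w 0\<close>.\<close>

lemma dt_bracket:
  assumes m: "m \<in> M"
  shows "fst (fst (lie_bracket (Y i) (Y j) m)) = 0"
proof -
  have "fst (fst (tangent_map (Y k) m u)) = 0" for k u
  proof -
    have "((\<lambda>m. fst (fst (Y k m))) has_derivative (\<lambda>u. fst (fst (tangent_map (Y k) m u)))) (at m)"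
      by (intro has_derivative_fst smooth_on_has_derivative[OF smY m])
    then have "((\<lambda>m. if k = 0 then 1 else 0) has_derivative (\<lambda>u. fst (fst (tangent_map (Y k) m u)))) (at m)"
      by (rule has_derivative_transform_within_open[OF _ openM m]) (simp add: dt_Y)
    then show ?thesis using has_derivative_unique[OF _ has_derivative_const] by metis
  qed
  then show ?thesis by (simp add: lie_bracket_def)
qed

lemma w_contract_smooth: "smooth_on (\<lambda>m. w 1 m (X m) v) M"
  unfolding w_def
  by (rule smooth_on_apply_linear[OF openM smooth_on_ext_deriv_form[OF openM smth]
      linear_ext_deriv_left[OF openM _ smth linth] smX])

lemma lie_deriv2_w:
  assumes m: "m \<in> M"
  shows "lie_deriv2 X (w 1) m u v = ext_deriv (\<lambda>m. w 1 m (X m)) m u v"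
  unfolding w_def by (rule lie_deriv2_exact[OF openM m smth linth smX])

lemma w_contract_null:
  assumes "m \<in> M" "v \<in> D m"
  shows "w 1 m (X m) v = 0"
proof -
  have "subspace {v. w 1 m (X m) v = 0}"
    using linear_subspace_vimage[OF linw[OF assms(1)] subspace_single_0] by (simp add: vimage_def)
  moreover have "(\<lambda>k. Y k m) ` {..CARD('n)} \<subseteq> {v. w 1 m (X m) v = 0}"
    using w_isotropic[OF assms(1), of 1 0] by (auto simp: Y_0)
  ultimately show ?thesis using assms(2) span_minimal unfolding D_def by blast
qed

lemma lie_deriv_zero_if_integrable:
  assumes int: "integrable_distribution M D" and m: "m \<in> M" and uv: "u \<in> D m" "v \<in> D m"
  shows "lie_deriv2 X (w 1) m u v = 0"
proof -
  obtain W \<phi> where W: "integral_manifold D W \<phi>" "m \<in> \<phi> ` W" "\<phi> ` W \<subseteq> M"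
    using int m unfolding integrable_distribution_def by blast
  then obtain z where z: "z \<in> W" "m = \<phi> z" by blast
  show ?thesis
    unfolding lie_deriv2_w[OF m] unfolding z(2)
    by (rule ext_deriv_on_integral_manifold[OF openM w_contract_smooth linw w_contract_null W(1,3) z(1)])
      (use uv z(2) in auto)
qed

lemma w_Y_shift_bracket:
  assumes m: "m \<in> M"
  shows "w q m (lie_bracket (Y i) (Y j) m) (Y k m) = w 0 m (lie_bracket (Y i) (Y j) m) (Y (k + q) m)"
  using w_Y_shift[OF m dt_bracket[OF m], of q k i j] w_skew[of q m _ "Y k m"] w_skew[of 0 m _ "Y (k + q) m"]
  by metis

lemma lie_bracket_skew: "lie_bracket V Z x = - lie_bracket Z V x"
  by (simp add: lie_bracket_def)

lemma brackets_in_D: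
  assumes ind: "\<And>m. m \<in> M \<Longrightarrow> inj_on (\<lambda>k. Y k m) {..CARD('n)}"
      "\<And>m. m \<in> M \<Longrightarrow> independent ((\<lambda>k. Y k m) ` {..CARD('n)})"
    and lie: "\<And>u v. u \<in> D m \<Longrightarrow> v \<in> D m \<Longrightarrow> lie_deriv2 X (w 1) m u v = 0"
    and m: "m \<in> M"
  shows "lie_bracket (Y i) (Y j) m \<in> D m"
proof -
  define c where "c i j k = w 0 m (lie_bracket (Y i) (Y j) m) (Y k m)" for i j k
  \<comment> \<open>This includes \<open>k > CARD('n)\<close>: such a field is orthogonal to all the
    others, so maximality of \<open>D\<close> puts it into the span.\<close>
  have YD: "Y k m \<in> D m" for k
    by (rule D_maximal_isotropic[OF m ind[OF m] w_isotropic[OF m]])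
  have skew: "c i j k = - c j i k" for i j k
    unfolding c_def using lie_bracket_skew[of "Y i" "Y j" m] linear_neg[OF linw'[OF m]] by simp
  have shift: "w q m (lie_bracket (Y i) (Y j) m) (Y k m) = c i j (k + q)" for i j k q
    unfolding c_def by (rule w_Y_shift_bracket[OF m])
  have bianchi: "c i j (k + q) + c j k (i + q) + c k i (j + q) = 0" for i j k q
  proof -
    have "w q m (lie_bracket (Y i) (Y j) m) (Y k m) + w q m (lie_bracket (Y j) (Y k) m) (Y i m)
      + w q m (lie_bracket (Y k) (Y i) m) (Y j m) = 0"
      unfolding w_def
      by (rule ext_deriv_isotropic_bianchi[OF openM m smth linth smY w_isotropic[unfolded w_def]])
    then show ?thesis unfolding shift .
  qed
  have c1: "c i j 1 = 0" for i j
  proof -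
    \<comment> \<open>The only use of the hypothesis on the Lie derivative: by Cartan's formula it
      is the differential of a 1-form that vanishes on \<open>D\<close>, so it sees only the
      bracket.\<close>
    have "0 = lie_deriv2 X (w 1) m (Y i m) (Y j m)" using lie YD by simp
    also have "\<dots> = - w 1 m (X m) (lie_bracket (Y i) (Y j) m)"
      unfolding lie_deriv2_w[OF m]
      by (rule ext_deriv_on_null_fields[OF openM m w_contract_smooth linw smY _ smY])
        (use w_isotropic[of _ 1 0] in \<open>auto simp: Y_0\<close>)
    also have "\<dots> = w 1 m (lie_bracket (Y i) (Y j) m) (Y 0 m)"
      using w_skew[of 1 m "X m"] by (simp add: Y_0)
    also have "\<dots> = c i j 1" unfolding shift by simp
    finally show ?thesis by simp
  qed
  have c0: "c i j 0 = 0" for i j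
    unfolding c_def using w_0_X[OF m] w_skew[of 0 m _ "X m"] by (simp add: Y_0)
  have s_sym: "c 0 j k = c 0 k j" for j k
    using bianchi[of 0 j k 0] c0[of j k] skew[of 0 k j] by simp
  have s_shift: "c 0 j (Suc k) = c 0 k (Suc j)" for j k
    using bianchi[of 0 j k 1] c1[of j k] skew[of 0 k "Suc j"] by simp
  have s: "c 0 j k = 0" for j k
  proof (induction j arbitrary: k)
    case 0
    show ?case using skew[of 0 0 k] by simp
  next
    case (Suc j)
    have "c 0 (Suc j) k = c 0 k (Suc j)" by (rule s_sym)
    also have "\<dots> = c 0 j (Suc k)" by (rule s_shift[symmetric])
    also have "\<dots> = 0" by (rule Suc)
    finally show ?case .
  qed
  \<comment> \<open>With first index 0 and shift \<open>k\<close>, the other two terms of the cyclic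
    sum are of the form \<open>c 0 _ _\<close> up to sign.\<close>
  have "c i j k = 0" for k
    using bianchi[of 0 i j k] s skew[of 0 j] by simp
  then show ?thesis unfolding c_def by (intro D_maximal_isotropic[OF m ind[OF m]])
qed

lemma integrable_if_lie_deriv_zero:
  assumes ind: "\<And>m. m \<in> M \<Longrightarrow> inj_on (\<lambda>k. Y k m) {..CARD('n)}"
      "\<And>m. m \<in> M \<Longrightarrow> independent ((\<lambda>k. Y k m) ` {..CARD('n)})"
    and lie: "\<And>m u v. m \<in> M \<Longrightarrow> u \<in> D m \<Longrightarrow> v \<in> D m \<Longrightarrow> lie_deriv2 X (w 1) m u v = 0"
  shows "integrable_distribution M D"
proof -
  \<comment> \<open>Integral manifolds are parametrised by \<open>'n base_coords\<close>, which has
    dimension \<open>n + 1\<close>. An enumeration of its basis turns the frame into one linear map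
    \<open>F m\<close> from the parameter space.\<close>
  have "card (Basis :: 'n base_coords set) = card {..CARD('n)}" by simp
  then obtain \<iota> where \<iota>: "bij_betw \<iota> (Basis :: 'n base_coords set) {..CARD('n)}"
    using finite_same_card_bij[OF finite_Basis finite_atMost] by blast
  define F where "F m v = (\<Sum>b\<in>Basis. (v \<bullet> b) *\<^sub>R Y (\<iota> b) m)" for m and v :: "'n base_coords"
  have smF: "smooth_on (\<lambda>m. F m v) M" for v
    unfolding F_def by (intro smooth_on_sum smooth_on_scaleR openM smooth_on_const smY)
  have linF: "linear (F m)" for m
    unfolding F_def
    by (rule linearI) (simp_all add: inner_add_left scaleR_add_left sum.distrib scaleR_sum_right)
  have F_Basis: "F m b = Y (\<iota> b) m" if "b \<in> Basis" for m b
  proof -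
    have "F m b = (\<Sum>b'\<in>Basis. if b' = b then Y (\<iota> b') m else 0)"
      unfolding F_def using that by (intro sum.cong refl) (simp add: inner_Basis)
    then show ?thesis using that by simp
  qed
  have F_img: "F m ` Basis = (\<lambda>k. Y k m) ` {..CARD('n)}" for m
  proof -
    have "F m ` Basis = (\<lambda>b. Y (\<iota> b) m) ` Basis" by (rule image_cong[OF refl F_Basis])
    also have "\<dots> = (\<lambda>k. Y k m) ` (\<iota> ` Basis)" by (simp add: image_image)
    finally show ?thesis using \<iota> by (simp add: bij_betw_def)
  qed
  have range_F: "range (F m) = D m" for m
    unfolding D_def F_img[symmetric] using linear_span_image[OF linF, of m Basis] by simp
  have inj_F: "inj (F m)" if m: "m \<in> M" for m
  proof -
    have "inj_on (\<lambda>b. Y (\<iota> b) m) Basis"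
      using comp_inj_on[of \<iota> Basis "\<lambda>k. Y k m"] \<iota> ind(1)[OF m] by (simp add: bij_betw_def o_def)
    moreover have "inj_on (F m) Basis = inj_on (\<lambda>b. Y (\<iota> b) m) Basis"
      by (rule inj_on_cong) (rule F_Basis)
    ultimately have "inj_on (F m) Basis" by simp
    then show ?thesis
      using linear_inj_on_span_iff_independent_image[OF linF, of m Basis] ind(2)[OF m] F_img by simp
  qed
  have bracket: "lie_bracket (\<lambda>y. F y u) (\<lambda>y. F y v) m \<in> range (F m)" if m: "m \<in> M" for m u v
  proof -
    have tF: "tangent_map (\<lambda>y. F y v) m a = (\<Sum>b\<in>Basis. (v \<bullet> b) *\<^sub>R tangent_map (Y (\<iota> b)) m a)" for v a
    proof -
      have "((\<lambda>y. F y v) has_derivative (\<lambda>a. \<Sum>b\<in>Basis. (v \<bullet> b) *\<^sub>R tangent_map (Y (\<iota> b)) m a)) (at m)"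
        unfolding F_def
        by (intro has_derivative_sum has_derivative_scaleR_right smooth_on_has_derivative[OF smY m])
      then show ?thesis by (simp add: tangent_map_eq)
    qed
    have tY: "tangent_map (Y k) m (F m u) = (\<Sum>b\<in>Basis. (u \<bullet> b) *\<^sub>R tangent_map (Y k) m (Y (\<iota> b) m))" for k u
      unfolding F_def using smooth_on_linear_tangent_map[OF smY m, of k]
      by (simp add: linear_sum linear_cmul)
    \<comment> \<open>The coefficients of \<open>F\<close> are constant, so brackets of its fields
      are linear combinations of the brackets of the \<open>Y k\<close>.\<close>
    have "lie_bracket (\<lambda>y. F y u) (\<lambda>y. F y v) m =
       (\<Sum>b\<in>Basis. \<Sum>b'\<in>Basis. ((v \<bullet> b) * (u \<bullet> b')) *\<^sub>R tangent_map (Y (\<iota> b)) m (Y (\<iota> b') m))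
       - (\<Sum>b'\<in>Basis. \<Sum>b\<in>Basis. ((v \<bullet> b) * (u \<bullet> b')) *\<^sub>R tangent_map (Y (\<iota> b')) m (Y (\<iota> b) m))"
      unfolding lie_bracket_def tF tY by (simp add: scaleR_sum_right mult.commute)
    also have "\<dots> = (\<Sum>b\<in>Basis. \<Sum>b'\<in>Basis. ((v \<bullet> b) * (u \<bullet> b')) *\<^sub>R lie_bracket (Y (\<iota> b')) (Y (\<iota> b)) m)"
      by (subst sum.swap[of _ Basis Basis, where g = "\<lambda>b' b. ((v \<bullet> b) * (u \<bullet> b')) *\<^sub>R tangent_map (Y (\<iota> b')) m (Y (\<iota> b) m)"])
        (simp add: sum_subtractf lie_bracket_def scaleR_diff_right)
    also have "\<dots> \<in> D m"
      unfolding D_def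
      by (intro span_sum span_scale brackets_in_D[OF ind lie, unfolded D_def] m)
    finally show ?thesis by (simp add: range_F)
  qed
  show ?thesis
    unfolding integrable_distribution_def integral_manifold_def
  proof
    fix m assume m: "m \<in> M"
    have "\<exists>(W :: 'n base_coords set) \<phi>. open W \<and> smooth_on \<phi> W \<and> inj_on \<phi> W
      \<and> (\<forall>w\<in>W. inj (tangent_map \<phi> w) \<and> range (tangent_map \<phi> w) = range (F (\<phi> w)))
      \<and> m \<in> \<phi> ` W \<and> \<phi> ` W \<subseteq> M"
      by (rule frobenius[OF openM m smF linF inj_F[OF m] bracket])
    then show "\<exists>(W :: 'n base_coords set) \<phi>. (open W \<and> smooth_on \<phi> W \<and> inj_on \<phi> W
      \<and> (\<forall>w\<in>W. inj (tangent_map \<phi> w) \<and> range (tangent_map \<phi> w) = D (\<phi> w)))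
      \<and> m \<in> \<phi> ` W \<and> \<phi> ` W \<subseteq> M"
      unfolding range_F by (simp only: conj_assoc)
  qed
qed

end

section \<open>Coordinate representatives\<close>

lemma omega_eq:
  fixes z :: "'n::finite cot_coords"
  shows "omega z W V = snd W \<bullet> fst V - snd V \<bullet> fst W"
proof -
  have "((\<lambda>y. theta y v) has_derivative (\<lambda>u. snd u \<bullet> fst v)) (at z)" for v z :: "'n cot_coords"
    unfolding theta_def
    by (intro has_derivative_inner_left bounded_linear_imp_has_derivative[OF bounded_linear_snd])
  from tangent_map_eq[OF this] show ?thesis by (simp add: omega_def ext_deriv_def)
qed

text \<open>This gives uniqueness in the description that defines \<open>lift_cot\<close>. The
  difference of the two vectors, with base and momentum parts exchanged, is the test vector.\<close>

lemma omega_nondegenerate: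
  fixes W :: "'n::finite cot_coords"
  assumes "\<And>V. omega z W V = omega z W' V"
  shows "W = W'"
proof -
  have "(fst W - fst W') \<bullet> (fst W - fst W') = 0"
    using assms[of "(0, fst W - fst W')"] by (simp add: omega_eq inner_diff_left inner_diff_right inner_commute)
  moreover have "(snd W - snd W') \<bullet> (snd W - snd W') = 0"
    using assms[of "(snd W - snd W', 0)"] by (simp add: omega_eq inner_diff_left inner_diff_right inner_commute)
  ultimately show ?thesis by (simp add: prod_eq_iff)
qed

lemma sum_Basis_inner:
  fixes g :: "'a::euclidean_space \<Rightarrow> real"
  assumes "linear g"
  shows "(\<Sum>b\<in>Basis. g b *\<^sub>R b) \<bullet> v = g v"
proof -
  have "g v = (\<Sum>b\<in>Basis. (v \<bullet> b) * g b)" using linear_expand_Basis[OF assms, of v] by simp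
  also have "\<dots> = (\<Sum>b\<in>Basis. g b *\<^sub>R b) \<bullet> v"
    unfolding inner_sum_left inner_scaleR_left
    by (intro sum.cong refl) (simp only: inner_commute mult.commute)
  finally show ?thesis by simp
qed

lemma tangent_map_rho_loc:
  fixes z :: "'n::finite cot_coords"
  shows "tangent_map rho_loc z Z = rho_loc Z"
proof -
  have "bounded_linear (rho_loc :: 'n cot_coords \<Rightarrow> 'n J1_coords)"
    unfolding rho_loc_def
    by (intro bounded_linear_Pair bounded_linear_fst bounded_linear_compose[OF bounded_linear_snd bounded_linear_snd])
  from tangent_map_eq[OF bounded_linear_imp_has_derivative[OF this]] show ?thesis by simp
qed

context jet_system
begin

text \<open>The momentum part of the lifted vector, read as a covector and evaluated at
  \<open>b\<close>.\<close>

definition lift_component :: "'n cot_coords \<Rightarrow> 'n cot_coords \<Rightarrow> 'n base_coords \<Rightarrow> real" where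
  "lift_component z Z b = snd Z \<bullet> L (fst z) b
     + snd z \<bullet> (DL (fst z) (fst Z) b - DL (fst z) b (fst Z))"

lemma linear_lift_component: "fst z \<in> U \<Longrightarrow> linear (lift_component z Z)"
  unfolding lift_component_def[abs_def]
  by (intro linear_compose_add linear_compose_sub linL linDL linDL'
      linear_compose[OF _ bounded_linear.linear[OF bounded_linear_inner_right], unfolded o_def])

text \<open>The adjoint is characterised by inner products only; its basis expansion can be
  differentiated term by term.\<close>

lemma tau_map_eq:
  assumes "fst z \<in> U"
  shows "tau_map L z = (fst z, \<Sum>b\<in>Basis. (snd z \<bullet> L (fst z) b) *\<^sub>R b)"
proof -
  have "adjoint (L (fst z)) (snd z) = (\<Sum>b\<in>Basis. (adjoint (L (fst z)) (snd z) \<bullet> b) *\<^sub>R b)"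
    by (simp only: euclidean_representation)
  also have "\<dots> = (\<Sum>b\<in>Basis. (snd z \<bullet> L (fst z) b) *\<^sub>R b)"
    using adjoint_works[OF linL[OF assms]] by (simp add: inner_commute)
  finally show ?thesis by (simp add: tau_map_def)
qed

lemma pullback_tau_map:
  assumes z: "fst z \<in> U"
  shows "pullback2 (tau_map L) omega z Z V = lift_component z Z (fst V) - snd V \<bullet> L (fst z) (fst Z)"
proof -
  let ?x = "fst z"
  define T where "T Z = (\<Sum>b\<in>Basis. (snd z \<bullet> DL ?x (fst Z) b + snd Z \<bullet> L ?x b) *\<^sub>R b)" for Z :: "'n cot_coords"
  have S: "open (U \<times> UNIV :: 'n cot_coords set)" "z \<in> U \<times> UNIV"
    using z by (simp_all add: open_Times[OF U open_UNIV] mem_Times_iff)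
  have "((\<lambda>z. (fst z, \<Sum>b\<in>Basis. (snd z \<bullet> L (fst z) b) *\<^sub>R b)) has_derivative (\<lambda>Z. (fst Z, T Z))) (at z)"
    unfolding T_def
  proof (intro has_derivative_Pair has_derivative_sum has_derivative_scaleR_left has_derivative_inner)
    show fst: "(fst has_derivative fst) (at z)" and "(snd has_derivative snd) (at z)"
      by (rule bounded_linear_imp_has_derivative, rule bounded_linear_fst bounded_linear_snd)+
    show "((\<lambda>z. L (fst z) b) has_derivative (\<lambda>Z. DL ?x (fst Z) b)) (at z)" for b
      using diff_chain_at[OF fst smooth_on_has_derivative[OF smL z]] by (simp add: o_def)
  qed
  then have "(tau_map L has_derivative (\<lambda>Z. (fst Z, T Z))) (at z)"
    by (rule has_derivative_transform_within_open[OF _ S]) (auto simp: tau_map_eq)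
  then have tan: "tangent_map (tau_map L) z Z = (fst Z, T Z)" for Z by (simp add: tangent_map_eq)
  have T: "T Z \<bullet> v = snd z \<bullet> DL ?x (fst Z) v + snd Z \<bullet> L ?x v" for Z v
    unfolding T_def
    by (rule sum_Basis_inner)
      (intro linear_compose_add linL z linDL linear_compose[OF _ bounded_linear.linear[OF bounded_linear_inner_right], unfolded o_def])
  show ?thesis
    by (simp add: pullback2_def tan omega_eq T lift_component_def inner_diff_right)
qed

lemma lift_cot_eq:
  assumes z: "fst z \<in> U"
  shows "lift_cot L z Z = (L (fst z) (fst Z), \<Sum>b\<in>Basis. lift_component z Z b *\<^sub>R b)" (is "_ = ?W")
  unfolding lift_cot_def
proof (rule the_equality)
  show *: "\<forall>V. omega z ?W V = pullback2 (tau_map L) omega z Z V"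
    by (simp add: omega_eq pullback_tau_map[OF z] sum_Basis_inner[OF linear_lift_component[OF z]])
  fix W assume W: "\<forall>V. omega z W V = pullback2 (tau_map L) omega z Z V"
  show "W = ?W"
    by (rule omega_nondegenerate[of z]) (simp only: spec[OF W] spec[OF *])
qed

text \<open>The projected lift depends neither on \<open>p\<^sub>0\<close> of the point nor on that
  of the vector, since both are paired with values of \<open>L\<close> and its derivatives, whose
  \<open>dt\<close> component is 0. Hence the description in \<open>lift_J1\<close> has a unique
  solution.\<close>

lemma lift_J1_eq:
  assumes m: "m \<in> M"
  shows "lift_J1 L m = N m"
proof
  fix v
  have rel: "rho_loc (lift_cot L z Z) = N m v" if zZ: "rho_loc z = m" "rho_loc Z = v" for z Z
  proof -
    have x: "fst z = fst m" "snd (snd z) = snd m" "fst Z = fst v" "snd (snd Z) = snd v"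
      using zZ by (auto simp: rho_loc_def)
    have U: "fst m \<in> U" by (rule fstM[OF m])
    have "snd (\<Sum>b\<in>Basis. lift_component z Z b *\<^sub>R b) $ i = lift_component z Z (0, axis i 1)" for i
    proof -
      have "snd (\<Sum>b\<in>Basis. lift_component z Z b *\<^sub>R b) $ i = (\<Sum>b\<in>Basis. lift_component z Z b *\<^sub>R b) \<bullet> (0, axis i 1)"
        by (simp add: inner_prod_def inner_axis)
      also have "\<dots> = lift_component z Z (0, axis i 1)"
        by (rule sum_Basis_inner[OF linear_lift_component]) (simp add: x U)
      finally show ?thesis .
    qed
    then show ?thesis
      using U by (simp add: lift_cot_eq x rho_loc_def N_def vec_eq_iff lift_component_def inner_prod_def dtL fst_DL)
  qed
  show "lift_J1 L m v = N m v"
    unfolding lift_J1_def tangent_map_rho_loc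
  proof (rule the_equality)
    show "\<forall>z Z. rho_loc z = m \<and> rho_loc Z = v \<longrightarrow> rho_loc (lift_cot L z Z) = N m v"
      using rel by blast
    fix w assume "\<forall>z Z. rho_loc z = m \<and> rho_loc Z = v \<longrightarrow> rho_loc (lift_cot L z Z) = w"
    \<comment> \<open>Uniqueness needs at least one representative of \<open>m\<close> and
      \<open>v\<close>; those with vanishing \<open>p\<^sub>0\<close> serve.\<close>
    moreover have "rho_loc (fst m, (0, snd m)) = m" "rho_loc (fst v, (0, snd v)) = v"
      by (simp_all add: rho_loc_def)
    ultimately show "w = N m v" using rel by metis
  qed
qed

lemma hamiltonian_vf_eq:
  assumes h: "\<And>m. m \<in> M \<Longrightarrow> h m = (fst m, hm m)" and m: "m \<in> M"
  shows "hamiltonian_vf h m = X m"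
proof -
  have "((\<lambda>m. (fst m, hm m)) has_derivative (\<lambda>u. (fst u, Dhm m u))) (at m)"
    by (intro has_derivative_Pair hd_hm m bounded_linear_imp_has_derivative bounded_linear_fst)
  then have "(h has_derivative (\<lambda>u. (fst u, Dhm m u))) (at m)"
    by (rule has_derivative_transform_within_open[OF _ openM m]) (simp add: h)
  then have "pullback2 h omega m u v = w 0 m u v" for u v
    by (simp add: pullback2_def tangent_map_eq omega_eq w_0_eq[OF m])
  then have "hamiltonian_vf h m = (THE X. (\<forall>v. w 0 m X v = 0) \<and> fst (fst X) = 1)"
    by (simp add: hamiltonian_vf_def)
  also have "\<dots> = X m"
  proof (rule the_equality)
    show "(\<forall>v. w 0 m (X m) v = 0) \<and> fst (fst (X m)) = 1" by (simp add: w_0_X[OF m] X_fst_snd)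
    show "u = X m" if "(\<forall>v. w 0 m u v = 0) \<and> fst (fst u) = 1" for u
      using w_0_kernel[OF m, of u] that by simp
  qed
  finally show ?thesis .
qed

text \<open>The representative \<open>(0, p)\<close> may be exchanged for \<open>(-H, p)\<close>
  because \<open>L\<close> takes values without \<open>dt\<close> component.\<close>

lemma horizontal_lift_eq:
  assumes m: "m \<in> M"
  shows "horizontal_lift L m v = th 1 m v"
proof -
  have "tangent_map fst m v = fst v"
    using tangent_map_eq[OF bounded_linear_imp_has_derivative[OF bounded_linear_fst, of "at m"]] by simp
  then have "horizontal_lift L m v = L (fst m) (fst v) \<bullet> (0, snd m)"
    by (simp only: horizontal_lift_def adjoint_works[OF linL[OF fstM[OF m]]])
  then show ?thesis by (simp add: th_def hm_def inner_prod_def dtL[OF fstM[OF m]] inner_commute)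
qed

lemma omega_R_eq:
  assumes m: "m \<in> M"
  shows "omega_R L m u v = w 1 m u v"
proof -
  have "(\<lambda>y. th 1 y v) differentiable (at m)" for v
    using smooth_on_has_derivative[OF smth m] differentiable_def by blast
  then have "tangent_map (\<lambda>y. horizontal_lift L y v) m = tangent_map (\<lambda>y. th 1 y v) m" for v
    by (intro tangent_map_cong_open[OF openM m]) (simp_all add: horizontal_lift_eq)
  then show ?thesis by (simp add: omega_R_def w_def ext_deriv_def)
qed

lemma lie_deriv2_omega_R_eq:
  assumes h: "\<And>m. m \<in> M \<Longrightarrow> h m = (fst m, hm m)" and m: "m \<in> M"
  shows "lie_deriv2 (hamiltonian_vf h) (omega_R L) m u v = lie_deriv2 X (w 1) m u v"
proof -
  have "smooth_on (\<lambda>y. w 1 y u v) M" unfolding w_def by (rule smooth_on_ext_deriv_form[OF openM smth])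
  then have "(\<lambda>y. w 1 y u v) differentiable (at m)"
    using smooth_on_has_derivative[OF _ m] differentiable_def by blast
  then have "tangent_map (\<lambda>y. omega_R L y u v) m = tangent_map (\<lambda>y. w 1 y u v) m"
    by (intro tangent_map_cong_open[OF openM m]) (simp_all add: omega_R_eq)
  moreover have "X differentiable (at m)"
    using smooth_on_has_derivative[OF smX m] differentiable_def by blast
  then have "tangent_map (hamiltonian_vf h) m = tangent_map X m"
    by (intro tangent_map_cong_open[OF openM m]) (simp_all add: hamiltonian_vf_eq[OF h])
  ultimately show ?thesis
    by (simp add: lie_deriv2_def omega_R_eq[OF m] hamiltonian_vf_eq[OF h m])
qed

lemma iterate_eq:
  assumes h: "\<And>m. m \<in> M \<Longrightarrow> h m = (fst m, hm m)" and m: "m \<in> M"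
  shows "iterate L h k m = Y k m"
  by (simp add: iterate_def Y_def lift_J1_eq[OF m] hamiltonian_vf_eq[OF h m])

lemma D_h_eq:
  assumes h: "\<And>m. m \<in> M \<Longrightarrow> h m = (fst m, hm m)" and m: "m \<in> M"
  shows "D_h L h m = D m"
  by (simp add: D_h_def D_def iterate_eq[OF h m])

lemma integrable_iff_lie_deriv_zero:
  assumes h: "\<And>m. m \<in> M \<Longrightarrow> h m = (fst m, hm m)"
    and ind: "\<And>m. m \<in> M \<Longrightarrow> inj_on (\<lambda>k. iterate L h k m) {..CARD('n)}
      \<and> independent ((\<lambda>k. iterate L h k m) ` {..CARD('n)})"
  shows "integrable_distribution M (D_h L h) \<longleftrightarrow>
    (\<forall>m\<in>M. \<forall>u\<in>D_h L h m. \<forall>v\<in>D_h L h m. lie_deriv2 (hamiltonian_vf h) (omega_R L) m u v = 0)"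
proof -
  have "integral_manifold (D_h L h) W \<phi> = integral_manifold D W \<phi>" if "\<phi> ` W \<subseteq> M" for W \<phi>
  proof -
    have "D_h L h (\<phi> w) = D (\<phi> w)" if "w \<in> W" for w
      using \<open>\<phi> ` W \<subseteq> M\<close> that by (intro D_h_eq[OF h]) auto
    then show ?thesis by (simp add: integral_manifold_def)
  qed
  then have 1: "integrable_distribution M (D_h L h) \<longleftrightarrow> integrable_distribution M D"
    unfolding integrable_distribution_def by blast
  have ind': "inj_on (\<lambda>k. Y k m) {..CARD('n)}" "independent ((\<lambda>k. Y k m) ` {..CARD('n)})" if "m \<in> M" for m
  proof -
    have "(\<lambda>k. iterate L h k m) = (\<lambda>k. Y k m)" by (intro ext iterate_eq[OF h that])
    from ind[OF that, unfolded this]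
    show "inj_on (\<lambda>k. Y k m) {..CARD('n)}" "independent ((\<lambda>k. Y k m) ` {..CARD('n)})"
      by simp_all
  qed
  have "integrable_distribution M D \<longleftrightarrow> (\<forall>m\<in>M. \<forall>u\<in>D m. \<forall>v\<in>D m. lie_deriv2 X (w 1) m u v = 0)"
  proof
    assume "integrable_distribution M D"
    then show "\<forall>m\<in>M. \<forall>u\<in>D m. \<forall>v\<in>D m. lie_deriv2 X (w 1) m u v = 0"
      by (intro ballI lie_deriv_zero_if_integrable)
  next
    assume "\<forall>m\<in>M. \<forall>u\<in>D m. \<forall>v\<in>D m. lie_deriv2 X (w 1) m u v = 0"
    then show "integrable_distribution M D"
      by (intro integrable_if_lie_deriv_zero ind') blast+
  qed
  also have "\<dots> \<longleftrightarrow> (\<forall>m\<in>M. \<forall>u\<in>D_h L h m. \<forall>v\<in>D_h L h m. lie_deriv2 (hamiltonian_vf h) (omega_R L) m u v = 0)"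
    by (intro ball_cong refl) (simp_all add: D_h_eq[OF h] lie_deriv2_omega_R_eq[OF h])
  finally show ?thesis unfolding 1 .
qed

end

section \<open>Charts, transition maps and covectors\<close>

lemma chart_inv_apply: "is_chart c \<Longrightarrow> e \<in> fst c \<Longrightarrow> chart_inv c (snd c e) = e"
  unfolding is_chart_def using homeomorphism_apply1 by metis

lemma open_chart_image:
  assumes c: "is_chart c" and V: "open V" "V \<subseteq> fst c"
  shows "open (snd c ` V)"
proof -
  have "openin (top_of_set (fst c)) V"
    using V by (simp add: open_subset)
  with c have "openin (top_of_set (chart_image c)) (snd c ` V)"
    unfolding is_chart_def by (intro homeomorphism_imp_open_map) auto
  then show ?thesis using c openin_open_trans unfolding is_chart_def by blast
qed

lemma charts_atD:
  assumes "c \<in> charts_at A \<tau> e"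
  shows "is_chart c" "e \<in> fst c" "\<And>d. d \<in> A \<Longrightarrow> compatible c d" "c \<in> bundle_charts A \<tau>"
  using assms by (auto simp: charts_at_def bundle_charts_def)

lemma transition_compose:
  assumes c: "is_chart c" and d: "is_chart d" and a: "is_chart a"
    and e: "e \<in> fst c" "e \<in> fst d" "e \<in> fst a"
    and dca: "(transition c a has_derivative f) (at (snd c e))"
    and dad: "(transition a d has_derivative g) (at (snd a e))"
  shows "(transition c d has_derivative (g \<circ> f)) (at (snd c e))"
proof -
  have "transition c a (snd c e) = snd a e" using chart_inv_apply[OF c e(1)] by (simp add: transition_def)
  then have "(transition a d \<circ> transition c a has_derivative (g \<circ> f)) (at (snd c e))"
    using diff_chain_at[OF dca, of "transition a d" g] dad by simp
  moreover have "open (snd c ` (fst c \<inter> fst a \<inter> fst d))"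
    using c a d by (intro open_chart_image open_Int) (auto simp: is_chart_def)
  moreover have "snd c e \<in> snd c ` (fst c \<inter> fst a \<inter> fst d)" using e by blast
  moreover have "(transition a d \<circ> transition c a) y = transition c d y"
    if "y \<in> snd c ` (fst c \<inter> fst a \<inter> fst d)" for y
    using that chart_inv_apply[OF c] chart_inv_apply[OF a] by (auto simp: transition_def)
  ultimately show ?thesis by (rule has_derivative_transform_within_open)
qed

text \<open>Compatibility of a bundle chart is required only with the charts of \<open>A\<close>;
  differentiability between two bundle charts is obtained by passing through an atlas chart around
  \<open>e\<close>.\<close>

lemma transition_has_derivative:
  assumes A: "smooth_atlas A" and c: "c \<in> charts_at A \<tau> e" and d: "d \<in> charts_at A \<tau> e"
  shows "(transition c d has_derivative tangent_map (transition c d) (snd c e)) (at (snd c e))"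
proof -
  obtain a where a: "a \<in> A" "e \<in> fst a" "is_chart a" using A unfolding smooth_atlas_def by blast
  have "smooth_on (transition c a) (snd c ` (fst c \<inter> fst a))"
    using charts_atD(3)[OF c a(1)] by (simp add: compatible_def)
  then have 1: "(transition c a has_derivative tangent_map (transition c a) (snd c e)) (at (snd c e))"
    by (rule smooth_on_has_derivative) (use charts_atD(2)[OF c] a in blast)
  have "smooth_on (transition a d) (snd a ` (fst d \<inter> fst a))"
    using charts_atD(3)[OF d a(1)] by (simp add: compatible_def)
  then have 2: "(transition a d has_derivative tangent_map (transition a d) (snd a e)) (at (snd a e))"
    by (rule smooth_on_has_derivative) (use charts_atD(2)[OF d] a in blast)
  show ?thesis
    using transition_compose[OF charts_atD(1)[OF c] charts_atD(1)[OF d] a(3) charts_atD(2)[OF c]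
        charts_atD(2)[OF d] a(2) 1 2] tangent_map_eq by metis
qed

lemma transition_cocycle:
  assumes A: "smooth_atlas A" and c: "c \<in> charts_at A \<tau> e" and d: "d \<in> charts_at A \<tau> e"
    and c': "c' \<in> charts_at A \<tau> e"
  shows "tangent_map (transition d c') (snd d e) (tangent_map (transition c d) (snd c e) v)
    = tangent_map (transition c c') (snd c e) v"
  using tangent_map_eq[OF transition_compose[OF charts_atD(1)[OF c] charts_atD(1)[OF c'] charts_atD(1)[OF d]
      charts_atD(2)[OF c] charts_atD(2)[OF c'] charts_atD(2)[OF d]
      transition_has_derivative[OF A c d] transition_has_derivative[OF A d c']]] by simp

lemma tangent_map_transition_self:
  assumes c: "c \<in> charts_at A \<tau> e"
  shows "tangent_map (transition c c) (snd c e) v = v"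
proof -
  have "((\<lambda>y. y) has_derivative (\<lambda>v. v)) (at (snd c e))" by (rule has_derivative_ident)
  moreover have "open (chart_image c)" using charts_atD(1)[OF c] by (simp add: is_chart_def)
  moreover have "snd c e \<in> chart_image c" using charts_atD(2)[OF c] by blast
  moreover have "y = transition c c y" if "y \<in> chart_image c" for y
    using that chart_inv_apply[OF charts_atD(1)[OF c]] by (auto simp: transition_def)
  ultimately have "(transition c c has_derivative (\<lambda>v. v)) (at (snd c e))"
    by (rule has_derivative_transform_within_open)
  then show ?thesis by (simp add: tangent_map_eq)
qed

text \<open>The components in one chart determine all the others by transposed transition
  derivatives; the cocycle rule makes these choices consistent. The value 0 in the remaining charts
  is prescribed by \<open>cotangent_bundle\<close>.\<close>

lemma covector_exists:
  assumes A: "smooth_atlas A" and c: "c \<in> charts_at A \<tau> e"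
  shows "\<exists>a. (e, a) \<in> cotangent_bundle A \<tau> \<and> a c = p"
proof -
  define a where "a d = (if d \<in> charts_at A \<tau> e
    then adjoint (tangent_map (transition d c) (snd d e)) p else 0)" for d
  have adj: "a d \<bullet> v = p \<bullet> tangent_map (transition d c) (snd d e) v" if d: "d \<in> charts_at A \<tau> e" for d v
  proof -
    have "linear (tangent_map (transition d c) (snd d e))"
      by (rule has_derivative_linear[OF transition_has_derivative[OF A d c]])
    from adjoint_works[OF this, of v p] show ?thesis by (simp add: a_def d inner_commute)
  qed
  have "(e, a) \<in> cotangent_bundle A \<tau>"
    unfolding cotangent_bundle_def
    by (auto simp: adj transition_cocycle[OF A _ _ c]) (simp add: a_def)
  moreover have "a c = p"
    by (rule euclidean_eqI) (simp only: adj[OF c] tangent_map_transition_self[OF c])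
  ultimately show ?thesis by blast
qed

lemma mod_dt_refl: "z \<in> cotangent_bundle A \<tau> \<Longrightarrow> (z, z) \<in> mod_dt A \<tau>"
  unfolding mod_dt_def by (auto intro!: exI[of _ 0] simp: zero_prod_def[symmetric])

text \<open>Equivalent covectors differ only in \<open>p\<^sub>0\<close>, which
  \<open>rho_loc\<close> forgets, so the representative picked by \<open>SOME\<close> does not
  influence the coordinates.\<close>

lemma J1_chart_of_class:
  assumes z: "z \<in> cotangent_bundle A \<tau>" and c: "c \<in> bundle_charts A \<tau>"
  shows "fst (SOME z'. z' \<in> rho A \<tau> z) = fst z"
    "fst z \<in> fst c \<Longrightarrow> J1_chart c (rho A \<tau> z) = rho_loc (cot_chart c z)"
proof -
  define z' where "z' = (SOME z'. z' \<in> rho A \<tau> z)"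
  have "z \<in> rho A \<tau> z" using mod_dt_refl[OF z] by (simp add: rho_def)
  then have "z' \<in> rho A \<tau> z" unfolding z'_def by (rule someI)
  then have "(z, z') \<in> mod_dt A \<tau>" by (simp add: rho_def)
  then obtain s where s: "fst z' = fst z" "\<And>c. c \<in> charts_at A \<tau> (fst z) \<Longrightarrow> snd z' c = snd z c + s *\<^sub>R (1, 0)"
    unfolding mod_dt_def by force
  show "fst (SOME z'. z' \<in> rho A \<tau> z) = fst z" using s(1) by (simp add: z'_def)
  assume "fst z \<in> fst c"
  then have "c \<in> charts_at A \<tau> (fst z)" using c by (simp add: charts_at_def)
  then show "J1_chart c (rho A \<tau> z) = rho_loc (cot_chart c z)"
    unfolding J1_chart_def z'_def[symmetric] by (simp add: rho_loc_def cot_chart_def s)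
qed

text \<open>\<open>local_section\<close> goes through \<open>inv_into\<close>, which is a right
  inverse exactly on the image of the chart; hence every coordinate point has to be
  attained.\<close>

lemma J1_chart_surj:
  assumes A: "smooth_atlas A" and c: "c \<in> bundle_charts A \<tau>" and m: "m \<in> J1_image c"
  shows "m \<in> J1_chart c ` J1_over A \<tau> c"
proof -
  obtain e where e: "e \<in> fst c" "fst m = snd c e" using m by (auto simp: J1_image_def)
  then have "c \<in> charts_at A \<tau> e" using c by (simp add: charts_at_def)
  from covector_exists[OF A this] obtain a where a: "(e, a) \<in> cotangent_bundle A \<tau>" "a c = (0, snd m)"
    by blast
  have "J1_chart c (rho A \<tau> (e, a)) = m"
    using J1_chart_of_class(2)[OF a(1) c] e a(2) by (simp add: rho_loc_def cot_chart_def prod_eq_iff)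
  moreover have "rho A \<tau> (e, a) \<in> J1_over A \<tau> c"
    using J1_chart_of_class(1)[OF a(1) c] e(1) a(1)
    by (auto simp: J1_over_def J1_dual_def rho_def intro: quotientI)
  ultimately show ?thesis by (rule image_eqI[OF sym])
qed

text \<open>Only the \<open>p\<^sub>0\<close> component of a section is free in coordinates. Its
  negative is the Hamiltonian \<open>H\<close> of the chart.\<close>

lemma local_section_eq:
  assumes A: "smooth_atlas A" and h: "smooth_section A \<tau> h" and c: "c \<in> bundle_charts A \<tau>"
    and m: "m \<in> J1_image c"
  shows "rho_loc (local_section A \<tau> c h m) = m"
proof -
  define k where "k = inv_into (J1_over A \<tau> c) (J1_chart c) m"
  have img: "m \<in> J1_chart c ` J1_over A \<tau> c" by (rule J1_chart_surj[OF A c m])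
  have k: "k \<in> J1_over A \<tau> c" "J1_chart c k = m"
    unfolding k_def using inv_into_into[OF img] f_inv_into_f[OF img] by auto
  then have "k \<in> J1_dual A \<tau>" by (simp add: J1_over_def)
  then have hk: "h k \<in> cotangent_bundle A \<tau>" "rho A \<tau> (h k) = k"
    using h by (auto simp: smooth_section_def)
  have "fst (h k) \<in> fst c"
    using k(1) J1_chart_of_class(1)[OF hk(1) c] hk(2) by (simp add: J1_over_def)
  from J1_chart_of_class(2)[OF hk(1) c this] have "rho_loc (cot_chart c (h k)) = m"
    using k(2) hk(2) by simp
  then show ?thesis unfolding local_section_def k_def .
qed

theorem theorem6:
  fixes A :: "('e::{t2_space,second_countable_topology}, real \<times> (real^'n)) chart set"
    and B :: "('f::{t2_space,second_countable_topology}, real^'n) chart set"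
    and \<tau> :: "'e \<Rightarrow> real"
    and R :: "('e, 'n) tensor11"
    and h :: "('e, 'n) covector set \<Rightarrow> ('e, 'n) covector"
  assumes tau_bundle: "bundle_over_line A B \<tau>"
    and tensor: "smooth_tensor11 A \<tau> R"
    and R_dt: "kills_dt A \<tau> R"
    and torsion: "torsion_free A \<tau> R"
    and diag: "\<And>e c. c \<in> charts_at A \<tau> e \<Longrightarrow> diagonalizable_distinct (R e c)"
    and h_section: "smooth_section A \<tau> h"
    and indep: "\<And>c m. c \<in> bundle_charts A \<tau> \<Longrightarrow> m \<in> J1_image c \<Longrightarrow>
        inj_on (\<lambda>k. iterate (local_tensor c R) (local_section A \<tau> c h) k m) {..CARD('n)}
        \<and> independent
            ((\<lambda>k. iterate (local_tensor c R) (local_section A \<tau> c h) k m) ` {..CARD('n)})"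
  shows "(\<forall>c\<in>bundle_charts A \<tau>. integrable_distribution (J1_image c)
            (D_h (local_tensor c R) (local_section A \<tau> c h)))
     \<longleftrightarrow> (\<forall>c\<in>bundle_charts A \<tau>. \<forall>m\<in>J1_image c.
            \<forall>X\<in>D_h (local_tensor c R) (local_section A \<tau> c h) m.
            \<forall>Y\<in>D_h (local_tensor c R) (local_section A \<tau> c h) m.
              lie_deriv2 (hamiltonian_vf (local_section A \<tau> c h)) (omega_R (local_tensor c R)) m X Y
              = 0)"
\<comment> \<open>The equivalence already holds in each bundle chart separately.\<close>
proof (rule ball_cong[OF refl])
  fix c assume c: "c \<in> bundle_charts A \<tau>"
  have A: "smooth_atlas A" using tau_bundle by (simp add: bundle_over_line_def)
  let ?U = "chart_image c" and ?L = "local_tensor c R" and ?h = "local_section A \<tau> c h"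
  let ?H = "\<lambda>m. - fst (snd (?h m))"
  have chart: "c \<in> charts_at A \<tau> (chart_inv c x)" if "x \<in> ?U" for x
    using c inv_into_into[OF that] by (simp add: charts_at_def)
  have U: "open ?U" using c by (simp add: bundle_charts_def is_chart_def)
  have lin: "linear (?L x)" if "x \<in> ?U" for x
    using tensor chart[OF that] by (simp add: smooth_tensor11_def local_tensor_def)
  have sm: "smooth_on (\<lambda>x. ?L x v) ?U" for v
    using tensor c unfolding smooth_tensor11_def by blast
  have dt: "fst (?L x v) = 0" if "x \<in> ?U" for x v
    using R_dt chart[OF that] unfolding kills_dt_def local_tensor_def by blast
  have tor: "tangent_map (\<lambda>y. ?L y b) x (?L x a) - tangent_map (\<lambda>y. ?L y a) x (?L x b)
       + ?L x (tangent_map (\<lambda>y. ?L y a) x b) - ?L x (tangent_map (\<lambda>y. ?L y b) x a) = 0"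
    if x: "x \<in> ?U" for x a b
  proof -
    \<comment> \<open>On constant fields the bracket of \<open>a\<close> and \<open>b\<close> and
      all derivatives of the arguments vanish, which leaves the identity in terms of
      \<open>?L\<close> and its derivative.\<close>
    have "nijenhuis_torsion ?L (\<lambda>_. a) (\<lambda>_. b) x = 0"
      using torsion c x smooth_on_const unfolding torsion_free_def by blast
    then show ?thesis
      using linear_0[OF lin[OF x]] linear_neg[OF lin[OF x]]
      by (simp add: nijenhuis_torsion_def lie_bracket_def)
  qed
  have "smooth_on ?h (J1_image c)" using h_section c by (simp add: smooth_section_def)
  then have smH: "smooth_on ?H (?U \<times> UNIV)"
    unfolding J1_image_def
    by (intro smooth_on_minus smooth_on_bounded_linear[of _ ?h "\<lambda>z. fst (snd z)"] open_Times U open_UNIV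
        bounded_linear_compose[OF bounded_linear_fst bounded_linear_snd])
  interpret jet_system ?U ?L ?H
    by (rule jet_system.intro[OF U sm lin dt tor smH])
  have sect: "?h m = (fst m, hm m)" if "m \<in> ?U \<times> UNIV" for m
    using local_section_eq[OF A h_section c, of m] that
    by (auto simp: J1_image_def rho_loc_def hm_def prod_eq_iff)
  show "integrable_distribution (J1_image c) (D_h ?L ?h) \<longleftrightarrow>
    (\<forall>m\<in>J1_image c. \<forall>X\<in>D_h ?L ?h m. \<forall>Y\<in>D_h ?L ?h m.
       lie_deriv2 (hamiltonian_vf ?h) (omega_R ?L) m X Y = 0)"
    unfolding J1_image_def
    by (rule integrable_iff_lie_deriv_zero[OF sect indep[OF c, unfolded J1_image_def]])
qed

end
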